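(* Let $1\le p<\infty$, $0<q<\infty$ and $\nu\in\mathcal{D}\cap\widehat{\mathcal{D}}_q$. Then there exist positive constants $C_1$ and $C_2$ depending only on $p$, $q$ and $\nu$ such that $$\begin{aligned}\|f'\|_{A^{p,q}_\nu}^q&\le\int_0^1\left(\int_0^{2\pi}\left(\int_0^{2\pi}|f(e^{i\theta})-f(re^{it})|\,d\mu_{re^{it}}(\theta)\right)^p dt\right)^{q/p}\frac{\nu(r)}{(1-r)^q}\,dr\\&\le C_1\left(\int_0^1\omega_p(1-s,f)^q\,\frac{\nu(s)}{(1-s)^q}\,ds+\|f\|_{H^p}^q\right)\\&\le C_2\left(\|f'\|_{A^{p,q}_\nu}^q+\|f\|_{H^p}^q\right)\end{aligned}$$ for all $f\in H^p$.
   Context: $\mathbb{D}$ is the open unit disc of $\mathbb{C}$, $\mathbb{T}$ its boundary, and $\mathcal{H}(\mathbb{D})$ the set of analytic functions in $\mathbb{D}$. For $f\in\mathcal{H}(\mathbb{D})$, $0<p<\infty$ and $0\le r<1$ let $M_p(r,f)=\left(\frac1{2\pi}\int_0^{2\pi}|f(re^{i\theta})|^p\,d\theta\right)^{1/p}$. The Hardy space $H^p$ consists of $f\in\mathcal{H}(\mathbb{D})$ with $\|f\|_{H^p}=\sup_{0\le r<1}M_p(r,f)<\infty$; for $f\in H^p$, $f(e^{i\theta})$ denotes the non-tangential limit, which exists almost everywhere. A weight is a function $\nu:\mathbb{D}\to[0,\infty)$ that is integrable over $\mathbb{D}$ and radial, $\nu(z)=\nu(|z|)$. Put $\widehat\nu(z)=\widehat\nu(|z|)=\int_{|z|}^1\nu(s)\,ds$;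 it is understood that $\widehat\nu(r)>0$ for all $0\le r<1$. Write $\nu\in\widehat{\mathcal{D}}$ if there is $C=C(\nu)>0$ with $\widehat\nu(r)\le C\,\widehat\nu\left(\frac{1+r}{2}\right)$ for all $0\le r<1$. Write $\nu\in\check{\mathcal{D}}$ if there are $K=K(\nu)>1$ and $C=C(\nu)>1$ with $\widehat\nu(r)\ge C\,\widehat\nu\left(1-\frac{1-r}{K}\right)$ for all $0\le r<1$. Set $\mathcal{D}=\widehat{\mathcal{D}}\cap\check{\mathcal{D}}$. For $0<q<\infty$, $\widehat{\mathcal{D}}_q$ is the subclass of those $\nu\in\widehat{\mathcal{D}}$ with $$\sup_{0\le r<1}\frac{(1-r)^q}{\widehat\nu(r)}\int_0^r\frac{\nu(s)}{(1-s)^q}\,ds<\infty.$$ For $g\in\mathcal{H}(\mathbb{D})$, $\|g\|_{A^{p,q}_\nu}^q=\int_0^1M_p(r,g)^q\,\nu(r)\,dr\in[0,\infty]$. The $L^p$ modulus of continuity is $\omega_p(t,f)=\sup_{0<h<t}\left(\int_0^{2\pi}|f(e^{i(\theta+h)})-f(e^{i\theta})|^p\,d\theta\right)^{1/p}$ for $0<t\le2\pi$. For $z\in\mathbb{D}$, $\mu_z$ is the measure on $[0,2\pi)$ given by $d\mu_z(\theta)=\frac{1-|z|^2}{|e^{i\theta}-z|^2}\,\frac{d\theta}{2\pi}$. Each expression in the chain may take the value $+\infty$. *)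

theory Defs
  imports "HOL-Complex_Analysis.Complex_Analysis"
begin

text \<open>All (quasi-)norms and integrals are taken in \<^typ>\<open>ennreal\<close>, so that each of them
  may be infinite.  The library has no real powers on \<^typ>\<open>ennreal\<close>; the following is only
  used for exponents \<^term>\<open>a > 0\<close>.\<close>

definition ennpowr :: "ennreal \<Rightarrow> real \<Rightarrow> ennreal" where
  "ennpowr x a = (if x = \<infinity> then \<infinity> else ennreal (enn2real x powr a))"

definition Mp :: "real \<Rightarrow> real \<Rightarrow> (complex \<Rightarrow> complex) \<Rightarrow> ennreal" where
  "Mp p r f = ennpowr (ennreal (1 / (2 * pi)) *
     (\<integral>\<^sup>+\<theta>\<in>{0..2*pi}. ennreal (cmod (f (of_real r * cis \<theta>)) powr p) \<partial>lebesgue)) (1 / p)"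

definition hardy_norm :: "real \<Rightarrow> (complex \<Rightarrow> complex) \<Rightarrow> ennreal" where
  "hardy_norm p f = (SUP r\<in>{0..<1}. Mp p r f)"

definition hardy_space :: "real \<Rightarrow> (complex \<Rightarrow> complex) set" where
  "hardy_space p = {f. f holomorphic_on ball 0 1 \<and> hardy_norm p f < \<infinity>}"

definition stolz_region :: "real \<Rightarrow> complex \<Rightarrow> complex set" where
  "stolz_region a \<zeta> = {z. cmod z < 1 \<and> cmod (z - \<zeta>) < a * (1 - cmod z)}"

definition has_nontangential_limit :: "(complex \<Rightarrow> complex) \<Rightarrow> complex \<Rightarrow> complex \<Rightarrow> bool" where
  "has_nontangential_limit f L \<zeta> \<longleftrightarrow> (\<forall>a>1. (f \<longlongrightarrow> L) (at \<zeta> within stolz_region a \<zeta>))"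

text \<open>The boundary function of \<^term>\<open>f\<close>, meaningful at the points of the unit circle where the
  non-tangential limit exists.  For functions in \<^term>\<open>hardy_space p\<close> the remaining points of the
  circle form a null set, on which the value is an irrelevant constant.\<close>

definition boundary_value :: "(complex \<Rightarrow> complex) \<Rightarrow> complex \<Rightarrow> complex" where
  "boundary_value f \<zeta> = (THE L. has_nontangential_limit f L \<zeta>)"

text \<open>Only the values of a weight on the unit disc matter.\<close>

definition radial_weight :: "(complex \<Rightarrow> real) \<Rightarrow> bool" where
  "radial_weight \<nu> \<longleftrightarrow>
     set_integrable lebesgue (ball 0 1) \<nu> \<and>
     (\<forall>z\<in>ball 0 1. 0 \<le> \<nu> z \<and> \<nu> z = \<nu> (of_real (cmod z)))"

definition tail :: "(complex \<Rightarrow> real) \<Rightarrow> real \<Rightarrow> ennreal" where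
  "tail \<nu> r = (\<integral>\<^sup>+s\<in>{r..<1}. ennreal (\<nu> (of_real s)) \<partial>lebesgue)"

definition weights :: "(complex \<Rightarrow> real) set" where
  "weights = {\<nu>. radial_weight \<nu> \<and> (\<forall>r\<in>{0..<1}. tail \<nu> r > 0)}"

definition D_hat :: "(complex \<Rightarrow> real) set" where
  "D_hat = {\<nu>\<in>weights. \<exists>C>0. \<forall>r\<in>{0..<1}. tail \<nu> r \<le> ennreal C * tail \<nu> ((1 + r) / 2)}"

definition D_check :: "(complex \<Rightarrow> real) set" where
  "D_check = {\<nu>\<in>weights. \<exists>K>1. \<exists>C>1. \<forall>r\<in>{0..<1}.
     tail \<nu> r \<ge> ennreal C * tail \<nu> (1 - (1 - r) / K)}"

definition D_class :: "(complex \<Rightarrow> real) set" where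
  "D_class = D_hat \<inter> D_check"

definition D_hat_sub :: "real \<Rightarrow> (complex \<Rightarrow> real) set" where
  "D_hat_sub q = {\<nu>\<in>D_hat.
     (SUP r\<in>{0..<1}. ennreal ((1 - r) powr q) / tail \<nu> r *
        (\<integral>\<^sup>+s\<in>{0..r}. ennreal (\<nu> (of_real s) / (1 - s) powr q) \<partial>lebesgue)) < \<infinity>}"

text \<open>The \<^term>\<open>q\<close>-th power of the norm in the weighted mixed norm space.\<close>

definition mixed_norm_pow :: "real \<Rightarrow> real \<Rightarrow> (complex \<Rightarrow> real) \<Rightarrow> (complex \<Rightarrow> complex) \<Rightarrow> ennreal" where
  "mixed_norm_pow p q \<nu> g =
     (\<integral>\<^sup>+r\<in>{0..<1}. ennpowr (Mp p r g) q * ennreal (\<nu> (of_real r)) \<partial>lebesgue)"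

definition Lp_modulus :: "real \<Rightarrow> real \<Rightarrow> (complex \<Rightarrow> complex) \<Rightarrow> ennreal" where
  "Lp_modulus p t f = (SUP h\<in>{0<..<t}. ennpowr
     (\<integral>\<^sup>+\<theta>\<in>{0..2*pi}. ennreal (cmod (boundary_value f (cis (\<theta> + h)) - boundary_value f (cis \<theta>)) powr p)
        \<partial>lebesgue) (1 / p))"

definition poisson_measure :: "complex \<Rightarrow> real measure" where
  "poisson_measure z = density (lebesgue_on {0..<2*pi})
     (\<lambda>\<theta>. ennreal ((1 - (cmod z)\<^sup>2) / (cmod (cis \<theta> - z))\<^sup>2 * (1 / (2 * pi))))"

end

theory Submission
  imports Defs "HOL-Real_Asymp.Real_Asymp"
begin

text \<open>Let \<open>\<psi>\<close> be the boundary function of \<open>f\<close>.  Applying the Poisson inequality to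
  \<open>(F - F z) / b\<close>, where \<open>b\<close> is the Blaschke factor at \<open>z\<close>, bounds \<open>(1 - |z|^2) |f' z|\<close> by the Poisson
  mean of \<open>|\<psi> - f z|\<close>, which gives the first inequality.  Minkowski's inequality and a dyadic
  decomposition of the Poisson kernel bound the middle term by sums of moduli of continuity at dyadic
  scales; conversely a modulus of continuity is at most an integral of the means of \<open>f'\<close>.  The
  conditions on the weight enter as geometric growth or decay of its dyadic tails, under which the
  resulting sums obey discrete Hardy inequalities.

  That \<open>\<psi>\<close> exists and represents \<open>f\<close>, also for \<open>p = 1\<close>, follows from a complex convexity
  property of \<open>L^1\<close>: writing \<open>F = u v\<close> with \<open>|u|^2 = |v|^2 = |F|\<close> on the circle, the distance in
  \<open>L^1\<close> between two dilations of \<open>f\<close> is controlled by the increment of the integral means of \<open>|f|\<close>,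
  which are monotone and bounded.  A weak type estimate turns this into nontangential convergence.\<close>

section \<open>Powers and Minkowski's inequality for extended nonnegative reals\<close>

text \<open>Since \<open>q\<close> may be less than 1, no triangle inequality is available for the
  radial integrals; replacing them by dyadic sums leaves inequalities between sequences that hold
  for every \<open>q\<close>. The two sequences that occur, \<open>2^k\<close> times the modulus at
  \<open>2^-k\<close> and the means of \<open>f'\<close> at \<open>1 - 2^-k\<close>, are both
  increasing. This is essential, because the masses \<open>m n\<close> of single dyadic blocks may
  vanish and are not comparable with each other. The Hardy inequalities are therefore proved for the
  tails \<open>T n\<close>, and monotonicity allows the return from tails to masses: a fixed number
  of consecutive blocks carries a fixed proportion of each tail.

  On the side of \<open>f\<close> the obstacle is that bounded means do not by themselves make
  dilations converge when \<open>p = 1\<close>. Convergence is only needed in \<open>L^1\<close>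
  along one sequence of radii, whatever \<open>p\<close> is, because for fixed \<open>z\<close> the
  Poisson kernel is bounded. The radii avoid the moduli of the zeros of \<open>f\<close>, so that
  the factorization with equal moduli on the circle exists.\<close>

lemma ennpowr_ennreal: "0 \<le> x \<Longrightarrow> ennpowr (ennreal x) a = ennreal (x powr a)"
  by (simp add: ennpowr_def)

lemma ennpowr_top [simp]: "ennpowr top a = top"
  by (simp add: ennpowr_def)

lemma ennpowr_0 [simp]: "ennpowr 0 a = 0"
  by (simp add: ennpowr_def)

lemma ennpowr_1 [simp]: "ennpowr x 1 = x"
  by (cases x) (simp_all add: ennpowr_ennreal)

lemma ennpowr_mono: "x \<le> y \<Longrightarrow> 0 \<le> a \<Longrightarrow> ennpowr x a \<le> ennpowr y a"
  by (cases x; cases y) (auto simp: ennpowr_ennreal top_unique intro!: ennreal_leI powr_mono2)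

lemma ennpowr_mult: "ennpowr (x * y) a = ennpowr x a * ennpowr y a"
proof (cases x)
  case (real r)
  show ?thesis
  proof (cases y)
    case y: (real s)
    then show ?thesis using real
      by (simp add: ennpowr_ennreal powr_mult flip: ennreal_mult)
  next
    case top
    then show ?thesis using real
      by (cases "r = 0") (auto simp: ennpowr_ennreal ennreal_mult_top)
  qed
next
  case top
  then show ?thesis
    by (cases y) (auto simp: ennpowr_ennreal ennreal_top_mult powr_eq_0_iff)
qed

lemma ennpowr_ennpowr: "ennpowr (ennpowr x a) b = ennpowr x (a * b)"
  by (cases x) (simp_all add: ennpowr_ennreal powr_powr)

lemma ennpowr_le_iff: "0 < a \<Longrightarrow> ennpowr x a \<le> ennpowr y a \<longleftrightarrow> x \<le> y"
proof
  assume a: "0 < a" and le: "ennpowr x a \<le> ennpowr y a"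
  have "ennpowr (ennpowr x a) (1/a) \<le> ennpowr (ennpowr y a) (1/a)"
    by (rule ennpowr_mono) (use le a in auto)
  then show "x \<le> y" using a by (simp add: ennpowr_ennpowr)
qed (simp add: ennpowr_mono)

lemma ennpowr_eq_top_iff [simp]: "ennpowr x a = top \<longleftrightarrow> x = top"
  by (cases x) (simp_all add: ennpowr_ennreal)

lemma ennpowr_less_top_iff [simp]: "ennpowr x a < top \<longleftrightarrow> x < top"
  by (cases x) (simp_all add: ennpowr_ennreal)

lemma ennpowr_eq_0_iff [simp]: "ennpowr x a = 0 \<longleftrightarrow> x = 0"
  by (cases x) (simp_all add: ennpowr_ennreal)

lemma ennpowr_mult_inverse:
  assumes "x \<noteq> 0" "x < top" shows "ennpowr x a * ennpowr (inverse x) a = 1"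
proof -
  obtain r where r: "x = ennreal r" "r > 0" using assms by (cases x) auto
  then show ?thesis by (simp add: inverse_ennreal ennpowr_ennreal flip: ennreal_mult powr_mult)
qed

lemma borel_measurable_ennpowr [measurable (raw)]:
  assumes [measurable]: "f \<in> borel_measurable M"
  shows "(\<lambda>x. ennpowr (f x) a) \<in> borel_measurable M"
  unfolding ennpowr_def by measurable

section \<open>Jensen's inequality for powers\<close>

lemma powr_tangent_le:
  fixes a x p :: real
  assumes p: "1 \<le> p" and a: "0 < a" and x: "0 \<le> x"
  shows "p * a powr (p - 1) * x \<le> x powr p + (p - 1) * a powr p"
proof (cases "x = 0")
  case True
  then show ?thesis using p by simp
next
  case False
  have eq: "a powr p = a powr (p-1) * a"
    using a by (simp add: powr_diff)
  have "p * a powr (p - 1) * (x - a) \<le> x powr p - a powr p"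
  proof (rule convex_on_imp_above_tangent[OF powr_convex[OF p]])
    show "((\<lambda>x. x powr p) has_real_derivative p * a powr (p - 1)) (at a within {0<..})"
      using a by (auto intro!: derivative_eq_intros simp: powr_diff field_simps)
  qed (use a x False in \<open>auto simp: interior_open\<close>)
  then show ?thesis
    unfolding eq by (simp add: algebra_simps)
qed

lemma ennpowr_tangent_le:
  assumes p: "1 \<le> p" and a: "0 < a"
  shows "ennreal (p * a powr (p - 1)) * x \<le> ennpowr x p + ennreal ((p - 1) * a powr p)"
proof (cases x)
  case (real r)
  then show ?thesis
    using powr_tangent_le[OF p a, of r] p a
    by (simp add: ennpowr_ennreal flip: ennreal_mult ennreal_plus)
qed simp

text \<open>Jensen's inequality: the tangent of the \<open>p\<close>-th power at the mean
  \<open>r\<close> is integrated. The tangent inequality is kept in additive form, with the constant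
  on the right, since subtraction on \<open>ennreal\<close> truncates.\<close>

lemma ennpowr_nn_integral_le:
  assumes M: "emeasure M (space M) = 1" and [measurable]: "f \<in> borel_measurable M" and p: "1 \<le> p"
  shows "ennpowr (\<integral>\<^sup>+x. f x \<partial>M) p \<le> (\<integral>\<^sup>+x. ennpowr (f x) p \<partial>M)"
proof (cases "\<integral>\<^sup>+x. f x \<partial>M")
  case (real r)
  show ?thesis
  proof (cases "r = 0")
    case False
    with real have r: "r > 0" by simp
    have "ennreal (p * r powr (p - 1)) * (\<integral>\<^sup>+x. f x \<partial>M) =
        (\<integral>\<^sup>+x. ennreal (p * r powr (p - 1)) * f x \<partial>M)"
      by (simp add: nn_integral_cmult)
    also have "\<dots> \<le> (\<integral>\<^sup>+x. ennpowr (f x) p + ennreal ((p - 1) * r powr p) \<partial>M)"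
      by (intro nn_integral_mono ennpowr_tangent_le p r)
    also have "\<dots> = (\<integral>\<^sup>+x. ennpowr (f x) p \<partial>M) + ennreal ((p - 1) * r powr p)"
      by (subst nn_integral_add) (auto simp: M)
    finally have "ennreal (p * r powr p) \<le> (\<integral>\<^sup>+x. ennpowr (f x) p \<partial>M) + ennreal ((p - 1) * r powr p)"
      using r p real by (simp add: powr_diff flip: ennreal_mult)
    moreover have "ennreal (p * r powr p) = ennreal (r powr p) + ennreal ((p - 1) * r powr p)"
      using p using mult_right_mono[of 1 p "r powr p"] by (subst ennreal_plus[symmetric]) (auto simp: algebra_simps)
    ultimately show ?thesis
      using real r by (simp add: ennpowr_ennreal add.commute[of _ "ennreal ((p - 1) * r powr p)"])
  qed (use real in simp)
next
  \<comment> \<open>An infinite mean makes the right side infinite as well, because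
    \<open>f \<le> 1 + f^p\<close> and the total mass is 1.\<close>
  case top
  have "f x \<le> 1 + ennpowr (f x) p" for x
    using ennpowr_tangent_le[OF p, of 1 "f x"] p
  proof (cases "f x")
    case (real r)
    have "r \<le> 1 + r powr p"
    proof (cases "r \<le> 1")
      case False
      then have "r powr 1 \<le> r powr p" using p by (intro powr_mono) auto
      with False show ?thesis by simp
    qed (use powr_ge_zero[of r p] in linarith)
    then show ?thesis
      using real by (simp add: ennpowr_ennreal flip: ennreal_plus ennreal_1)
  qed simp
  then have "(\<integral>\<^sup>+x. f x \<partial>M) \<le> (\<integral>\<^sup>+x. 1 + ennpowr (f x) p \<partial>M)"
    by (intro nn_integral_mono) auto
  also have "\<dots> = 1 + (\<integral>\<^sup>+x. ennpowr (f x) p \<partial>M)"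
    by (subst nn_integral_add) (auto simp: M)
  finally show ?thesis using top by (simp add: top_unique)
qed

section \<open>Lp norms and Minkowski's inequality\<close>

definition Lpn :: "'a measure \<Rightarrow> real \<Rightarrow> ('a \<Rightarrow> ennreal) \<Rightarrow> ennreal" where
  "Lpn M p F = ennpowr (\<integral>\<^sup>+x. ennpowr (F x) p \<partial>M) (1 / p)"

lemma ennpowr_Lpn: "p \<noteq> 0 \<Longrightarrow> ennpowr (Lpn M p F) a = ennpowr (\<integral>\<^sup>+x. ennpowr (F x) p \<partial>M) (a / p)"
  by (simp add: Lpn_def ennpowr_ennpowr)

lemma Lpn_mono_AE:
  assumes "0 < p" "AE x in M. F x \<le> G x" shows "Lpn M p F \<le> Lpn M p G"
  unfolding Lpn_def using assms
  by (intro ennpowr_mono nn_integral_mono_AE) (auto elim!: eventually_mono intro!: ennpowr_mono)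

lemma Lpn_mono: "0 < p \<Longrightarrow> (\<And>x. F x \<le> G x) \<Longrightarrow> Lpn M p F \<le> Lpn M p G"
  by (simp add: Lpn_mono_AE)

lemma Lpn_cmult:
  assumes [measurable]: "F \<in> borel_measurable M" and p: "0 < p"
  shows "Lpn M p (\<lambda>x. c * F x) = c * Lpn M p F"
  using p by (simp add: Lpn_def ennpowr_mult nn_integral_cmult ennpowr_ennpowr)

lemma Lpn_const: "p \<noteq> 0 \<Longrightarrow> Lpn M p (\<lambda>x. c) = c * ennpowr (emeasure M (space M)) (1/p)"
  by (simp add: Lpn_def ennpowr_mult ennpowr_ennpowr)

lemma Lpn_1: "Lpn M 1 F = (\<integral>\<^sup>+x. F x \<partial>M)"
  by (simp add: Lpn_def)

text \<open>Jensen's inequality is applied to the probability measure with density proportional to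
  the norms of the slices; adding a small positive integrable function avoids dividing by zero.\<close>

lemma Lpn_nn_integral_le:
  assumes M: "sigma_finite_measure M" and N: "sigma_finite_measure N" and p: "1 \<le> p"
    and F [measurable]: "(\<lambda>(x, t). F x t) \<in> borel_measurable (N \<Otimes>\<^sub>M M)"
  shows "Lpn M p (\<lambda>t. \<integral>\<^sup>+x. F x t \<partial>N) \<le> (\<integral>\<^sup>+x. Lpn M p (F x) \<partial>N)"
proof -
  interpret M: sigma_finite_measure M by fact
  interpret N: sigma_finite_measure N by fact
  interpret NM: pair_sigma_finite N M ..
  have p0: "p \<noteq> 0" "p > 0" using p by auto
  define L where "L x = Lpn M p (F x)" for x
  have [measurable]: "L \<in> borel_measurable N"
    unfolding L_def Lpn_def by measurable
  show ?thesis
  proof (cases "(\<integral>\<^sup>+x. L x \<partial>N) < top")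
    case False
    then have "(\<integral>\<^sup>+x. L x \<partial>N) = top" using less_top by blast
    then show ?thesis by (simp add: L_def)
  next
    case fin: True
    obtain h where [measurable]: "h \<in> borel_measurable N" and h: "integral\<^sup>N N h \<noteq> top"
       "\<And>x. x \<in> space N \<Longrightarrow> 0 < h x \<and> h x < top"
      using N.Ex_finite_integrable_function by auto
    obtain H where H: "integral\<^sup>N N h = ennreal H" "0 \<le> H"
      using h(1) by (cases "integral\<^sup>N N h") auto
    have *: "Lpn M p (\<lambda>t. \<integral>\<^sup>+x. F x t \<partial>N) \<le> (\<integral>\<^sup>+x. L x \<partial>N) + ennreal e" if e: "0 < e" for e :: real
    proof (cases "AE x in N. False")
      \<comment> \<open>For a null measure \<open>N\<close> the normalizing constant
        \<open>k\<close> below would be 0; here both sides of the inequality vanish.\<close>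
      case True
      then have "(\<integral>\<^sup>+x. f x \<partial>N) = 0" for f
        by (subst nn_integral_cong_AE[of _ "\<lambda>_. 0"]) auto
      then show ?thesis by (simp add: Lpn_const p0)
    next
      case ne: False
      \<comment> \<open>Since \<open>d * H \<le> e\<close>, adding \<open>d * h\<close> to the slice
        norms raises their integral by at most \<open>e\<close>.\<close>
      define d where "d = e / (H + 1)"
      have d: "d > 0" "d * H \<le> e" using e H by (auto simp: d_def field_simps)
      define K where "K x = L x + ennreal d * h x" for x
      have [measurable]: "K \<in> borel_measurable N" unfolding K_def by measurable
      have K_pos: "0 < K x" if "x \<in> space N" for x
        using h(2)[OF that] d by (auto simp: K_def intro!: add_nonneg_pos ennreal_zero_less_mult_iff[THEN iffD2])
      define k where "k = (\<integral>\<^sup>+x. K x \<partial>N)"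
      have k_eq: "k = (\<integral>\<^sup>+x. L x \<partial>N) + ennreal (d * H)"
        unfolding k_def K_def using d H by (simp add: nn_integral_add nn_integral_cmult ennreal_mult)
      then have k_le: "k \<le> (\<integral>\<^sup>+x. L x \<partial>N) + ennreal e"
        using d by (auto intro!: add_left_mono ennreal_leI)
      have k_fin: "k < top" using fin by (simp add: k_eq)
      have k_pos: "k \<noteq> 0"
      proof
        assume "k = 0"
        then have "AE x in N. K x = 0" by (simp add: k_def nn_integral_0_iff_AE)
        then have "AE x in N. h x = 0" using AE_space
          by eventually_elim (use K_pos in force)
        then have "AE x in N. False" using AE_space
          by eventually_elim (use h(2) in force)
        with ne show False by simp
      qed
      define P where "P = density N (\<lambda>x. K x / k)"
      have meas_P [measurable_cong]: "sets P = sets N" by (simp add: P_def)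
      have P1: "emeasure P (space P) = 1"
      proof -
        have "emeasure P (space P) = (\<integral>\<^sup>+x. K x / k \<partial>N)"
          unfolding P_def by (simp add: emeasure_density cong: nn_integral_cong)
        also have "\<dots> = k / k" unfolding k_def by (rule nn_integral_divide) simp
        finally show ?thesis using k_fin k_pos by (simp add: ennreal_divide_self)
      qed
      have K_fin: "AE x in N. K x < top"
        using nn_integral_PInf_AE[of K N] k_fin by (auto simp: k_def less_top)
      have "(\<integral>\<^sup>+t. ennpowr (\<integral>\<^sup>+x. F x t \<partial>N) p \<partial>M) \<le>
          (\<integral>\<^sup>+t. ennpowr k p * (\<integral>\<^sup>+x. K x / k * ennpowr (F x t * inverse (K x)) p \<partial>N) \<partial>M)"
      proof (rule nn_integral_mono)
        fix t assume [measurable]: "t \<in> space M"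
        have "(\<integral>\<^sup>+x. F x t \<partial>N) = (\<integral>\<^sup>+x. k * (K x / k * (F x t * inverse (K x))) \<partial>N)"
        proof (rule nn_integral_cong_AE)
          \<comment> \<open>Where \<open>K x\<close> is finite and positive all factors cancel, so
            the integral of \<open>F\<close> is \<open>k\<close> times the mean, for the probability
            measure \<open>P\<close>, of the normalized slices \<open>F x t / K x\<close>.\<close>
          show "AE x in N. F x t = k * (K x / k * (F x t * inverse (K x)))"
            using K_fin AE_space
          proof eventually_elim
            case (elim x)
            obtain a b where "K x = ennreal a" "a > 0" "k = ennreal b" "b > 0"
              using elim K_pos[of x] k_pos k_fin by (cases "K x"; cases k) auto
            then have "k * inverse k = 1" "K x * inverse (K x) = 1"
              by (auto simp: inverse_ennreal simp flip: ennreal_mult)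
            moreover have "k * (K x / k * (F x t * inverse (K x))) = (k * inverse k) * (K x * inverse (K x)) * F x t"
              by (simp only: divide_ennreal_def ac_simps)
            ultimately show ?case by simp
          qed
        qed
        also have "\<dots> = k * (\<integral>\<^sup>+x. F x t * inverse (K x) \<partial>P)"
          unfolding P_def by (simp add: nn_integral_cmult nn_integral_density)
        also have "ennpowr \<dots> p \<le> ennpowr k p * (\<integral>\<^sup>+x. ennpowr (F x t * inverse (K x)) p \<partial>P)"
          unfolding ennpowr_mult[of k] by (intro mult_left_mono ennpowr_nn_integral_le P1 p) auto
        also have "(\<integral>\<^sup>+x. ennpowr (F x t * inverse (K x)) p \<partial>P) =
            (\<integral>\<^sup>+x. K x / k * ennpowr (F x t * inverse (K x)) p \<partial>N)"
          unfolding P_def by (simp add: nn_integral_density)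
        finally show "ennpowr (\<integral>\<^sup>+x. F x t \<partial>N) p \<le>
          ennpowr k p * (\<integral>\<^sup>+x. K x / k * ennpowr (F x t * inverse (K x)) p \<partial>N)" .
      qed
      also have "\<dots> = ennpowr k p * (\<integral>\<^sup>+t. (\<integral>\<^sup>+x. K x / k * ennpowr (F x t * inverse (K x)) p \<partial>N) \<partial>M)"
        by (rule nn_integral_cmult) measurable
      also have "(\<integral>\<^sup>+t. (\<integral>\<^sup>+x. K x / k * ennpowr (F x t * inverse (K x)) p \<partial>N) \<partial>M) =
         (\<integral>\<^sup>+x. (\<integral>\<^sup>+t. K x / k * ennpowr (F x t * inverse (K x)) p \<partial>M) \<partial>N)"
        by (rule NM.Fubini') measurable
      also have "\<dots> \<le> (\<integral>\<^sup>+x. K x / k \<partial>N)"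
      proof (rule nn_integral_mono_AE)
        show "AE x in N. (\<integral>\<^sup>+t. K x / k * ennpowr (F x t * inverse (K x)) p \<partial>M) \<le> K x / k"
          using K_fin AE_space
        proof eventually_elim
          case (elim x)
          note [measurable] = elim(2)
          have "(\<integral>\<^sup>+t. K x / k * ennpowr (F x t * inverse (K x)) p \<partial>M) =
              K x / k * (ennpowr (L x) p * ennpowr (inverse (K x)) p)"
            using p0 by (simp add: nn_integral_cmult nn_integral_multc ennpowr_mult L_def ennpowr_Lpn)
          also have "\<dots> \<le> K x / k * (ennpowr (K x) p * ennpowr (inverse (K x)) p)"
            using p0 by (intro mult_left_mono mult_right_mono ennpowr_mono) (auto simp: K_def)
          also have "\<dots> = K x / k"
            using K_pos[OF elim(2)] elim(1) by (simp add: ennpowr_mult_inverse)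
          finally show ?case .
        qed
      qed
      also have "\<dots> = k / k" unfolding k_def by (rule nn_integral_divide) simp
      also have "\<dots> = 1" using k_fin k_pos by (simp add: ennreal_divide_self)
      finally have "(\<integral>\<^sup>+t. ennpowr (\<integral>\<^sup>+x. F x t \<partial>N) p \<partial>M) \<le> ennpowr k p"
        by (simp add: mult_left_mono)
      then have "Lpn M p (\<lambda>t. \<integral>\<^sup>+x. F x t \<partial>N) \<le> ennpowr (ennpowr k p) (1/p)"
        unfolding Lpn_def using p by (intro ennpowr_mono) auto
      also have "\<dots> = k" using p0 by (simp add: ennpowr_ennpowr)
      finally show ?thesis using k_le by simp
    qed
    show ?thesis
      unfolding L_def[symmetric] by (rule ennreal_le_epsilon) (rule *)
  qed
qed

text \<open>The integral form of Minkowski's inequality, with the counting measure on two points in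
  place of \<open>N\<close>.\<close>

lemma Lpn_add_le:
  assumes M: "sigma_finite_measure M" and p: "1 \<le> p"
    and [measurable]: "F \<in> borel_measurable M" "G \<in> borel_measurable M"
  shows "Lpn M p (\<lambda>x. F x + G x) \<le> Lpn M p F + Lpn M p G"
proof -
  let ?N = "count_space (UNIV :: bool set)"
  have "Lpn M p (\<lambda>t. \<integral>\<^sup>+b. (if b then F t else G t) \<partial>?N) \<le>
      (\<integral>\<^sup>+b. Lpn M p (\<lambda>t. if b then F t else G t) \<partial>?N)"
  proof (rule Lpn_nn_integral_le[OF M _ p])
    show "sigma_finite_measure ?N" by (rule sigma_finite_measure_count_space)
    show "(\<lambda>(b, t). if b then F t else G t) \<in> borel_measurable (?N \<Otimes>\<^sub>M M)"
      by measurable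
  qed
  then show ?thesis
    by (simp add: nn_integral_count_space_finite UNIV_bool add.commute)
qed

section \<open>Lower integrals of non-measurable functions\<close>

text \<open>The radial profile of a weight is not known to be measurable; the library's integral of a
  non-measurable function is the lower integral, for which the following facts remain true.\<close>

lemma nn_integral_minorant:
  obtains g where "g \<in> borel_measurable M" "\<And>x. g x \<le> f x" "(\<integral>\<^sup>+x. g x \<partial>M) = (\<integral>\<^sup>+x. f x \<partial>M)"
proof -
  let ?S = "{g. simple_function M g \<and> g \<le> f}"
  have "?S \<noteq> {}"
    using simple_function_const[of M 0] by (auto simp: le_fun_def intro!: exI[of _ "\<lambda>_. 0"])
  from ennreal_SUP_countable_SUP[OF this, of "integral\<^sup>S M"]
  obtain v :: "nat \<Rightarrow> ennreal" where v: "range v \<subseteq> integral\<^sup>S M ` ?S" and eq: "(SUP g\<in>?S. integral\<^sup>S M g) = Sup (range v)"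
    by blast
  have "\<forall>i. \<exists>s. s \<in> ?S \<and> v i = integral\<^sup>S M s" using v by blast
  then obtain s where s: "\<And>i. s i \<in> ?S" "\<And>i. v i = integral\<^sup>S M (s i)" by metis
  \<comment> \<open>Countably many simple minorants already approach the lower integral; their
    pointwise supremum is a measurable minorant that attains it.\<close>
  define g where "g x = (SUP i. s i x)" for x
  have sm: "simple_function M (s i)" for i using s by auto
  note [measurable] = borel_measurable_simple_function[OF sm]
  have g [measurable]: "g \<in> borel_measurable M" unfolding g_def by measurable
  have gf: "g x \<le> f x" for x
    unfolding g_def using s(1) by (auto intro!: SUP_least simp: le_fun_def)
  have "v i \<le> (\<integral>\<^sup>+x. g x \<partial>M)" for i
    unfolding s(2) nn_integral_eq_simple_integral[OF sm, symmetric]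
    by (intro nn_integral_mono) (auto simp: g_def intro: SUP_upper)
  then have "(\<integral>\<^sup>+x. f x \<partial>M) \<le> (\<integral>\<^sup>+x. g x \<partial>M)"
    unfolding nn_integral_def[of M f] eq by (auto intro!: SUP_least)
  moreover have "(\<integral>\<^sup>+x. g x \<partial>M) \<le> (\<integral>\<^sup>+x. f x \<partial>M)" by (intro nn_integral_mono gf)
  ultimately show ?thesis using that[OF g gf] by auto
qed

lemma lower_integral_cmult_ge: "c * (\<integral>\<^sup>+x. f x \<partial>M) \<le> (\<integral>\<^sup>+x. c * f x \<partial>M)"
proof -
  obtain g where [measurable]: "g \<in> borel_measurable M" and g: "\<And>x. g x \<le> f x"
    "(\<integral>\<^sup>+x. g x \<partial>M) = (\<integral>\<^sup>+x. f x \<partial>M)"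
    using nn_integral_minorant[of M f] by metis
  have "c * (\<integral>\<^sup>+x. f x \<partial>M) = (\<integral>\<^sup>+x. c * g x \<partial>M)"
    by (simp add: g(2)[symmetric] nn_integral_cmult)
  also have "\<dots> \<le> (\<integral>\<^sup>+x. c * f x \<partial>M)" by (intro nn_integral_mono mult_left_mono g) simp
  finally show ?thesis .
qed

text \<open>The inequality \<open>lower_integral_cmult_ge\<close> is applied a second time with the
  inverse factor, which is why \<open>c\<close> has to be finite.\<close>

lemma lower_integral_cmult:
  assumes c: "c < top"
  shows "(\<integral>\<^sup>+x. c * f x \<partial>M) = c * (\<integral>\<^sup>+x. f x \<partial>M)"
proof (cases "c = 0")
  case False
  then obtain r where r: "c = ennreal r" "r > 0" using c by (cases c) auto
  have 1: "c * inverse c = 1"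
    using r by (simp add: inverse_ennreal flip: ennreal_mult)
  have "inverse c * (\<integral>\<^sup>+x. c * f x \<partial>M) \<le> (\<integral>\<^sup>+x. inverse c * (c * f x) \<partial>M)"
    by (rule lower_integral_cmult_ge)
  also have "\<dots> = (\<integral>\<^sup>+x. f x \<partial>M)"
    using 1 by (simp add: mult.assoc[symmetric] mult.commute[of "inverse c"])
  finally have "c * (inverse c * (\<integral>\<^sup>+x. c * f x \<partial>M)) \<le> c * (\<integral>\<^sup>+x. f x \<partial>M)"
    by (rule mult_left_mono) simp
  then have "(\<integral>\<^sup>+x. c * f x \<partial>M) \<le> c * (\<integral>\<^sup>+x. f x \<partial>M)"
    using 1 by (simp add: mult.assoc[symmetric])
  then show ?thesis by (intro antisym lower_integral_cmult_ge)
qed simp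

text \<open>Countable additivity survives because the pieces are measurable sets: a measurable
  minorant on the union restricts to each piece, and minorants on the pieces add up to one on the
  union.\<close>

lemma lower_integral_UN:
  fixes A :: "nat \<Rightarrow> 'a set"
  assumes d: "disjoint_family A" and A [measurable]: "\<And>n. A n \<in> sets M"
  shows "(\<integral>\<^sup>+x. f x * indicator (\<Union>n. A n) x \<partial>M) = (\<Sum>n. \<integral>\<^sup>+x. f x * indicator (A n) x \<partial>M)"
proof (rule antisym)
  have ind: "(\<Sum>n. h x * indicator (A n) x) = h x * indicator (\<Union>n. A n) x" for h :: "'a \<Rightarrow> ennreal" and x
    using suminf_indicator[OF d, of x] by simp
  obtain g where [measurable]: "g \<in> borel_measurable M"
    and g: "\<And>x. g x \<le> f x * indicator (\<Union>n. A n) x"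
    "(\<integral>\<^sup>+x. g x \<partial>M) = (\<integral>\<^sup>+x. f x * indicator (\<Union>n. A n) x \<partial>M)"
    using nn_integral_minorant[of M "\<lambda>x. f x * indicator (\<Union>n. A n) x"] by metis
  have "g x = g x * indicator (\<Union>n. A n) x" for x
    using g(1)[of x] by (auto split: split_indicator)
  then have "(\<integral>\<^sup>+x. g x \<partial>M) = (\<integral>\<^sup>+x. (\<Sum>n. g x * indicator (A n) x) \<partial>M)"
    unfolding ind by (intro nn_integral_cong) auto
  also have "\<dots> = (\<Sum>n. \<integral>\<^sup>+x. g x * indicator (A n) x \<partial>M)"
    by (rule nn_integral_suminf) measurable
  also have "\<dots> \<le> (\<Sum>n. \<integral>\<^sup>+x. f x * indicator (A n) x \<partial>M)"
  proof (intro suminf_le nn_integral_mono)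
    fix n x
    have "g x \<le> f x" if "x \<in> A n"
    proof -
      have "x \<in> (\<Union>n. A n)" using that by blast
      then show ?thesis using g(1)[of x] by simp
    qed
    then show "g x * indicator (A n) x \<le> f x * indicator (A n) x"
      by (simp add: indicator_def)
  qed auto
  finally show "(\<integral>\<^sup>+x. f x * indicator (\<Union>n. A n) x \<partial>M) \<le> (\<Sum>n. \<integral>\<^sup>+x. f x * indicator (A n) x \<partial>M)"
    using g(2) by simp
  have "\<exists>h. h \<in> borel_measurable M \<and> (\<forall>x. h x \<le> f x * indicator (A n) x) \<and>
      (\<integral>\<^sup>+x. h x \<partial>M) = (\<integral>\<^sup>+x. f x * indicator (A n) x \<partial>M)" for n
    using nn_integral_minorant[of M "\<lambda>x. f x * indicator (A n) x"] by metis
  then obtain h where [measurable]: "\<And>n. h n \<in> borel_measurable M"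
    and h: "\<And>n x. h n x \<le> f x * indicator (A n) x"
     "\<And>n. (\<integral>\<^sup>+x. h n x \<partial>M) = (\<integral>\<^sup>+x. f x * indicator (A n) x \<partial>M)" by metis
  have "(\<Sum>n. \<integral>\<^sup>+x. f x * indicator (A n) x \<partial>M) = (\<integral>\<^sup>+x. (\<Sum>n. h n x) \<partial>M)"
    by (simp add: h(2)[symmetric] nn_integral_suminf)
  also have "\<dots> \<le> (\<integral>\<^sup>+x. f x * indicator (\<Union>n. A n) x \<partial>M)"
    unfolding ind[symmetric] by (intro nn_integral_mono suminf_le h) auto
  finally show "(\<Sum>n. \<integral>\<^sup>+x. f x * indicator (A n) x \<partial>M) \<le> (\<integral>\<^sup>+x. f x * indicator (\<Union>n. A n) x \<partial>M)" .
qed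

section \<open>Discrete Hardy inequalities\<close>

lemma suminf_swap_ennreal:
  fixes f :: "nat \<Rightarrow> nat \<Rightarrow> ennreal"
  shows "(\<Sum>n. \<Sum>k. f n k) = (\<Sum>k. \<Sum>n. f n k)"
proof -
  have "(\<Sum>n. \<Sum>k. f n k) = (\<Sum>n. \<integral>\<^sup>+k. f n k \<partial>count_space UNIV)"
    by (simp add: nn_integral_count_space_nat)
  also have "\<dots> = (\<integral>\<^sup>+k. (\<Sum>n. f n k) \<partial>count_space UNIV)"
    by (rule nn_integral_suminf[symmetric]) simp
  finally show ?thesis by (simp add: nn_integral_count_space_nat)
qed

text \<open>Subtraction on \<open>nat\<close> truncates, so one summand is always 0 and the sum is
  the distance \<open>|n - k|\<close>.\<close>

definition nat_dist :: "nat \<Rightarrow> nat \<Rightarrow> nat" where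
  "nat_dist n k = (n - k) + (k - n)"

lemma nat_dist_commute: "nat_dist n k = nat_dist k n"
  by (simp add: nat_dist_def add.commute)

lemma suminf_power_nat_dist_le:
  fixes \<rho> :: real
  assumes \<rho>: "0 < \<rho>" "\<rho> < 1"
  shows "(\<Sum>k. ennreal (\<rho> ^ nat_dist n k)) \<le> ennreal (2 / (1 - \<rho>))"
proof -
  have eq: "(\<lambda>k. \<rho> ^ nat_dist n (k + n)) = (\<lambda>k. \<rho> ^ k)"
    by (simp add: nat_dist_def)
  have "summable (\<lambda>k. \<rho> ^ nat_dist n (k + n))" unfolding eq using \<rho> by (intro summable_geometric) auto
  then have s: "summable (\<lambda>k. \<rho> ^ nat_dist n k)" by (subst (asm) summable_iff_shift)
  have geo: "(\<Sum>k. \<rho> ^ k) = 1 / (1 - \<rho>)" using \<rho> by (intro suminf_geometric) auto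
  have "(\<Sum>k. \<rho> ^ nat_dist n k) = (\<Sum>k. \<rho> ^ k) + (\<Sum>k<n. \<rho> ^ nat_dist n k)"
    by (subst suminf_split_initial_segment[OF s, of n]) (simp add: eq)
  moreover have "(\<Sum>k<n. \<rho> ^ nat_dist n k) \<le> (\<Sum>k<n. \<rho> ^ (n - Suc k))"
    using \<rho> by (intro sum_mono power_decreasing) (auto simp: nat_dist_def)
  moreover have "\<dots> = (\<Sum>k<n. \<rho> ^ k)" by (rule sum.nat_diff_reindex)
  moreover have "\<dots> \<le> (\<Sum>k. \<rho> ^ k)" using \<rho> by (intro sum_le_suminf summable_geometric) auto
  ultimately have "(\<Sum>k. \<rho> ^ nat_dist n k) \<le> 1 / (1 - \<rho>) + 1 / (1 - \<rho>)"
    unfolding geo by linarith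
  then have "(\<Sum>k. \<rho> ^ nat_dist n k) \<le> 2 / (1 - \<rho>)" by (simp flip: add_divide_distrib)
  then show ?thesis
    using \<rho> s by (subst suminf_ennreal2) (auto intro!: ennreal_leI)
qed

text \<open>With \<open>\<sigma> = sqrt \<rho>\<close>, each sum \<open>\<Sum>k. \<rho>^k x_k\<close> is at most \<open>\<Sum>k. \<sigma>^k\<close> times the supremum
  of \<open>\<sigma>^k x_k\<close>, whose \<open>q\<close>-th power is at most the sum of the \<open>q\<close>-th powers.  This treats
  \<open>q < 1\<close> and \<open>q \<ge> 1\<close> alike.\<close>

lemma geometric_convolution_le:
  fixes \<rho> q :: real
  assumes \<rho>: "0 < \<rho>" "\<rho> < 1" and q: "0 < q"
  obtains C where "C > 0" "\<And>x. (\<Sum>n. ennpowr (\<Sum>k. ennreal (\<rho> ^ nat_dist n k) * x k) q) \<le>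
     ennreal C * (\<Sum>k. ennpowr (x k) q)"
proof
  define \<sigma> where "\<sigma> = sqrt \<rho>"
  have \<sigma>: "0 < \<sigma>" "\<sigma> < 1" "\<rho> = \<sigma> * \<sigma>" using \<rho> by (auto simp: \<sigma>_def)
  \<comment> \<open>This is the ratio of the convolution that remains after the factors
    \<open>\<sigma> ^ nat_dist n k\<close> have been raised to the power \<open>q\<close>.\<close>
  define \<tau> where "\<tau> = \<sigma> powr q"
  have \<tau>: "0 < \<tau>" "\<tau> < 1" using \<sigma> q powr_less_mono2[of q \<sigma> 1] by (auto simp: \<tau>_def)
  define B where "B = 2 / (1 - \<sigma>)"
  have B: "B > 0" using \<sigma> by (simp add: B_def)
  show "B powr q * (2 / (1 - \<tau>)) > 0" using B \<tau> by simp
  fix x :: "nat \<Rightarrow> ennreal"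
  have \<tau>_eq: "ennpowr (ennreal (\<sigma> ^ j)) q = ennreal (\<tau> ^ j)" for j
    using \<sigma> by (simp add: ennpowr_ennreal \<tau>_def powr_power powr_powr mult.commute flip: powr_realpow)
  have 1: "ennpowr (\<Sum>k. ennreal (\<rho> ^ nat_dist n k) * x k) q \<le>
      ennreal (B powr q) * (\<Sum>k. ennreal (\<tau> ^ nat_dist n k) * ennpowr (x k) q)" for n
  proof -
    define y where "y k = ennreal (\<sigma> ^ nat_dist n k) * x k" for k
    \<comment> \<open>The \<open>l^q\<close> quasinorm of \<open>y\<close> takes the place of the
      supremum: it dominates every \<open>y k\<close>, and its \<open>q\<close>-th power is the sum
      wanted on the right.\<close>
    define Y where "Y = ennpowr (\<Sum>k. ennpowr (y k) q) (1 / q)"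
    have Yq: "ennpowr Y q = (\<Sum>k. ennpowr (y k) q)" using q by (simp add: Y_def ennpowr_ennpowr)
    have y_le: "y k \<le> Y" for k
    proof -
      have "ennpowr (y k) q \<le> (\<Sum>k. ennpowr (y k) q)"
        using sum_le_suminf[of "\<lambda>k. ennpowr (y k) q" "{k}"] by auto
      then show ?thesis using q by (simp flip: Yq add: ennpowr_le_iff)
    qed
    have "(\<Sum>k. ennreal (\<rho> ^ nat_dist n k) * x k) \<le> (\<Sum>k. ennreal (\<sigma> ^ nat_dist n k) * Y)"
    proof (intro suminf_le)
      fix k
      have "ennreal (\<rho> ^ nat_dist n k) * x k = ennreal (\<sigma> ^ nat_dist n k) * y k"
        using \<sigma> by (simp add: y_def power_mult_distrib ennreal_mult mult.assoc)
      also have "\<dots> \<le> ennreal (\<sigma> ^ nat_dist n k) * Y" by (intro mult_left_mono y_le) simp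
      finally show "ennreal (\<rho> ^ nat_dist n k) * x k \<le> ennreal (\<sigma> ^ nat_dist n k) * Y" .
    qed auto
    also have "\<dots> \<le> ennreal B * Y"
      unfolding ennreal_suminf_multc B_def
      by (intro mult_right_mono suminf_power_nat_dist_le \<sigma>) auto
    finally have "ennpowr (\<Sum>k. ennreal (\<rho> ^ nat_dist n k) * x k) q \<le> ennpowr (ennreal B * Y) q"
      using q by (intro ennpowr_mono) auto
    also have "\<dots> = ennreal (B powr q) * (\<Sum>k. ennpowr (y k) q)"
      using B by (simp add: ennpowr_mult Yq ennpowr_ennreal)
    finally show ?thesis by (simp add: y_def ennpowr_mult \<tau>_eq)
  qed
  have "(\<Sum>n. ennpowr (\<Sum>k. ennreal (\<rho> ^ nat_dist n k) * x k) q) \<le>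
      (\<Sum>n. ennreal (B powr q) * (\<Sum>k. ennreal (\<tau> ^ nat_dist n k) * ennpowr (x k) q))"
    by (intro suminf_le 1) auto
  also have "\<dots> = ennreal (B powr q) * (\<Sum>k. (\<Sum>n. ennreal (\<tau> ^ nat_dist k n)) * ennpowr (x k) q)"
    by (simp only: ennreal_suminf_cmult ennreal_suminf_multc[symmetric] nat_dist_commute)
      (subst suminf_swap_ennreal, simp add: nat_dist_commute)
  also have "\<dots> \<le> ennreal (B powr q) * (\<Sum>k. ennreal (2 / (1 - \<tau>)) * ennpowr (x k) q)"
    by (intro mult_left_mono suminf_le mult_right_mono suminf_power_nat_dist_le \<tau>) auto
  also have "\<dots> = ennreal (B powr q * (2 / (1 - \<tau>))) * (\<Sum>k. ennpowr (x k) q)"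
    using \<tau> by (subst ennreal_mult) (auto simp: mult.assoc)
  finally show "(\<Sum>n. ennpowr (\<Sum>k. ennreal (\<rho> ^ nat_dist n k) * x k) q) \<le>
     ennreal (B powr q * (2 / (1 - \<tau>))) * (\<Sum>k. ennpowr (x k) q)" .
qed

text \<open>\<open>R\<close> will be \<open>k \<le> n\<close> or \<open>n \<le> k\<close>, and
  \<open>V\<close> is assumed to fall geometrically from \<open>k\<close> to \<open>n\<close> in
  that direction. Absorbing the \<open>q\<close>-th root of \<open>V\<close> into \<open>x\<close>
  leaves a convolution with ratio \<open>\<rho> powr (1 / q)\<close>.\<close>

lemma geometric_weight_hardy:
  fixes V :: "nat \<Rightarrow> ennreal" and R :: "nat \<Rightarrow> nat \<Rightarrow> bool"
  assumes \<rho>: "0 < \<rho>" "\<rho> < 1" and q: "0 < q" and D: "0 \<le> D"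
    and V: "\<And>n k. R n k \<Longrightarrow> V n \<le> ennreal (D * \<rho> ^ nat_dist n k) * V k"
  obtains C where "C > 0" "\<And>x. (\<Sum>n. ennpowr (\<Sum>k. of_bool (R n k) * x k) q * V n) \<le>
     ennreal C * (\<Sum>k. ennpowr (x k) q * V k)"
proof -
  define r where "r = \<rho> powr (1 / q)"
  have r: "0 < r" "r < 1" using \<rho> q powr_less_mono2[of "1/q" \<rho> 1] by (auto simp: r_def)
  obtain C where C: "C > 0" "\<And>x. (\<Sum>n. ennpowr (\<Sum>k. ennreal (r ^ nat_dist n k) * x k) q) \<le>
     ennreal C * (\<Sum>k. ennpowr (x k) q)"
    by (rule geometric_convolution_le[OF r q]) (rule that)
  show ?thesis
  proof
    \<comment> \<open>The summand 1 keeps the constant positive when \<open>D\<close> is 0.\<close>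
    show "D * C + 1 > 0" using C(1) D mult_nonneg_nonneg[of D C] by linarith
    fix x :: "nat \<Rightarrow> ennreal"
    define y where "y k = x k * ennpowr (V k) (1 / q)" for k
    have yq: "ennpowr (y k) q = ennpowr (x k) q * V k" for k
      using q by (simp add: y_def ennpowr_mult ennpowr_ennpowr)
    have "(\<Sum>n. ennpowr (\<Sum>k. of_bool (R n k) * x k) q * V n) \<le>
        (\<Sum>n. ennreal D * ennpowr (\<Sum>k. ennreal (r ^ nat_dist n k) * y k) q)"
    proof (intro suminf_le)
      fix n
      have *: "of_bool (R n k) * x k * ennpowr (V n) (1 / q) \<le>
          ennreal (D powr (1/q)) * (ennreal (r ^ nat_dist n k) * y k)" for k
      proof (cases "R n k")
        case True
        have "ennpowr (V n) (1 / q) \<le> ennpowr (ennreal (D * \<rho> ^ nat_dist n k) * V k) (1 / q)"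
          using V[OF True] q by (intro ennpowr_mono) auto
        also have "\<dots> = ennreal (D powr (1/q)) * ennreal (r ^ nat_dist n k) * ennpowr (V k) (1 / q)"
          using D \<rho> by (simp add: ennpowr_mult ennpowr_ennreal powr_mult ennreal_mult r_def powr_power powr_powr mult.commute
              flip: powr_realpow)
        finally have "x k * ennpowr (V n) (1 / q) \<le>
            x k * (ennreal (D powr (1/q)) * ennreal (r ^ nat_dist n k) * ennpowr (V k) (1 / q))"
          by (rule mult_left_mono) simp
        then show ?thesis using True by (simp add: y_def ac_simps)
      qed simp
      have "ennpowr (\<Sum>k. of_bool (R n k) * x k) q * V n =
          ennpowr (\<Sum>k. of_bool (R n k) * x k * ennpowr (V n) (1 / q)) q"
        using q by (simp add: ennpowr_mult ennpowr_ennpowr)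
      also have "\<dots> \<le> ennpowr (\<Sum>k. ennreal (D powr (1/q)) * (ennreal (r ^ nat_dist n k) * y k)) q"
        using q by (intro ennpowr_mono suminf_le *) auto
      also have "\<dots> = ennreal D * ennpowr (\<Sum>k. ennreal (r ^ nat_dist n k) * y k) q"
        using q D by (simp add: ennpowr_mult ennpowr_ennreal powr_powr)
      finally show "ennpowr (\<Sum>k. of_bool (R n k) * x k) q * V n \<le>
         ennreal D * ennpowr (\<Sum>k. ennreal (r ^ nat_dist n k) * y k) q" .
    qed auto
    also have "\<dots> \<le> ennreal D * (ennreal C * (\<Sum>k. ennpowr (y k) q))"
      unfolding ennreal_suminf_cmult by (intro mult_left_mono C) simp
    also have "\<dots> \<le> ennreal (D * C + 1) * (\<Sum>k. ennpowr (y k) q)"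
      using D C by (simp only: mult.assoc[symmetric] ennreal_mult[symmetric])
        (intro mult_right_mono ennreal_leI, auto)
    finally show "(\<Sum>n. ennpowr (\<Sum>k. of_bool (R n k) * x k) q * V n) \<le>
       ennreal (D * C + 1) * (\<Sum>k. ennpowr (x k) q * V k)" by (simp add: yq)
  qed
qed

text \<open>\<open>m n\<close> is the mass of a weight on the dyadic interval \<open>[1 - 2^-n, 1 - 2^-(n+1))\<close> and
  \<open>T n\<close> the tail of the weight at \<open>1 - 2^-n\<close>.\<close>

locale dyadic_weight =
  fixes m T :: "nat \<Rightarrow> ennreal" and c0 :: real and M :: nat
  assumes tail_eq: "\<And>n. T n = (\<Sum>k. m (n + k))"
    and c0: "1 < c0"
    and reverse_doubling: "\<And>n. ennreal c0 * T (n + M) \<le> T n"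
    and finite_or_top: "(\<forall>n. T n < top) \<or> (\<forall>n. T n = top)"
begin

lemma m_le_T: "m n \<le> T n"
  unfolding tail_eq using sum_le_suminf[of "\<lambda>k. m (n + k)" "{0}"] by simp

lemma T_add: "T n = (\<Sum>j<i. m (n + j)) + T (n + i)"
  unfolding tail_eq using suminf_offset[of "\<lambda>k. m (n + k)" i] by (simp add: ac_simps)

lemma T_antimono: "T (n + i) \<le> T n"
  using T_add[of n i] by simp

text \<open>Reverse doubling is iterated in steps of \<open>M\<close> indices. The choice
  \<open>\<rho> ^ M = 1 / c0\<close> spreads the gain over the indices, and the factor
  \<open>c0\<close> pays for the last, incomplete step.\<close>

lemma T_decay:
  assumes fin: "\<And>n. T n < top"
  obtains \<rho> where "0 < \<rho>" "\<rho> < 1" "\<And>k i. T (k + i) \<le> ennreal (c0 * \<rho> ^ i) * T k"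
proof (cases "M = 0")
  \<comment> \<open>With \<open>M = 0\<close> reverse doubling reads
    \<open>c0 * T k \<le> T k\<close>, which forces a finite tail to vanish as
    \<open>c0 > 1\<close>.\<close>
  case True
  have "T k = 0" for k
  proof -
    obtain t where t: "T k = ennreal t" "t \<ge> 0" using fin[of k] by (cases "T k") auto
    then have "c0 * t \<le> t"
      using reverse_doubling[of k] True c0 by (simp flip: ennreal_mult)
    then have "t = 0" using mult_strict_right_mono[of 1 c0 t] c0 t by (cases "t = 0") auto
    then show ?thesis using t by simp
  qed
  then show ?thesis using that[of "1/2"] by simp
next
  case M: False
  define \<rho> where "\<rho> = (1 / c0) powr (1 / M)"
  have \<rho>: "0 < \<rho>" "\<rho> < 1" "\<rho> ^ M = 1 / c0"
    using c0 M powr_less_mono2[of "1/M" "1/c0" 1] by (auto simp: \<rho>_def powr_power)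
  have "T (k + i) \<le> ennreal (c0 * \<rho> ^ i) * T k" for k i
  proof (induction i rule: less_induct)
    case (less i)
    show ?case
    proof (cases "i < M")
      case True
      then have "1 / c0 \<le> \<rho> ^ i" using \<rho> power_decreasing[of i M \<rho>] by auto
      then have "1 \<le> c0 * \<rho> ^ i" using c0 by (simp add: field_simps)
      then have "1 * T k \<le> ennreal (c0 * \<rho> ^ i) * T k"
        by (intro mult_right_mono) (auto simp: ennreal_le_iff simp flip: ennreal_1)
      then show ?thesis using T_antimono[of k i] by simp
    next
      case False
      then have i: "i = (i - M) + M" "i - M < i" using M by auto
      have "T (k + i) = ennreal (1 / c0) * (ennreal c0 * T (k + (i - M) + M))"
        using c0 i by (simp add: mult.assoc[symmetric] flip: ennreal_mult)
      also have "\<dots> \<le> ennreal (1 / c0) * T (k + (i - M))"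
        by (intro mult_left_mono reverse_doubling) simp
      also have "\<dots> \<le> ennreal (1 / c0) * (ennreal (c0 * \<rho> ^ (i - M)) * T k)"
        by (intro mult_left_mono less i) simp
      also have "\<dots> = ennreal (c0 * (\<rho> ^ (i - M) * \<rho> ^ M)) * T k"
        using c0 \<rho> by (simp add: mult.assoc[symmetric] flip: ennreal_mult)
      also have "\<rho> ^ (i - M) * \<rho> ^ M = \<rho> ^ i" using i by (metis power_add)
      finally show ?thesis .
    qed
  qed
  then show ?thesis using that \<rho> by blast
qed

text \<open>The tail is the block sum plus \<open>T (n + M)\<close>, which is at most
  \<open>T n / c0\<close>. Solving for \<open>T n\<close> needs the tails to be finite.\<close>

lemma T_le_block:
  assumes fin: "\<And>n. T n < top"
  shows "T n \<le> ennreal (c0 / (c0 - 1)) * (\<Sum>j<M. m (n + j))"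
proof -
  obtain t where t: "T n = ennreal t" "t \<ge> 0" using fin[of n] by (cases "T n") auto
  obtain u where u: "T (n + M) = ennreal u" "u \<ge> 0" using fin[of "n + M"] by (cases "T (n + M)") auto
  have "(\<Sum>j<M. m (n + j)) < top" using T_add[of n M] t
    by (metis ennreal_add_eq_top ennreal_neq_top less_top)
  then obtain s where s: "(\<Sum>j<M. m (n + j)) = ennreal s" "s \<ge> 0"
    by (cases "\<Sum>j<M. m (n + j)") auto
  have "c0 * u \<le> t" using reverse_doubling[of n] c0 t u by (simp flip: ennreal_mult)
  moreover have "t = s + u" using T_add[of n M] t u s by (simp flip: ennreal_plus)
  ultimately have "t \<le> c0 / (c0 - 1) * s"
    using c0 by (simp add: field_simps)
  then show ?thesis using t s c0 by (simp flip: ennreal_mult)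
qed

text \<open>Passage from tails back to masses: in \<open>A n * m (n + j)\<close> monotonicity raises
  \<open>A n\<close> to \<open>A (n + j)\<close>, and then every term \<open>A i * m i\<close> is
  counted at most \<open>M\<close> times.\<close>

lemma sum_T_le_sum_m:
  assumes fin: "\<And>n. T n < top" and A: "incseq A"
  shows "(\<Sum>n. A n * T n) \<le> ennreal (c0 / (c0 - 1) * M) * (\<Sum>n. A n * m n)"
proof -
  have "(\<Sum>n. A n * T n) \<le> (\<Sum>n. ennreal (c0 / (c0 - 1)) * (\<Sum>j<M. A (n + j) * m (n + j)))"
  proof (intro suminf_le)
    fix n
    have "A n * T n \<le> A n * (ennreal (c0 / (c0 - 1)) * (\<Sum>j<M. m (n + j)))"
      by (intro mult_left_mono T_le_block fin) simp
    also have "\<dots> = ennreal (c0 / (c0 - 1)) * (\<Sum>j<M. A n * m (n + j))"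
      by (simp add: sum_distrib_left ac_simps)
    also have "\<dots> \<le> ennreal (c0 / (c0 - 1)) * (\<Sum>j<M. A (n + j) * m (n + j))"
      by (intro mult_left_mono sum_mono mult_right_mono incseqD[OF A]) auto
    finally show "A n * T n \<le> ennreal (c0 / (c0 - 1)) * (\<Sum>j<M. A (n + j) * m (n + j))" .
  qed auto
  also have "\<dots> = ennreal (c0 / (c0 - 1)) * (\<Sum>j<M. \<Sum>n. A (n + j) * m (n + j))"
    by (simp add: suminf_sum)
  also have "\<dots> \<le> ennreal (c0 / (c0 - 1)) * (\<Sum>j<M. \<Sum>n. A n * m n)"
  proof (intro mult_left_mono sum_mono)
    fix j
    show "(\<Sum>n. A (n + j) * m (n + j)) \<le> (\<Sum>n. A n * m n)"
      by (subst suminf_offset[of "\<lambda>n. A n * m n" j]) auto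
  qed simp
  also have "\<dots> = ennreal (c0 / (c0 - 1) * M) * (\<Sum>n. A n * m n)"
    using c0 by (simp add: ennreal_mult mult.assoc ennreal_of_nat_eq_real_of_nat
          del: times_divide_eq_left times_divide_eq_right)
  finally show ?thesis .
qed

text \<open>This makes both Hardy inequalities trivial for infinite tails: unless the sequence
  \<open>a\<close> vanishes, their right sides are infinite.\<close>

lemma sum_eq_top_of_tail_top:
  assumes top: "\<And>n. T n = top" and A: "incseq A" and pos: "A N > 0"
  shows "(\<Sum>n. A n * m n) = top"
proof -
  have "top = A N * T N" using pos top by (simp add: ennreal_mult_top)
  also have "\<dots> = (\<Sum>k. A N * m (N + k))" by (simp add: tail_eq)
  also have "\<dots> \<le> (\<Sum>k. A (N + k) * m (N + k))"
    by (intro suminf_le mult_right_mono incseqD[OF A]) auto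
  also have "\<dots> \<le> (\<Sum>n. A n * m n)"
    by (subst (2) suminf_offset[of _ N]) (auto simp: add.commute)
  finally show ?thesis by (simp add: top_unique)
qed

text \<open>Here the geometric decay of \<open>T\<close> from \<open>k\<close> to a later
  \<open>n\<close> is used. On the left \<open>m\<close> is enlarged to \<open>T\<close>; on the
  right \<open>T\<close> is reduced to \<open>m\<close> by the monotonicity of
  \<open>a\<close>.\<close>

lemma hardy_lower:
  assumes q: "0 < q"
  obtains C :: real where "C > 0" "\<And>a. incseq a \<Longrightarrow>
    (\<Sum>n. ennpowr (\<Sum>k. of_bool (k \<le> n) * a k) q * m n) \<le> ennreal C * (\<Sum>n. ennpowr (a n) q * m n)"
proof (cases "\<forall>n. T n < top")
  case True
  then have fin: "\<And>n. T n < top" by blast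
  obtain \<rho> where \<rho>: "0 < \<rho>" "\<rho> < 1" "\<And>k i. T (k + i) \<le> ennreal (c0 * \<rho> ^ i) * T k"
    by (rule T_decay[OF fin]) (rule that)
  have V: "T n \<le> ennreal (c0 * \<rho> ^ nat_dist n k) * T k" if "k \<le> n" for n k
    using \<rho>(3)[of k "n - k"] that by (simp add: nat_dist_def)
  have c0': "0 \<le> c0" using c0 by simp
  obtain C where C: "C > 0" "\<And>x. (\<Sum>n. ennpowr (\<Sum>k. of_bool (k \<le> n) * x k) q * T n) \<le>
     ennreal C * (\<Sum>k. ennpowr (x k) q * T k)" by (rule geometric_weight_hardy[where R="\<lambda>n k. k \<le> n", OF \<rho>(1,2) q c0']) (erule V, rule that)
  show ?thesis
  proof
    show "C * (c0 / (c0 - 1) * M) + 1 > 0"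
      using C c0 by (intro add_nonneg_pos mult_nonneg_nonneg) auto
    fix a :: "nat \<Rightarrow> ennreal" assume a: "incseq a"
    have "(\<Sum>n. ennpowr (\<Sum>k. of_bool (k \<le> n) * a k) q * m n) \<le>
        (\<Sum>n. ennpowr (\<Sum>k. of_bool (k \<le> n) * a k) q * T n)"
      by (intro suminf_le mult_left_mono m_le_T) auto
    also have "\<dots> \<le> ennreal C * (\<Sum>k. ennpowr (a k) q * T k)" by (rule C)
    also have "\<dots> \<le> ennreal C * (ennreal (c0 / (c0 - 1) * M) * (\<Sum>n. ennpowr (a n) q * m n))"
      using a q by (intro mult_left_mono sum_T_le_sum_m fin) (auto simp: incseq_def intro!: ennpowr_mono)
    also have "\<dots> = ennreal (C * (c0 / (c0 - 1) * M)) * (\<Sum>n. ennpowr (a n) q * m n)"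
      using C c0 by (simp add: ennreal_mult mult.assoc
          del: times_divide_eq_left times_divide_eq_right)
    also have "\<dots> \<le> ennreal (C * (c0 / (c0 - 1) * M) + 1) * (\<Sum>n. ennpowr (a n) q * m n)"
      by (intro mult_right_mono ennreal_leI) auto
    finally show "(\<Sum>n. ennpowr (\<Sum>k. of_bool (k \<le> n) * a k) q * m n) \<le>
      ennreal (C * (c0 / (c0 - 1) * M) + 1) * (\<Sum>n. ennpowr (a n) q * m n)" .
  qed
next
  case False
  then have top: "\<And>n. T n = top" using finite_or_top by blast
  show ?thesis
  proof
    fix a :: "nat \<Rightarrow> ennreal" assume a: "incseq a"
    show "(\<Sum>n. ennpowr (\<Sum>k. of_bool (k \<le> n) * a k) q * m n) \<le> ennreal 1 * (\<Sum>n. ennpowr (a n) q * m n)"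
    proof (cases "\<forall>n. a n = 0")
      case False
      then obtain N where "ennpowr (a N) q > 0" by (auto simp: zero_less_iff_neq_zero)
      moreover have "incseq (\<lambda>n. ennpowr (a n) q)"
        using a q by (auto simp: incseq_def intro!: ennpowr_mono)
      ultimately have "(\<Sum>n. ennpowr (a n) q * m n) = top"
        using sum_eq_top_of_tail_top[of "\<lambda>n. ennpowr (a n) q" N] top by blast
      then show ?thesis by simp
    qed simp
  qed simp
qed

text \<open>The relevant weight is \<open>U n = 2^(n q) T n\<close>, which grows geometrically by
  \<open>sub\<close>. The sequence \<open>a\<close> enters at \<open>Suc k\<close> because the means
  of \<open>f'\<close> will be taken at the right ends of dyadic intervals; \<open>doubling\<close>
  pays for this shift.\<close>

lemma hardy_upper:
  assumes q: "0 < q" and D: "D \<ge> 0" and E: "E \<ge> 0"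
    and doubling: "\<And>n. T n \<le> ennreal D * T (Suc n)"
    and sub: "\<And>k. (\<Sum>n<k. ennreal ((2 ^ n) powr q) * m n) \<le> ennreal E * (ennreal ((2 ^ k) powr q) * T k)"
  obtains C :: real where "C > 0" "\<And>a. incseq a \<Longrightarrow>
    (\<Sum>n. ennpowr (\<Sum>k. of_bool (n \<le> k) * (ennreal ((1/2) ^ k) * a (Suc k))) q * (ennreal ((2 ^ n) powr q) * m n)) \<le>
    ennreal C * (\<Sum>n. ennpowr (a n) q * m n)"
proof (cases "\<forall>n. T n < top")
  case True
  then have fin: "\<And>n. T n < top" by blast
  define w :: "nat \<Rightarrow> ennreal" where "w n = ennreal ((2 ^ n) powr q)" for n
  define U where "U n = w n * T n" for n
  define B where "B = c0 / (c0 - 1) * (M * (E * (2 ^ M) powr q))"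
  have B: "B \<ge> 0" using c0 E by (simp add: B_def)
  have w_mono: "w i \<le> w (i + j)" for i j
    unfolding w_def using q by (intro ennreal_leI powr_mono2 power_increasing) auto
  \<comment> \<open>Each \<open>U n\<close> is at most a multiple of \<open>M\<close> consecutive
    weighted masses. Their sums over \<open>n \<le> k\<close> are bounded by \<open>sub\<close> at
    \<open>k + M\<close>, where the larger power of 2 costs the factor
    \<open>(2 ^ M) powr q\<close>.\<close>
  have sumU: "(\<Sum>n\<le>k. U n) \<le> ennreal B * U k" for k
  proof -
    have "(\<Sum>n\<le>k. U n) \<le> (\<Sum>n\<le>k. ennreal (c0 / (c0 - 1)) * (\<Sum>j<M. w (n + j) * m (n + j)))"
    proof (rule sum_mono)
      fix n
      have "U n \<le> w n * (ennreal (c0 / (c0 - 1)) * (\<Sum>j<M. m (n + j)))"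
        unfolding U_def by (intro mult_left_mono T_le_block fin) simp
      also have "\<dots> = ennreal (c0 / (c0 - 1)) * (\<Sum>j<M. w n * m (n + j))"
        by (simp add: sum_distrib_left ac_simps)
      also have "\<dots> \<le> ennreal (c0 / (c0 - 1)) * (\<Sum>j<M. w (n + j) * m (n + j))"
        by (intro mult_left_mono sum_mono mult_right_mono w_mono) auto
      finally show "U n \<le> ennreal (c0 / (c0 - 1)) * (\<Sum>j<M. w (n + j) * m (n + j))" .
    qed
    also have "\<dots> = ennreal (c0 / (c0 - 1)) * (\<Sum>j<M. \<Sum>n\<le>k. w (n + j) * m (n + j))"
      by (subst sum.swap) (simp add: sum_distrib_left)
    also have "\<dots> \<le> ennreal (c0 / (c0 - 1)) * (\<Sum>j<M. ennreal (E * (2 ^ M) powr q) * U k)"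
    proof (intro mult_left_mono sum_mono)
      fix j assume j: "j \<in> {..<M}"
      have "(\<Sum>n\<le>k. w (n + j) * m (n + j)) = (\<Sum>i\<in>(\<lambda>n. n + j) ` {..k}. w i * m i)"
        by (subst sum.reindex) (auto simp: inj_on_def)
      also have "\<dots> \<le> (\<Sum>i<k + M. w i * m i)"
        using j by (intro sum_mono2) auto
      also have "\<dots> \<le> ennreal E * (w (k + M) * T (k + M))"
        using sub[of "k + M"] by (simp add: w_def)
      also have "\<dots> \<le> ennreal E * (w (k + M) * T k)"
        by (intro mult_left_mono T_antimono) auto
      also have "w (k + M) = ennreal ((2 ^ M) powr q) * w k"
        by (simp add: w_def power_add powr_mult ennreal_mult mult.commute)
      finally show "(\<Sum>n\<le>k. w (n + j) * m (n + j)) \<le> ennreal (E * (2 ^ M) powr q) * U k"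
        using E by (simp add: U_def ennreal_mult mult.assoc)
    qed simp
    also have "\<dots> = ennreal B * U k"
      using c0 E by (simp add: B_def ennreal_mult mult.assoc ennreal_of_nat_eq_real_of_nat
          del: times_divide_eq_left times_divide_eq_right)
    finally show ?thesis .
  qed
  have U_fin: "U n < top" for n using fin[of n] by (simp add: U_def w_def ennreal_mult_less_top)
  define u where "u n = enn2real (U n)" for n
  have u: "U n = ennreal (u n)" "u n \<ge> 0" for n using U_fin[of n] by (simp_all add: u_def)
  \<comment> \<open>If a partial sum is at most \<open>B + 2\<close> times its last term, then
    dropping that term multiplies the sum by at most \<open>1 - 1 / (B + 2)\<close>. Using
    \<open>B + 2\<close> keeps this ratio positive even for \<open>B = 0\<close>.\<close>
  define \<rho> where "\<rho> = (B + 1) / (B + 2)"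
  have \<rho>: "0 < \<rho>" "\<rho> < 1" using B by (auto simp: \<rho>_def)
  have su: "(\<Sum>n\<le>k. u n) \<le> (B + 2) * u k" for k
  proof -
    have "(\<Sum>n\<le>k. u n) \<le> B * u k"
      using sumU[of k] B u by (simp flip: ennreal_mult add: sum_nonneg)
    then show ?thesis using u(2)[of k] by (simp add: algebra_simps)
  qed
  have S: "(\<Sum>n\<le>k. u n) \<le> \<rho> ^ i * (\<Sum>n\<le>k + i. u n)" for k i
  proof (induction i)
    case (Suc i)
    have "(\<Sum>n\<le>k + i. u n) \<le> \<rho> * (\<Sum>n\<le>k + Suc i. u n)"
    proof -
      have "(\<Sum>n\<le>k + Suc i. u n) = (\<Sum>n\<le>k + i. u n) + u (k + Suc i)" by simp
      then show ?thesis using su[of "k + Suc i"] B by (simp add: \<rho>_def field_simps)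
    qed
    from mult_left_mono[OF this, of "\<rho> ^ i"] \<rho>
    have "\<rho> ^ i * (\<Sum>n\<le>k + i. u n) \<le> \<rho> ^ i * (\<rho> * (\<Sum>n\<le>k + Suc i. u n))" by simp
    with Suc show ?case by (simp only: power_Suc2 mult.assoc)
  qed simp
  have V: "U n \<le> ennreal ((B + 2) * \<rho> ^ nat_dist n k) * U k" if "n \<le> k" for n k
  proof -
    have "u n \<le> (\<Sum>n\<le>n. u n)" using u(2) by (intro member_le_sum) auto
    also have "\<dots> \<le> \<rho> ^ (k - n) * (\<Sum>n\<le>k. u n)" using S[of n "k - n"] that by simp
    also have "\<dots> \<le> \<rho> ^ (k - n) * ((B + 2) * u k)" using \<rho> by (intro mult_left_mono su) auto
    finally have "u n \<le> (B + 2) * \<rho> ^ (k - n) * u k" by (simp add: ac_simps)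
    then show ?thesis using that \<rho> B u
      by (simp add: nat_dist_def flip: ennreal_mult)
  qed
  have B': "0 \<le> B + 2" using B by simp
  obtain C where C: "C > 0" "\<And>x. (\<Sum>n. ennpowr (\<Sum>k. of_bool (n \<le> k) * x k) q * U n) \<le>
     ennreal C * (\<Sum>k. ennpowr (x k) q * U k)"
    by (rule geometric_weight_hardy[where R="\<lambda>n k. n \<le> k", OF \<rho> q B']) (erule V, rule that)
  define C' where "C' = C * (D * (c0 / (c0 - 1) * M)) + 1"
  show ?thesis
  proof
    show "C' > 0" unfolding C'_def
      using C c0 D by (intro add_nonneg_pos mult_nonneg_nonneg) auto
    fix a :: "nat \<Rightarrow> ennreal" assume a: "incseq a"
    define x where "x k = ennreal ((1/2) ^ k) * a (Suc k)" for k
    \<comment> \<open>The factor \<open>(1/2) ^ k\<close> in \<open>x k\<close>, raised to the power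
      \<open>q\<close>, cancels the factor \<open>w k\<close> in \<open>U k\<close>.\<close>
    have x: "ennpowr (x k) q * U k = ennpowr (a (Suc k)) q * T k" for k
    proof -
      have "ennpowr (ennreal ((1/2) ^ k)) q * w k = 1"
        by (simp add: ennpowr_ennreal w_def flip: ennreal_mult powr_mult power_mult_distrib)
      then show ?thesis unfolding x_def U_def ennpowr_mult
        by (metis (no_types, lifting) mult.assoc mult.commute mult_1)
    qed
    have "(\<Sum>n. ennpowr (\<Sum>k. of_bool (n \<le> k) * x k) q * (w n * m n)) \<le>
        (\<Sum>n. ennpowr (\<Sum>k. of_bool (n \<le> k) * x k) q * U n)"
      unfolding U_def by (intro suminf_le mult_left_mono m_le_T) auto
    also have "\<dots> \<le> ennreal C * (\<Sum>k. ennpowr (a (Suc k)) q * T k)"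
      using C(2)[of x] by (simp add: x)
    also have "\<dots> \<le> ennreal C * (\<Sum>k. ennpowr (a (Suc k)) q * (ennreal D * T (Suc k)))"
      by (intro mult_left_mono suminf_le doubling) auto
    also have "\<dots> = ennreal C * (ennreal D * (\<Sum>k. ennpowr (a (Suc k)) q * T (Suc k)))"
      by (simp add: mult.left_commute)
    also have "\<dots> \<le> ennreal C * (ennreal D * (\<Sum>k. ennpowr (a k) q * T k))"
      by (subst (2) suminf_offset[of _ 1]) (auto intro!: mult_left_mono)
    also have "\<dots> \<le> ennreal C * (ennreal D * (ennreal (c0 / (c0 - 1) * M) * (\<Sum>n. ennpowr (a n) q * m n)))"
      using a q by (intro mult_left_mono sum_T_le_sum_m fin) (auto simp: incseq_def intro!: ennpowr_mono)
    also have "\<dots> = ennreal (C * (D * (c0 / (c0 - 1) * M))) * (\<Sum>n. ennpowr (a n) q * m n)"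
      using C D c0 by (simp add: ennreal_mult mult.assoc
          del: times_divide_eq_left times_divide_eq_right)
    also have "\<dots> \<le> ennreal C' * (\<Sum>n. ennpowr (a n) q * m n)"
      unfolding C'_def by (intro mult_right_mono ennreal_leI) auto
    finally show "(\<Sum>n. ennpowr (\<Sum>k. of_bool (n \<le> k) * (ennreal ((1/2) ^ k) * a (Suc k))) q *
        (ennreal ((2 ^ n) powr q) * m n)) \<le> ennreal C' * (\<Sum>n. ennpowr (a n) q * m n)"
      by (simp add: x_def w_def)
  qed
next
  case False
  then have top: "\<And>n. T n = top" using finite_or_top by blast
  show ?thesis
  proof
    fix a :: "nat \<Rightarrow> ennreal" assume a: "incseq a"
    show "(\<Sum>n. ennpowr (\<Sum>k. of_bool (n \<le> k) * (ennreal ((1/2) ^ k) * a (Suc k))) q *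
        (ennreal ((2 ^ n) powr q) * m n)) \<le> ennreal 1 * (\<Sum>n. ennpowr (a n) q * m n)"
    proof (cases "\<forall>n. a n = 0")
      case False
      then obtain N where "ennpowr (a N) q > 0" by (auto simp: zero_less_iff_neq_zero)
      moreover have "incseq (\<lambda>n. ennpowr (a n) q)"
        using a q by (auto simp: incseq_def intro!: ennpowr_mono)
      ultimately have "(\<Sum>n. ennpowr (a n) q * m n) = top"
        using sum_eq_top_of_tail_top[of "\<lambda>n. ennpowr (a n) q" N] top by blast
      then show ?thesis by simp
    qed simp
  qed simp
qed

end

section \<open>Integration over the circle and the Poisson kernel\<close>

text \<open>A density on the whole line, so that a function and its translates live on the same
  space and Borel measurability on the line suffices.\<close>

definition circ :: "real measure" where
  "circ = density lborel (indicator {0..2*pi})"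

lemma sets_circ [measurable_cong, simp]: "sets circ = sets borel"
  by (simp add: circ_def)

lemma space_circ [simp]: "space circ = UNIV"
  by (simp add: circ_def)

lemma nn_integral_circ:
  assumes [measurable]: "f \<in> borel_measurable borel"
  shows "(\<integral>\<^sup>+x. f x \<partial>circ) = (\<integral>\<^sup>+x. f x * indicator {0..2*pi} x \<partial>lborel)"
  unfolding circ_def by (subst nn_integral_density) (auto simp: mult.commute)

lemma emeasure_circ: "emeasure circ UNIV = ennreal (2 * pi)"
  by (simp add: circ_def emeasure_density)

lemma finite_measure_circ: "finite_measure circ"
  by (rule finite_measureI) (simp add: emeasure_circ)

lemma sigma_finite_circ: "sigma_finite_measure circ"
  using finite_measure_circ by (rule finite_measure.axioms(1))

lemma nn_integral_circ_half_open:
  assumes [measurable]: "f \<in> borel_measurable borel"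
  shows "(\<integral>\<^sup>+x. f x \<partial>circ) = (\<integral>\<^sup>+x. f x * indicator {0..<2*pi} x \<partial>lborel)"
  unfolding nn_integral_circ[OF assms]
  by (intro nn_integral_cong_AE eventually_mono[OF AE_lborel_singleton[of "2*pi"]])
     (auto split: split_indicator)

lemma periodic_add_int:
  fixes f :: "real \<Rightarrow> 'a" and k :: int
  assumes per: "\<And>x. f (x + 2 * pi) = f x"
  shows "f (x + 2 * pi * of_int k) = f x"
proof (induction k rule: int_induct[where k=0])
  case (step1 i)
  then show ?case using per[of "x + 2 * pi * of_int i"] by (simp add: algebra_simps)
next
  case (step2 i)
  then show ?case using per[of "x + 2 * pi * of_int (i - 1)"] by (simp add: algebra_simps)
qed simp

text \<open>The shift is reduced modulo \<open>2 * pi\<close> to some \<open>a\<close> in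
  \<open>[0, 2 pi)\<close>. The part of \<open>[a, a + 2 pi)\<close> beyond \<open>2 * pi\<close> is
  then moved back by one period.\<close>

lemma nn_integral_circ_shift:
  fixes f :: "real \<Rightarrow> ennreal"
  assumes f [measurable]: "f \<in> borel_measurable borel" and per: "\<And>x. f (x + 2 * pi) = f x"
  shows "(\<integral>\<^sup>+x. f (x + h) \<partial>circ) = (\<integral>\<^sup>+x. f x \<partial>circ)"
proof -
  define k :: real where "k = of_int \<lfloor>h / (2*pi)\<rfloor>"
  define a where "a = h - 2 * pi * k"
  have "k \<le> h / (2*pi)" "h / (2*pi) < k + 1" unfolding k_def by linarith+
  then have a: "0 \<le> a" "a < 2 * pi"
    unfolding a_def by (auto simp: pos_le_divide_eq pos_divide_less_eq algebra_simps)
  have fh: "f (x + h) = f (x + a)" for x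
    using periodic_add_int[where f=f and x="x + a" and k="\<lfloor>h / (2*pi)\<rfloor>", OF per] by (simp add: a_def k_def algebra_simps)
  let ?I = "\<lambda>A. \<integral>\<^sup>+x. f x * indicator A x \<partial>lborel"
  have split: "?I (A \<union> B) = ?I A + ?I B" if "A \<inter> B = {}" and [measurable]: "A \<in> sets borel" "B \<in> sets borel" for A B
    using that(1) by (subst nn_integral_add[symmetric]) (auto intro!: nn_integral_cong split: split_indicator)
  have "(\<integral>\<^sup>+x. f (x + h) \<partial>circ) = (\<integral>\<^sup>+x. f (x + a) * indicator {0..<2*pi} x \<partial>lborel)"
    by (subst nn_integral_circ_half_open) (auto simp: fh)
  also have "\<dots> = ?I {a..<a+2*pi}"
    by (subst nn_integral_real_affine[of "\<lambda>x. f x * indicator {a..<a+2*pi} x" 1 a])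
       (auto intro!: nn_integral_cong simp: add.commute split: split_indicator)
  also have "{a..<a+2*pi} = {a..<2*pi} \<union> {2*pi..<a+2*pi}" using a by auto
  also have "?I \<dots> = ?I {a..<2*pi} + ?I {2*pi..<a+2*pi}" by (rule split) auto
  also have "?I {2*pi..<a+2*pi} = ?I {0..<a}"
    by (subst nn_integral_real_affine[of "\<lambda>x. f x * indicator {2*pi..<a+2*pi} x" 1 "2*pi"])
       (auto intro!: nn_integral_cong simp: per add.commute[of "2*pi"] split: split_indicator)
  also have "?I {a..<2*pi} + ?I {0..<a} = ?I ({a..<2*pi} \<union> {0..<a})" by (rule split[symmetric]) auto
  also have "{a..<2*pi} \<union> {0..<a} = {0..<2*pi}" using a by auto
  finally show ?thesis by (simp add: nn_integral_circ_half_open)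
qed

lemma nn_integral_circ_has_integral:
  fixes f :: "real \<Rightarrow> real"
  assumes f: "continuous_on {0..2*pi} f" "f \<in> borel_measurable borel" and pos: "\<And>x. 0 \<le> f x"
  shows "(\<integral>\<^sup>+x. ennreal (f x) \<partial>circ) = ennreal (integral {0..2*pi} f)"
proof -
  have "(f has_integral (integral {0..2*pi} f)) {0..2*pi}"
    using integrable_continuous_interval[OF f(1)] by (rule integrable_integral)
  from nn_integral_has_integral_lebesgue[OF _ this] pos
  have "(\<integral>\<^sup>+x. indicator {0..2*pi} x * f x \<partial>lborel) = ennreal (integral {0..2*pi} f)" by simp
  then show ?thesis using f(2) pos
    by (subst nn_integral_circ) (auto simp: mult.commute ennreal_mult ennreal_indicator)
qed

section \<open>The Poisson kernel and the Poisson formula\<close>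

definition poisson :: "complex \<Rightarrow> real \<Rightarrow> real" where
  "poisson z \<theta> = (1 - (cmod z)\<^sup>2) / (cmod (cis \<theta> - z))\<^sup>2 * (1 / (2 * pi))"

lemma poisson_nonneg: "cmod z < 1 \<Longrightarrow> 0 \<le> poisson z \<theta>"
  by (simp add: poisson_def abs_square_le_1)

lemma borel_measurable_cis [measurable (raw)]:
  "f \<in> borel_measurable M \<Longrightarrow> (\<lambda>x. cis (f x)) \<in> borel_measurable M"
  by (rule borel_measurable_continuous_on[of cis]) (auto intro!: continuous_intros)

lemma borel_measurable_poisson [measurable (raw)]:
  assumes [measurable]: "f \<in> borel_measurable M" "g \<in> borel_measurable M"
  shows "(\<lambda>x. poisson (f x) (g x)) \<in> borel_measurable M"
  unfolding poisson_def by measurable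

lemma cis_ne: "cmod z < 1 \<Longrightarrow> cis \<theta> \<noteq> z"
  by (metis norm_cis less_irrefl)

lemma continuous_on_poisson [continuous_intros]:
  "cmod z < 1 \<Longrightarrow> continuous_on S g \<Longrightarrow> continuous_on S (\<lambda>x. poisson z (g x))"
  unfolding poisson_def by (intro continuous_intros) (auto simp: cis_ne)

lemma poisson_rotate: "poisson (z * cis t) (\<theta> + t) = poisson z \<theta>"
proof -
  have "cis (\<theta> + t) - z * cis t = (cis \<theta> - z) * cis t" by (simp add: cis_mult[symmetric] algebra_simps)
  then show ?thesis by (simp add: poisson_def norm_mult)
qed

lemma poisson_rotate': "poisson (of_real r * cis t) \<theta> = poisson (of_real r) (\<theta> - t)"
  using poisson_rotate[of "of_real r" t "\<theta> - t"] by simp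

lemma poisson_minus: "poisson (of_real r) (- \<theta>) = poisson (of_real r) \<theta>"
proof -
  have "cmod (cis (-\<theta>) - of_real r) = cmod (cnj (cis \<theta> - of_real r))" by (simp add: cis_cnj)
  then show ?thesis unfolding complex_mod_cnj by (simp add: poisson_def)
qed

text \<open>The kernel is an even function of the difference of the two angles. The symmetry lets
  \<open>dilation_deviation_le\<close> exchange the point of the circle with the point of
  evaluation.\<close>

lemma poisson_commute: "poisson (of_real r * cis t) \<theta> = poisson (of_real r * cis \<theta>) t"
  using poisson_minus[of r "\<theta> - t"] by (simp add: poisson_rotate')

lemma poisson_periodic: "poisson z (\<theta> + 2 * pi) = poisson z \<theta>"
  by (simp add: poisson_def cis.ctr)

lemma cis_periodic: "cis (\<theta> + 2 * pi) = cis \<theta>"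
  by (simp add: cis.ctr)

lemma poisson_le:
  assumes "cmod z < 1" shows "poisson z \<theta> \<le> 1 / (1 - cmod z)"
proof -
  define r where "r = cmod z"
  have r: "0 \<le> r" "r < 1" using assms by (auto simp: r_def)
  have "1 - r \<le> cmod (cis \<theta> - z)" using norm_triangle_ineq2[of "cis \<theta>" z] by (simp add: r_def)
  then have 1: "(1 - r)\<^sup>2 \<le> (cmod (cis \<theta> - z))\<^sup>2" using r by (intro power_mono) auto
  have "poisson z \<theta> \<le> (1 - r\<^sup>2) / (1 - r)\<^sup>2 * (1 / (2 * pi))"
    unfolding poisson_def r_def[symmetric] using 1 r
    by (intro mult_right_mono divide_left_mono mult_pos_pos) (auto simp: power_le_one zero_less_power2 cis_ne assms)
  also have "(1 - r\<^sup>2) / (1 - r)\<^sup>2 = (1 + r) / (1 - r)"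
  proof -
    have "1 - r\<^sup>2 = (1 + r) * (1 - r)" by (simp add: algebra_simps power2_eq_square)
    then show ?thesis using r by (simp add: power2_eq_square)
  qed
  also have "(1 + r) / (1 - r) * (1 / (2*pi)) \<le> 2 / (1 - r) * (1 / 2)"
    using r pi_gt3 by (intro mult_mono divide_right_mono) (auto simp: field_simps)
  also have "2 / (1 - r) * (1 / 2) = 1 / (1 - r)" using r by (simp add: field_simps)
  finally show ?thesis unfolding r_def .
qed

text \<open>Cauchy's formula at \<open>z\<close> for the function \<open>w \<mapsto> F w (1 - |z|^2) / (1 - z' w)\<close>, \<open>z'\<close> the
  conjugate of \<open>z\<close>, is the Poisson formula for \<open>F\<close>.\<close>

lemma has_integral_poisson:
  assumes F: "F holomorphic_on ball 0 R" and R: "1 < R" and z: "cmod z < 1"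
  shows "((\<lambda>\<theta>. F (cis \<theta>) * of_real (poisson z \<theta>)) has_integral F z) {0..2*pi}"
proof -
  define h where "h w = F w * (1 - (cmod z)\<^sup>2) / (1 - cnj z * w)" for w
  have ne: "1 - cnj z * w \<noteq> 0" if "cmod w \<le> 1" for w
  proof
    assume "1 - cnj z * w = 0"
    then have "cmod (cnj z * w) = 1" by (metis eq_iff_diff_eq_0 norm_one)
    moreover have "cmod (cnj z * w) \<le> cmod z * 1" unfolding norm_mult complex_mod_cnj using that by (intro mult_left_mono) auto
    ultimately show False using z by simp
  qed
  have F1: "F holomorphic_on cball 0 1" by (rule holomorphic_on_subset[OF F]) (use R in auto)
  have hol: "h holomorphic_on cball 0 1"
    unfolding h_def by (intro holomorphic_intros F1) (use ne in auto)
  have hz: "h z = F z"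
  proof -
    have "1 - cnj z * z = of_real (1 - (cmod z)\<^sup>2)"
      by (simp add: complex_norm_square[unfolded of_real_power] mult.commute)
    moreover have "of_real (1 - (cmod z)\<^sup>2) \<noteq> (0::complex)"
      using z by (metis abs_norm_cancel abs_square_less_1 eq_iff_diff_eq_0 less_irrefl of_real_eq_0_iff)
    ultimately show ?thesis by (simp add: h_def)
  qed
  have "((\<lambda>u. h u / (u - z)) has_contour_integral (2 * of_real pi * \<i> * h z)) (circlepath 0 1)"
    by (rule Cauchy_integral_circlepath)
       (use hol z in \<open>auto intro: holomorphic_on_imp_continuous_on holomorphic_on_subset\<close>)
  then have "((\<lambda>t. h (0 + of_real 1 * cis t) / (0 + of_real 1 * cis t - z) * of_real 1 * \<i> * cis t)
      has_integral (2 * of_real pi * \<i> * h z)) {0..2*pi}"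
    unfolding circlepath_def by (subst (asm) has_contour_integral_part_circlepath_iff) auto
  then have "((\<lambda>t. inverse (2 * of_real pi * \<i>) * (h (cis t) / (cis t - z) * \<i> * cis t))
      has_integral (inverse (2 * of_real pi * \<i>) * (2 * of_real pi * \<i> * h z))) {0..2*pi}"
    by (intro has_integral_mult_right) simp
  moreover have "inverse (2 * of_real pi * \<i>) * (2 * of_real pi * \<i> * h z) = F z"
    by (simp add: hz field_simps)
  moreover have "inverse (2 * of_real pi * \<i>) * (h (cis t) / (cis t - z) * \<i> * cis t) =
      F (cis t) * of_real (poisson z t)" for t
  proof -
    have c: "cis t * cnj (cis t) = 1" by (simp add: cis_cnj cis_mult)
    \<comment> \<open>On the circle the conjugate is the inverse, so \<open>cis t\<close> times the
      conjugate of \<open>cis t - z\<close> is \<open>1 - cnj z * cis t\<close>. This turns the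
      Cauchy kernel into the Poisson kernel.\<close>
    then have "of_real ((cmod (cis t - z))\<^sup>2) * cis t = (cis t - z) * (1 - cnj z * cis t)"
      unfolding complex_norm_square by (simp add: algebra_simps)
    moreover have "cis t - z \<noteq> 0" "1 - cnj z * cis t \<noteq> 0" using cis_ne[OF z, of t] ne[of "cis t"] by auto
    ultimately have 1: "cis t / ((cis t - z) * (1 - cnj z * cis t)) = 1 / of_real ((cmod (cis t - z))\<^sup>2)"
      by (simp add: divide_simps mult.commute[of "cis t"] del: of_real_power)
    have 2: "inverse (2 * of_real pi * \<i>) * (a / b / c * \<i> * d) = a * (d / (c * b)) * (1 / (2 * of_real pi))"
      for a b c d :: complex by (simp add: field_simps)
    show ?thesis
      unfolding h_def poisson_def 2 1 by simp
  qed
  ultimately show ?thesis by simp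
qed

lemma continuous_on_cis_holomorphic:
  assumes "F holomorphic_on ball 0 R" "1 < R"
  shows "continuous_on S (\<lambda>\<theta>. F (cis \<theta>))"
  by (rule continuous_on_compose2[OF holomorphic_on_imp_continuous_on[OF assms(1)]])
     (use assms(2) in \<open>auto intro!: continuous_intros\<close>)

lemma borel_measurable_cis_holomorphic:
  assumes "F holomorphic_on ball 0 R" "1 < R"
  shows "(\<lambda>\<theta>. F (cis \<theta>)) \<in> borel_measurable borel"
  by (intro borel_measurable_continuous_onI continuous_on_cis_holomorphic[OF assms])

lemma norm_le_poisson:
  assumes F: "F holomorphic_on ball 0 R" and R: "1 < R" and z: "cmod z < 1"
  shows "ennreal (cmod (F z)) \<le> (\<integral>\<^sup>+\<theta>. ennreal (cmod (F (cis \<theta>))) * ennreal (poisson z \<theta>) \<partial>circ)"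
proof -
  note c = continuous_on_cis_holomorphic[OF F R]
  note [measurable] = borel_measurable_cis_holomorphic[OF F R]
  have "cmod (F z) \<le> integral {0..2*pi} (\<lambda>\<theta>. cmod (F (cis \<theta>)) * poisson z \<theta>)"
  proof -
    have "cmod (integral {0..2*pi} (\<lambda>\<theta>. F (cis \<theta>) * of_real (poisson z \<theta>))) \<le>
        integral {0..2*pi} (\<lambda>\<theta>. cmod (F (cis \<theta>)) * poisson z \<theta>)"
      by (rule integral_norm_bound_integral)
         (use z in \<open>auto intro!: integrable_continuous_interval continuous_intros c simp: norm_mult poisson_nonneg\<close>)
    then show ?thesis using has_integral_poisson[OF F R z] by (simp add: integral_unique)
  qed
  also have "ennreal \<dots> = (\<integral>\<^sup>+\<theta>. ennreal (cmod (F (cis \<theta>)) * poisson z \<theta>) \<partial>circ)"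
    by (rule nn_integral_circ_has_integral[symmetric])
       (use z in \<open>auto intro!: continuous_intros c simp: poisson_nonneg\<close>)
  finally show ?thesis by (simp add: ennreal_mult z poisson_nonneg ennreal_leI)
qed

lemma nn_integral_poisson: "cmod z < 1 \<Longrightarrow> (\<integral>\<^sup>+\<theta>. ennreal (poisson z \<theta>) \<partial>circ) = 1"
proof -
  assume z: "cmod z < 1"
  have "((\<lambda>\<theta>. of_real (poisson z \<theta>) :: complex) has_integral of_real 1) {0..2*pi}"
    using has_integral_poisson[of "\<lambda>_. 1" 2 z] z by simp
  then have "(poisson z has_integral 1) {0..2*pi}"
    using has_integral_Re[of "\<lambda>\<theta>. of_real (poisson z \<theta>) :: complex" "of_real 1" "{0..2*pi}"] by simp
  then have "integral {0..2*pi} (poisson z) = 1" by (rule integral_unique)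
  moreover have "(\<integral>\<^sup>+\<theta>. ennreal (poisson z \<theta>) \<partial>circ) = ennreal (integral {0..2*pi} (poisson z))"
    by (rule nn_integral_circ_has_integral) (use z in \<open>auto intro!: continuous_intros simp: poisson_nonneg\<close>)
  ultimately show ?thesis by simp
qed

lemma Lpn_circ_shift:
  assumes "F \<in> borel_measurable borel" "\<And>x. F (x + 2 * pi) = F x"
  shows "Lpn circ p (\<lambda>x. F (x + h)) = Lpn circ p F"
  unfolding Lpn_def using assms
  by (subst nn_integral_circ_shift[where f="\<lambda>x. ennpowr (F x) p"]) auto

text \<open>After a rotation the Poisson integral is an average of translates of \<open>G\<close>
  over the probability measure \<open>N\<close>, which does not depend on \<open>t\<close>.
  Minkowski's inequality and translation invariance then give a contraction.\<close>

lemma Lpn_poisson_le: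
  assumes G [measurable]: "G \<in> borel_measurable borel" and per: "\<And>x. G (x + 2 * pi) = G x"
    and p: "1 \<le> p" and r: "0 \<le> r" "r < 1"
  shows "Lpn circ p (\<lambda>t. \<integral>\<^sup>+\<theta>. G \<theta> * ennreal (poisson (of_real r * cis t) \<theta>) \<partial>circ) \<le> Lpn circ p G"
proof -
  define N where "N = density circ (\<lambda>\<theta>. ennreal (poisson (of_real r) \<theta>))"
  have [measurable_cong]: "sets N = sets borel" by (simp add: N_def)
  have eN: "emeasure N (space N) = 1"
    using nn_integral_poisson[of "of_real r"] r by (simp add: N_def emeasure_density)
  have sN: "sigma_finite_measure N"
    by (intro finite_measure.axioms(1) finite_measureI) (simp add: eN)
  have "(\<integral>\<^sup>+\<theta>. G \<theta> * ennreal (poisson (of_real r * cis t) \<theta>) \<partial>circ) = (\<integral>\<^sup>+\<theta>. G (t + \<theta>) \<partial>N)" for t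
  proof -
    have "(\<integral>\<^sup>+\<theta>. G \<theta> * ennreal (poisson (of_real r * cis t) \<theta>) \<partial>circ) =
        (\<integral>\<^sup>+\<theta>. G (\<theta> + t) * ennreal (poisson (of_real r * cis t) (\<theta> + t)) \<partial>circ)"
      by (rule nn_integral_circ_shift[symmetric]) (auto simp: per poisson_periodic)
    also have "\<dots> = (\<integral>\<^sup>+\<theta>. ennreal (poisson (of_real r) \<theta>) * G (t + \<theta>) \<partial>circ)"
      by (simp only: poisson_rotate) (simp only: mult.commute[of "G _"] add.commute[of _ t])
    also have "\<dots> = (\<integral>\<^sup>+\<theta>. G (t + \<theta>) \<partial>N)" unfolding N_def by (subst nn_integral_density) auto
    finally show ?thesis .
  qed
  then have "Lpn circ p (\<lambda>t. \<integral>\<^sup>+\<theta>. G \<theta> * ennreal (poisson (of_real r * cis t) \<theta>) \<partial>circ) =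
      Lpn circ p (\<lambda>t. \<integral>\<^sup>+\<theta>. G (t + \<theta>) \<partial>N)" by simp
  also have "\<dots> \<le> (\<integral>\<^sup>+\<theta>. Lpn circ p (\<lambda>t. G (t + \<theta>)) \<partial>N)"
    by (rule Lpn_nn_integral_le[OF sigma_finite_circ sN p]) measurable
  also have "\<dots> = (\<integral>\<^sup>+\<theta>. Lpn circ p G \<partial>N)" by (simp add: Lpn_circ_shift[OF G per])
  also have "\<dots> = Lpn circ p G" by (simp add: eN)
  finally show ?thesis .
qed

section \<open>Integral means over circles\<close>

definition circ_norm :: "real \<Rightarrow> (complex \<Rightarrow> complex) \<Rightarrow> real \<Rightarrow> ennreal" where
  "circ_norm p f r = Lpn circ p (\<lambda>\<theta>. ennreal (cmod (f (of_real r * cis \<theta>))))"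

lemma holomorphic_dilate:
  assumes f: "f holomorphic_on ball 0 1" and r: "0 < r" "r < 1"
  shows "(\<lambda>z. f (of_real r * z)) holomorphic_on ball 0 (1 / r)" "1 < 1 / r"
proof -
  have "(f \<circ> (\<lambda>z. of_real r * z)) holomorphic_on ball 0 (1 / r)"
    by (rule holomorphic_on_compose_gen[OF _ f])
       (use r in \<open>auto intro!: holomorphic_intros simp: norm_mult field_simps\<close>)
  then show "(\<lambda>z. f (of_real r * z)) holomorphic_on ball 0 (1 / r)" by (simp add: o_def)
qed (use r in auto)

text \<open>The dilate by \<open>s\<close> is holomorphic beyond the closed disc, and its values on
  the circle of radius \<open>r / s\<close> are dominated by Poisson integrals of its modulus on the
  unit circle.\<close>

lemma circ_norm_mono:
  assumes f: "f holomorphic_on ball 0 1" and p: "1 \<le> p" and r: "0 \<le> r" "r \<le> s" "s < 1"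
  shows "circ_norm p f r \<le> circ_norm p f s"
proof (cases "r = s")
  case False
  then have s: "0 < s" "r < s" using r by auto
  define F where "F z = f (of_real s * z)" for z
  note F = holomorphic_dilate[OF f s(1) r(3), folded F_def]
  note [measurable] = borel_measurable_cis_holomorphic[OF F]
  have rs: "0 \<le> r / s" "r / s < 1" using r s by auto
  have "circ_norm p f r \<le> Lpn circ p (\<lambda>t. \<integral>\<^sup>+\<theta>. ennreal (cmod (F (cis \<theta>))) * ennreal (poisson (of_real (r / s) * cis t) \<theta>) \<partial>circ)"
    unfolding circ_norm_def
  proof (rule Lpn_mono)
    fix t
    have "cmod (of_real (r/s) * cis t) < 1" unfolding norm_mult using rs by (simp del: of_real_divide)
    from norm_le_poisson[OF F this]
    show "ennreal (cmod (f (of_real r * cis t))) \<le> (\<integral>\<^sup>+\<theta>. ennreal (cmod (F (cis \<theta>))) * ennreal (poisson (of_real (r / s) * cis t) \<theta>) \<partial>circ)"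
      using s by (simp add: F_def)
  qed (use p in auto)
  also have "\<dots> \<le> Lpn circ p (\<lambda>\<theta>. ennreal (cmod (F (cis \<theta>))))"
    by (rule Lpn_poisson_le) (use rs p in \<open>auto simp: cis_periodic\<close>)
  finally show ?thesis by (simp add: circ_norm_def F_def)
qed simp

section \<open>Radial convergence in the Hardy space\<close>

text \<open>The library factorization holds near \<open>a\<close> only. It becomes global because
  the quotient of \<open>F\<close> by the power is holomorphic away from \<open>a\<close> and agrees
  with the local factor near \<open>a\<close>.\<close>

lemma factor_zero:
  assumes F: "F holomorphic_on ball 0 R" and a: "a \<in> ball 0 R" "F a = 0" and nz: "w \<in> ball 0 R" "F w \<noteq> 0"
  obtains G n where "G holomorphic_on ball 0 R" "G a \<noteq> 0" "\<And>z. z \<in> ball 0 R \<Longrightarrow> F z = (z - a) ^ n * G z" "0 < n"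
proof -
  have nc: "\<not> F constant_on ball 0 R"
    using a nz unfolding constant_on_def by metis
  obtain g r n where n: "0 < n" and r: "0 < r" "ball a r \<subseteq> ball 0 R" and g: "g holomorphic_on ball a r"
    "\<And>w. w \<in> ball a r \<Longrightarrow> F w = (w - a) ^ n * g w" "\<And>w. w \<in> ball a r \<Longrightarrow> g w \<noteq> 0"
    using holomorphic_factor_zero_nonconstant[OF F open_ball connected_ball a nc] by metis
  define G where "G w = (if w = a then g a else F w / (w - a) ^ n)" for w
  have "G holomorphic_on ball a r"
    using g(1) by (rule holomorphic_transform) (auto simp: G_def g(2))
  moreover have "G holomorphic_on ball 0 R - {a}"
  proof (rule holomorphic_transform[of "\<lambda>w. F w / (w - a) ^ n"])
    show "(\<lambda>w. F w / (w - a) ^ n) holomorphic_on ball 0 R - {a}"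
      by (intro holomorphic_intros holomorphic_on_subset[OF F]) auto
  qed (auto simp: G_def)
  ultimately have "G holomorphic_on ball a r \<union> (ball 0 R - {a})"
    by (rule holomorphic_on_Un) auto
  moreover have "ball a r \<union> (ball 0 R - {a}) = ball 0 R" using r by auto
  ultimately have "G holomorphic_on ball 0 R" by simp
  moreover have "G a \<noteq> 0" using g(3)[of a] r by (simp add: G_def)
  moreover have "F z = (z - a) ^ n * G z" if "z \<in> ball 0 R" for z
    using n a by (auto simp: G_def)
  ultimately show ?thesis by (rule that[OF _ _ _ n])
qed

lemma norm_diff_eq_norm_blaschke:
  assumes "cmod w = 1" shows "cmod (1 - cnj a * w) = cmod (w - a)"
proof -
  have "1 - cnj a * w = w * cnj (w - a)"
    using complex_norm_square[of w] assms by (simp add: algebra_simps)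
  then show ?thesis using assms by (simp only: norm_mult complex_mod_cnj mult_1)
qed

lemma one_minus_cnj_mult_ne_0:
  assumes "cmod a * cmod w < 1" shows "1 - cnj a * w \<noteq> 0"
proof
  assume "1 - cnj a * w = 0"
  then have "cnj a * w = 1" by simp
  then have "cmod (cnj a * w) = 1" by (metis norm_one)
  then show False using assms by (simp add: norm_mult)
qed

text \<open>The zeros in the disc are moved, as Blaschke factors, into one of the two factors of equal
  modulus on the circle.\<close>

lemma balanced_factorization:
  assumes F: "F holomorphic_on ball 0 R" and R: "1 < R" and nz: "\<And>w. cmod w = 1 \<Longrightarrow> F w \<noteq> 0"
  obtains R' u v where "1 < R'" "u holomorphic_on ball 0 R'" "v holomorphic_on ball 0 R'"
    "\<And>z. cmod z \<le> 1 \<Longrightarrow> F z = u z * v z"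
    "\<And>\<theta>. (cmod (u (cis \<theta>)))\<^sup>2 = cmod (F (cis \<theta>))" "\<And>\<theta>. (cmod (v (cis \<theta>)))\<^sup>2 = cmod (F (cis \<theta>))"
proof -
  let ?P = "\<lambda>F. \<exists>R' u v. 1 < R' \<and> u holomorphic_on ball 0 R' \<and> v holomorphic_on ball 0 R' \<and>
    (\<forall>z. cmod z \<le> 1 \<longrightarrow> F z = u z * v z) \<and>
    (\<forall>\<theta>. (cmod (u (cis \<theta>)))\<^sup>2 = cmod (F (cis \<theta>))) \<and> (\<forall>\<theta>. (cmod (v (cis \<theta>)))\<^sup>2 = cmod (F (cis \<theta>)))"
  have fin: "finite {z\<in>cball 0 1. F z = 0}" if F: "F holomorphic_on ball 0 R" and nz: "\<And>w. cmod w = 1 \<Longrightarrow> F w \<noteq> 0" for F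
  proof (cases "F constant_on ball 0 R")
    case True
    then obtain c where c: "\<And>z. z \<in> ball 0 R \<Longrightarrow> F z = c" unfolding constant_on_def by blast
    have "c \<noteq> 0" using c[of 1] nz[of 1] R by simp
    then have "{z\<in>cball 0 1. F z = 0} = {}" using c R by auto
    then show ?thesis by (simp only: finite.emptyI)
  next
    case False
    show ?thesis
      by (rule holomorphic_compact_finite_zeros[OF F _ _ _ _ False]) (use R in auto)
  qed
  \<comment> \<open>Induction on the number of distinct zeros in the closed disc; each step removes
    one zero with its full multiplicity.\<close>
  have "?P F" if "card {z\<in>cball 0 1. F z = 0} = n" "F holomorphic_on ball 0 R" "\<And>w. cmod w = 1 \<Longrightarrow> F w \<noteq> 0" for F n
    using that
  proof (induction n arbitrary: F)
    case 0
    have nz: "F z \<noteq> 0" if "z \<in> cball 0 1" for z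
      using 0(1) fin[OF 0(2,3)] that by auto
    \<comment> \<open>By compactness \<open>F\<close> has no zeros in some disc of radius
      \<open>1 + e\<close>. There it has a holomorphic square root, which serves as both
      factors.\<close>
    define U where "U = {z\<in>ball 0 R. F z \<noteq> 0}"
    have "open U"
    proof -
      have "open (ball 0 R \<inter> F -` (- {0}))"
        by (intro continuous_open_preimage holomorphic_on_imp_continuous_on[OF 0(2)]) auto
      then show ?thesis by (simp add: U_def vimage_def Int_def conj_commute)
    qed
    moreover have "cball 0 1 \<subseteq> U" using nz R by (auto simp: U_def)
    ultimately obtain e where e: "e > 0" "(\<Union>x\<in>cball 0 1. ball x e) \<subseteq> U"
      using compact_subset_open_imp_ball_epsilon_subset[of "cball 0 1" U] by auto
    have sub: "ball 0 (1 + e) \<subseteq> U"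
    proof
      fix z :: complex assume z: "z \<in> ball 0 (1 + e)"
      show "z \<in> U"
      proof (cases "cmod z \<le> 1")
        case True
        then have "z \<in> ball z e" "z \<in> cball 0 1" using e by auto
        then show ?thesis using e(2) by blast
      next
        case False
        then have "sgn z \<in> cball 0 1" by (simp add: norm_sgn)
        moreover have "dist (sgn z) z = cmod z - 1"
        proof -
          have "z = of_real (cmod z) * sgn z" using False by (simp add: sgn_eq)
          then have "sgn z - z = of_real (1 - cmod z) * sgn z" by (simp add: algebra_simps)
          then have "cmod (sgn z - z) = \<bar>1 - cmod z\<bar> * cmod (sgn z)"
            by (simp only: norm_mult norm_of_real)
          then show ?thesis using False by (simp add: dist_norm norm_sgn split: if_splits)
        qed
        ultimately have "sgn z \<in> cball 0 1" "z \<in> ball (sgn z) e" using z by auto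
        then show ?thesis using e(2) by blast
      qed
    qed
    have "F holomorphic_on ball 0 (1 + e)" by (rule holomorphic_on_subset[OF 0(2)]) (use sub in \<open>auto simp: U_def\<close>)
    moreover have "contractible (ball (0::complex) (1 + e))" by (intro convex_imp_contractible) simp
    ultimately obtain g where g: "g holomorphic_on ball 0 (1 + e)" "\<And>z. z \<in> ball 0 (1 + e) \<Longrightarrow> F z = g z ^ 2"
      using contractible_imp_holomorphic_sqrt[of F "ball 0 (1 + e)"] sub unfolding U_def by blast
    have "(cmod (g (cis \<theta>)))\<^sup>2 = cmod (F (cis \<theta>))" for \<theta>
      using g(2)[of "cis \<theta>"] e by (simp add: norm_power)
    moreover have "F z = g z * g z" if "cmod z \<le> 1" for z
      using g(2)[of z] that e by (simp add: power2_eq_square)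
    ultimately show ?case using g(1) e(1)
      by (intro exI[of _ "1 + e"] exI[of _ g]) auto
  next
    case (Suc n)
    let ?Z = "\<lambda>F. {z\<in>cball 0 1. F z = 0}"
    have "?Z F \<noteq> {}" using Suc.prems(1) by (metis card.empty nat.distinct(1))
    then obtain a where a: "cmod a \<le> 1" "F a = 0" by auto
    then have a1: "cmod a < 1" using Suc.prems(3)[of a] by (cases "cmod a = 1") auto
    obtain G k where G: "G holomorphic_on ball 0 R" "G a \<noteq> 0" "\<And>z. z \<in> ball 0 R \<Longrightarrow> F z = (z - a) ^ k * G z" "0 < k"
      by (rule factor_zero[OF Suc.prems(2), of a 1]) (use a R Suc.prems(3)[of 1] in auto)
    \<comment> \<open>Exchanging the zero factor \<open>w - a\<close> for
      \<open>1 - cnj a * w\<close> removes the zero at \<open>a\<close>, creates none in the closed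
      disc, and preserves the modulus on the circle.\<close>
    define H where "H w = (1 - cnj a * w) ^ k * G w" for w
    have ne: "1 - cnj a * w \<noteq> 0" if "cmod w \<le> 1" for w
    proof -
      have "cmod a * cmod w \<le> cmod a * 1" using that by (intro mult_left_mono) auto
      then show ?thesis using a1 by (intro one_minus_cnj_mult_ne_0) auto
    qed
    have H: "H holomorphic_on ball 0 R" unfolding H_def by (intro holomorphic_intros G)
    have norm_H: "cmod (H w) = cmod (F w)" if "cmod w = 1" for w
      using G(3)[of w] norm_diff_eq_norm_blaschke[OF that, of a] that R by (simp add: H_def norm_mult norm_power)
    have "?Z H = ?Z F - {a}"
      using ne G R by (fastforce simp: H_def)
    then have "card (?Z H) = n" using Suc.prems(1) a fin[OF Suc.prems(2,3)] by simp
    moreover have "H w \<noteq> 0" if "cmod w = 1" for w using norm_H[OF that] Suc.prems(3)[OF that] by auto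
    ultimately have "?P H" using Suc.IH[of H] H by simp
    then obtain R' u v where uv: "1 < R'" "u holomorphic_on ball 0 R'" "v holomorphic_on ball 0 R'"
      "\<And>z. cmod z \<le> 1 \<Longrightarrow> H z = u z * v z"
      "\<And>\<theta>. (cmod (u (cis \<theta>)))\<^sup>2 = cmod (H (cis \<theta>))" "\<And>\<theta>. (cmod (v (cis \<theta>)))\<^sup>2 = cmod (H (cis \<theta>))"
      by blast
    define u' where "u' w = u w * ((w - a) / (1 - cnj a * w)) ^ k" for w
    \<comment> \<open>As \<open>cmod a < 1\<close>, the radius \<open>2 / (1 + cmod a)\<close>
      exceeds 1, and its product with \<open>cmod a\<close> is less than 1, so the Blaschke factor
      has no pole in the disc.\<close>
    define R'' where "R'' = min R' (2 / (1 + cmod a))"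
    have R'': "1 < R''" "R'' \<le> R'" using uv(1) a1 by (auto simp: R''_def field_simps add_pos_nonneg)
    have ne': "1 - cnj a * w \<noteq> 0" if "w \<in> ball 0 R''" for w
    proof -
      have w: "cmod w < 2 / (1 + cmod a)" using that by (simp add: R''_def)
      have "cmod a * cmod w \<le> cmod a * (2 / (1 + cmod a))" using w by (intro mult_left_mono) auto
      also have "\<dots> < 1" using a1 by (simp add: field_simps add_pos_nonneg)
      finally show ?thesis by (intro one_minus_cnj_mult_ne_0)
    qed
    have "u' holomorphic_on ball 0 R''"
      unfolding u'_def
      by (intro holomorphic_intros holomorphic_on_subset[OF uv(2)] ne') (use R'' in auto)
    moreover have "v holomorphic_on ball 0 R''"
      using holomorphic_on_subset[OF uv(3)] R'' by (simp add: subset_ball)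
    moreover have "F z = u' z * v z" if "cmod z \<le> 1" for z
      using uv(4)[OF that] ne[OF that] G(3)[of z] that R unfolding u'_def H_def
      by (simp add: power_divide field_simps)
    moreover have "cmod (u' (cis \<theta>)) = cmod (u (cis \<theta>))" for \<theta>
      using norm_diff_eq_norm_blaschke[of "cis \<theta>" a] ne[of "cis \<theta>"]
      by (auto simp: u'_def norm_mult norm_power norm_divide power_divide)
    ultimately show ?case using R''(1) uv(5,6) norm_H
      by (intro exI[of _ R''] exI[of _ u'] exI[of _ v]) auto
  qed
  from this[OF refl F nz] show ?thesis using that by blast
qed

text \<open>The variance identity for the Poisson measure at \<open>z\<close>, for which
  \<open>u z\<close> is the mean of \<open>u\<close>.\<close>

lemma integral_poisson_norm_diff:
  assumes u: "u holomorphic_on ball 0 R" and R: "1 < R" and z: "cmod z < 1"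
  shows "integral {0..2*pi} (\<lambda>\<theta>. (cmod (u (cis \<theta>) - u z))\<^sup>2 * poisson z \<theta>) =
    integral {0..2*pi} (\<lambda>\<theta>. (cmod (u (cis \<theta>)))\<^sup>2 * poisson z \<theta>) - (cmod (u z))\<^sup>2"
proof -
  note c = continuous_on_cis_holomorphic[OF u R]
  let ?A = "integral {0..2*pi} (\<lambda>\<theta>. (cmod (u (cis \<theta>)))\<^sup>2 * poisson z \<theta>)"
  have 1: "((\<lambda>\<theta>. (cmod (u (cis \<theta>)))\<^sup>2 * poisson z \<theta>) has_integral ?A) {0..2*pi}"
    by (intro integrable_integral integrable_continuous_interval continuous_intros c z)
  have "((\<lambda>\<theta>. cnj (u z) * (u (cis \<theta>) * of_real (poisson z \<theta>))) has_integral (cnj (u z) * u z)) {0..2*pi}"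
    by (intro has_integral_mult_right has_integral_poisson[OF u R z])
  from has_integral_Re[OF this]
  have 2: "((\<lambda>\<theta>. Re (cnj (u z) * u (cis \<theta>)) * poisson z \<theta>) has_integral (cmod (u z))\<^sup>2) {0..2*pi}"
    by (simp add: cmod_power2) (simp add: power2_eq_square algebra_simps)
  have "((\<lambda>\<theta>. (1::complex) * of_real (poisson z \<theta>)) has_integral 1) {0..2*pi}"
    using has_integral_poisson[of "\<lambda>_. 1" 2 z] z by simp
  from has_integral_mult_right[OF has_integral_Re[OF this], of "(cmod (u z))\<^sup>2"]
  have 3: "((\<lambda>\<theta>. (cmod (u z))\<^sup>2 * poisson z \<theta>) has_integral (cmod (u z))\<^sup>2) {0..2*pi}" by simp
  have "((\<lambda>\<theta>. (cmod (u (cis \<theta>)))\<^sup>2 * poisson z \<theta> - 2 * (Re (cnj (u z) * u (cis \<theta>)) * poisson z \<theta>)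
      + (cmod (u z))\<^sup>2 * poisson z \<theta>) has_integral (?A - 2 * (cmod (u z))\<^sup>2 + (cmod (u z))\<^sup>2)) {0..2*pi}"
    by (intro has_integral_add has_integral_diff has_integral_mult_right 1 2 3)
  moreover have "(cmod (u (cis \<theta>)))\<^sup>2 * poisson z \<theta> - 2 * (Re (cnj (u z) * u (cis \<theta>)) * poisson z \<theta>)
      + (cmod (u z))\<^sup>2 * poisson z \<theta> = (cmod (u (cis \<theta>) - u z))\<^sup>2 * poisson z \<theta>" for \<theta>
    by (simp add: cmod_power2) (simp add: algebra_simps power2_eq_square)
  ultimately show ?thesis by (simp add: integral_unique)
qed

text \<open>A form of the uniform complex convexity of \<open>L^1\<close>: with \<open>F = u v\<close> as above one has
  \<open>F - F z = u z (v - v z) + (u - u z) v\<close>, and the variances of \<open>u\<close> and \<open>v\<close> are controlled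
  by the gap between the mean of \<open>|F|\<close> and \<open>|F z|\<close>.\<close>

lemma poisson_deviation_le:
  assumes F: "F holomorphic_on ball 0 R" and R: "1 < R" and nz: "\<And>w. cmod w = 1 \<Longrightarrow> F w \<noteq> 0"
    and z: "cmod z < 1" and \<eta>: "0 < \<eta>"
  shows "(\<integral>\<^sup>+\<theta>. ennreal (cmod (F (cis \<theta>) - F z)) * ennreal (poisson z \<theta>) \<partial>circ) + ennreal (1 / \<eta>) * ennreal (cmod (F z))
    \<le> ennreal (\<eta> + 1 / \<eta>) * (\<integral>\<^sup>+\<theta>. ennreal (cmod (F (cis \<theta>))) * ennreal (poisson z \<theta>) \<partial>circ)"
proof -
  obtain R' u v where R': "1 < R'" and u: "u holomorphic_on ball 0 R'" and v: "v holomorphic_on ball 0 R'"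
    and Fuv: "\<And>z. cmod z \<le> 1 \<Longrightarrow> F z = u z * v z"
    and nu: "\<And>\<theta>. (cmod (u (cis \<theta>)))\<^sup>2 = cmod (F (cis \<theta>))" and nv: "\<And>\<theta>. (cmod (v (cis \<theta>)))\<^sup>2 = cmod (F (cis \<theta>))"
    using balanced_factorization[OF F R nz] by metis
  note c = continuous_on_cis_holomorphic[OF F R] continuous_on_cis_holomorphic[OF u R'] continuous_on_cis_holomorphic[OF v R']
  note bm = borel_measurable_cis_holomorphic[OF F R]
  note pos = poisson_nonneg[OF z]
  define E where "E h = integral {0..2*pi} (\<lambda>\<theta>. h \<theta> * poisson z \<theta>)" for h
  define A where "A = E (\<lambda>\<theta>. cmod (F (cis \<theta>)))"
  define D where "D = E (\<lambda>\<theta>. cmod (F (cis \<theta>) - F z))"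
  have ipos: "0 \<le> E h" if "\<And>\<theta>. 0 \<le> h \<theta>" for h

    unfolding E_def using that pos
    by (cases "(\<lambda>\<theta>. h \<theta> * poisson z \<theta>) integrable_on {0..2*pi}")
       (auto intro!: Henstock_Kurzweil_Integration.integral_nonneg simp: not_integrable_integral)
  have Eu: "E (\<lambda>\<theta>. (cmod (u (cis \<theta>) - u z))\<^sup>2) = A - (cmod (u z))\<^sup>2"
    using integral_poisson_norm_diff[OF u R' z] by (simp add: E_def A_def nu)
  have Ev: "E (\<lambda>\<theta>. (cmod (v (cis \<theta>) - v z))\<^sup>2) = A - (cmod (v z))\<^sup>2"
    using integral_poisson_norm_diff[OF v R' z] by (simp add: E_def A_def nv)
  have E1: "E (\<lambda>\<theta>. 1) = 1"
  proof -
    have "((\<lambda>\<theta>. (1::complex) * of_real (poisson z \<theta>)) has_integral 1) {0..2*pi}"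
      using has_integral_poisson[of "\<lambda>_. 1" 2 z] z by simp
    from integral_unique[OF has_integral_Re[OF this]] show ?thesis by (simp add: E_def)
  qed
  have "D \<le> E (\<lambda>\<theta>. \<eta> / 2 * ((cmod (u z))\<^sup>2 * 1 + cmod (F (cis \<theta>))) +
      1 / (2 * \<eta>) * ((cmod (v (cis \<theta>) - v z))\<^sup>2 + (cmod (u (cis \<theta>) - u z))\<^sup>2))"
    unfolding D_def E_def
  proof (intro integral_le integrable_continuous_interval continuous_intros c z mult_right_mono pos)
    fix \<theta>
    \<comment> \<open>The weight \<open>\<eta>\<close> stays free here; \<open>radial_cauchy\<close>
      takes it small in terms of the error allowed.\<close>
    have amgm: "x * y \<le> \<eta> / 2 * x\<^sup>2 + 1 / (2 * \<eta>) * y\<^sup>2" for x y :: real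
    proof -
      have "0 \<le> (\<eta> * x - y)\<^sup>2 / (2 * \<eta>)" using \<eta> by simp
      also have "\<dots> = \<eta> / 2 * x\<^sup>2 + 1 / (2 * \<eta>) * y\<^sup>2 - x * y"
        using \<eta> by (simp add: power2_eq_square field_simps)
      finally show ?thesis by simp
    qed
    have "F (cis \<theta>) - F z = u z * (v (cis \<theta>) - v z) + v (cis \<theta>) * (u (cis \<theta>) - u z)"
      using Fuv[of z] Fuv[of "cis \<theta>"] z by (simp add: algebra_simps)
    then have "cmod (F (cis \<theta>) - F z) \<le> cmod (u z) * cmod (v (cis \<theta>) - v z) + cmod (v (cis \<theta>)) * cmod (u (cis \<theta>) - u z)"
      by (metis norm_mult norm_triangle_ineq)
    also have "\<dots> \<le> \<eta> / 2 * ((cmod (u z))\<^sup>2 * 1 + cmod (F (cis \<theta>))) +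
      1 / (2 * \<eta>) * ((cmod (v (cis \<theta>) - v z))\<^sup>2 + (cmod (u (cis \<theta>) - u z))\<^sup>2)"
      using amgm[of "cmod (u z)" "cmod (v (cis \<theta>) - v z)"] amgm[of "cmod (v (cis \<theta>))" "cmod (u (cis \<theta>) - u z)"]
      unfolding nv[symmetric] by (simp add: algebra_simps)
    finally show "cmod (F (cis \<theta>) - F z) \<le> \<eta> / 2 * ((cmod (u z))\<^sup>2 * 1 + cmod (F (cis \<theta>))) +
      1 / (2 * \<eta>) * ((cmod (v (cis \<theta>) - v z))\<^sup>2 + (cmod (u (cis \<theta>) - u z))\<^sup>2)" .
  qed
  also have "\<dots> = \<eta> / 2 * ((cmod (u z))\<^sup>2 * E (\<lambda>\<theta>. 1) + A) +
      1 / (2 * \<eta>) * (E (\<lambda>\<theta>. (cmod (v (cis \<theta>) - v z))\<^sup>2) + E (\<lambda>\<theta>. (cmod (u (cis \<theta>) - u z))\<^sup>2))"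
  proof -
    have i: "((\<lambda>\<theta>. h \<theta> * poisson z \<theta>) has_integral E h) {0..2*pi}" if "continuous_on {0..2*pi} h" for h
      unfolding E_def
      by (intro integrable_integral integrable_continuous_interval continuous_intros that z)
    have "((\<lambda>\<theta>. \<eta> / 2 * ((cmod (u z))\<^sup>2 * (1 * poisson z \<theta>) + cmod (F (cis \<theta>)) * poisson z \<theta>) +
      1 / (2 * \<eta>) * ((cmod (v (cis \<theta>) - v z))\<^sup>2 * poisson z \<theta> + (cmod (u (cis \<theta>) - u z))\<^sup>2 * poisson z \<theta>)) has_integral
      (\<eta> / 2 * ((cmod (u z))\<^sup>2 * E (\<lambda>\<theta>. 1) + A) +
      1 / (2 * \<eta>) * (E (\<lambda>\<theta>. (cmod (v (cis \<theta>) - v z))\<^sup>2) + E (\<lambda>\<theta>. (cmod (u (cis \<theta>) - u z))\<^sup>2)))) {0..2*pi}"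
      unfolding A_def by (intro has_integral_add has_integral_mult_right i continuous_intros c)
    then show ?thesis unfolding E_def[of "\<lambda>\<theta>. \<eta> / 2 * _ \<theta> + _ \<theta>"]
      by (intro integral_unique) (simp add: algebra_simps)
  qed
  also have "\<dots> \<le> \<eta> * A + 1 / \<eta> * (A - cmod (F z))"
  proof -
    have "0 \<le> A - (cmod (u z))\<^sup>2" unfolding Eu[symmetric] by (intro ipos) simp
    then have "\<eta> / 2 * ((cmod (u z))\<^sup>2 * E (\<lambda>\<theta>. 1) + A) \<le> \<eta> / 2 * (A + A)"
      using \<eta> by (intro mult_left_mono) (auto simp: E1)
    \<comment> \<open>Since \<open>cmod (F z)\<close> is the product of the moduli of
      \<open>u z\<close> and \<open>v z\<close>, it is at most half the sum of their squares, so the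
      two variances add up to at most \<open>2 * (A - cmod (F z))\<close>.\<close>
    moreover have "2 * cmod (F z) \<le> (cmod (u z))\<^sup>2 + (cmod (v z))\<^sup>2"
      using Fuv[of z] z sum_squares_bound[of "cmod (u z)" "cmod (v z)"] by (simp add: norm_mult)
    then have "1 / (2 * \<eta>) * (E (\<lambda>\<theta>. (cmod (v (cis \<theta>) - v z))\<^sup>2) + E (\<lambda>\<theta>. (cmod (u (cis \<theta>) - u z))\<^sup>2))
        \<le> 1 / (2 * \<eta>) * (2 * (A - cmod (F z)))"
      unfolding Eu Ev using \<eta> by (intro mult_left_mono) auto
    moreover have "1 / (2 * \<eta>) * (2 * (A - cmod (F z))) = 1 / \<eta> * (A - cmod (F z))" "\<eta> / 2 * (A + A) = \<eta> * A"
      using \<eta> by (simp_all add: field_simps)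
    ultimately show ?thesis by linarith
  qed
  finally have main: "D + 1 / \<eta> * cmod (F z) \<le> (\<eta> + 1 / \<eta>) * A"
    unfolding distrib_right right_diff_distrib by linarith
  have D0: "D \<ge> 0" "A \<ge> 0" unfolding D_def A_def by (intro ipos, simp)+
  have eD: "(\<integral>\<^sup>+\<theta>. ennreal (cmod (F (cis \<theta>) - F z)) * ennreal (poisson z \<theta>) \<partial>circ) = ennreal D"
    unfolding D_def E_def ennreal_mult[OF norm_ge_zero pos, symmetric] using bm
    by (intro nn_integral_circ_has_integral continuous_intros c z) (auto simp: pos)
  have eA: "(\<integral>\<^sup>+\<theta>. ennreal (cmod (F (cis \<theta>))) * ennreal (poisson z \<theta>) \<partial>circ) = ennreal A"
    unfolding A_def E_def ennreal_mult[OF norm_ge_zero pos, symmetric] using bm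
    by (intro nn_integral_circ_has_integral continuous_intros c z) (auto simp: pos)
  show ?thesis unfolding eD eA using main D0 \<eta>
    by (simp flip: ennreal_mult ennreal_plus add: ennreal_leI)
qed

text \<open>The value \<open>F (s^2 cis \<theta>)\<close> is the Poisson mean at
  \<open>s cis \<theta>\<close> of the values \<open>F (s cis t)\<close>. By the symmetry of the
  kernel and Fubini, the distance to the dilate by \<open>s^2\<close> is at most the integral over
  \<open>t\<close> of the Poisson deviations at \<open>s cis t\<close>, to which
  \<open>poisson_deviation_le\<close> applies. Keeping the term with \<open>1 / \<eta>\<close> on
  the left avoids subtraction.\<close>

lemma dilation_deviation_le:
  assumes F: "F holomorphic_on ball 0 R" and R: "1 < R" and nz: "\<And>w. cmod w = 1 \<Longrightarrow> F w \<noteq> 0"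
    and s: "0 \<le> s" "s < 1" and \<eta>: "0 < \<eta>"
  shows "(\<integral>\<^sup>+\<theta>. ennreal (cmod (F (cis \<theta>) - F (of_real (s * s) * cis \<theta>))) \<partial>circ) +
      ennreal (1 / \<eta>) * (\<integral>\<^sup>+\<theta>. ennreal (cmod (F (of_real s * cis \<theta>))) \<partial>circ)
    \<le> ennreal (\<eta> + 1 / \<eta>) * (\<integral>\<^sup>+\<theta>. ennreal (cmod (F (cis \<theta>))) \<partial>circ)"
proof -
  interpret pair_sigma_finite circ circ by (intro pair_sigma_finite.intro sigma_finite_circ)
  have Fs: "(\<lambda>w. F (of_real s * w)) holomorphic_on ball 0 R"
  proof -
    have "(F \<circ> (\<lambda>w. of_real s * w)) holomorphic_on ball 0 R"
    proof (rule holomorphic_on_compose_gen[OF _ F])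
      show "(\<lambda>w. of_real s * w) ` ball (0::complex) R \<subseteq> ball 0 R"
      proof (rule image_subsetI)
        fix w :: complex assume "w \<in> ball 0 R"
        then have "s * cmod w < R" using s R mult_left_le_one_le[of "cmod w" s] by auto
        then show "of_real s * w \<in> ball 0 R" using s by (simp add: norm_mult)
      qed
    qed (auto intro!: holomorphic_intros)
    then show ?thesis by (simp add: o_def)
  qed
  note [measurable] = borel_measurable_cis_holomorphic[OF F R] borel_measurable_cis_holomorphic[OF Fs R]
  have zs: "cmod (of_real s * cis t) < 1" for t using s by (simp add: norm_mult)
  have "(\<integral>\<^sup>+\<theta>. ennreal (cmod (F (cis \<theta>) - F (of_real (s * s) * cis \<theta>))) \<partial>circ) \<le>
      (\<integral>\<^sup>+\<theta>. (\<integral>\<^sup>+t. ennreal (cmod (F (cis \<theta>) - F (of_real s * cis t))) * ennreal (poisson (of_real s * cis t) \<theta>) \<partial>circ) \<partial>circ)"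
  proof (rule nn_integral_mono)
    fix \<theta>
    have "(\<lambda>w. F (cis \<theta>) - F (of_real s * w)) holomorphic_on ball 0 R" by (intro holomorphic_intros Fs)
    from norm_le_poisson[OF this R zs[of \<theta>]]
    show "ennreal (cmod (F (cis \<theta>) - F (of_real (s * s) * cis \<theta>))) \<le>
      (\<integral>\<^sup>+t. ennreal (cmod (F (cis \<theta>) - F (of_real s * cis t))) * ennreal (poisson (of_real s * cis t) \<theta>) \<partial>circ)"
      by (subst poisson_commute) (simp add: mult.assoc)
  qed
  also have "\<dots> = (\<integral>\<^sup>+t. (\<integral>\<^sup>+\<theta>. ennreal (cmod (F (cis \<theta>) - F (of_real s * cis t))) * ennreal (poisson (of_real s * cis t) \<theta>) \<partial>circ) \<partial>circ)"
    by (rule Fubini') measurable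
  finally have "(\<integral>\<^sup>+\<theta>. ennreal (cmod (F (cis \<theta>) - F (of_real (s * s) * cis \<theta>))) \<partial>circ) \<le>
      (\<integral>\<^sup>+t. (\<integral>\<^sup>+\<theta>. ennreal (cmod (F (cis \<theta>) - F (of_real s * cis t))) * ennreal (poisson (of_real s * cis t) \<theta>) \<partial>circ) \<partial>circ)" .
  then have "(\<integral>\<^sup>+\<theta>. ennreal (cmod (F (cis \<theta>) - F (of_real (s * s) * cis \<theta>))) \<partial>circ) +
      ennreal (1 / \<eta>) * (\<integral>\<^sup>+\<theta>. ennreal (cmod (F (of_real s * cis \<theta>))) \<partial>circ) \<le>
      (\<integral>\<^sup>+t. (\<integral>\<^sup>+\<theta>. ennreal (cmod (F (cis \<theta>) - F (of_real s * cis t))) * ennreal (poisson (of_real s * cis t) \<theta>) \<partial>circ) \<partial>circ)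
       + (\<integral>\<^sup>+t. ennreal (1 / \<eta>) * ennreal (cmod (F (of_real s * cis t))) \<partial>circ)"
    by (subst nn_integral_cmult) (auto intro!: add_right_mono)
  also have "\<dots> = (\<integral>\<^sup>+t. (\<integral>\<^sup>+\<theta>. ennreal (cmod (F (cis \<theta>) - F (of_real s * cis t))) * ennreal (poisson (of_real s * cis t) \<theta>) \<partial>circ) +
      ennreal (1 / \<eta>) * ennreal (cmod (F (of_real s * cis t))) \<partial>circ)"
    by (subst nn_integral_add) auto
  also have "\<dots> \<le> (\<integral>\<^sup>+t. ennreal (\<eta> + 1 / \<eta>) * (\<integral>\<^sup>+\<theta>. ennreal (cmod (F (cis \<theta>))) * ennreal (poisson (of_real s * cis t) \<theta>) \<partial>circ) \<partial>circ)"
    by (intro nn_integral_mono poisson_deviation_le[OF F R nz zs \<eta>])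
  also have "\<dots> = ennreal (\<eta> + 1 / \<eta>) * (\<integral>\<^sup>+t. (\<integral>\<^sup>+\<theta>. ennreal (cmod (F (cis \<theta>))) * ennreal (poisson (of_real s * cis t) \<theta>) \<partial>circ) \<partial>circ)"
    by (rule nn_integral_cmult) measurable
  also have "\<dots> \<le> ennreal (\<eta> + 1 / \<eta>) * (\<integral>\<^sup>+\<theta>. ennreal (cmod (F (cis \<theta>))) \<partial>circ)"
    using Lpn_poisson_le[of "\<lambda>\<theta>. ennreal (cmod (F (cis \<theta>)))" 1 s] s
    by (intro mult_left_mono) (auto simp: Lpn_1 cis_periodic)
  finally show ?thesis .
qed

section \<open>Cauchy property of the dilations in L^1\<close>

lemma nonvanishing_radius:
  assumes f: "f holomorphic_on ball 0 1" and nz: "z \<in> ball 0 1" "f z \<noteq> 0" and a: "a < 1"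
  obtains r where "a < r" "0 < r" "r < 1" "\<And>w. cmod w = r \<Longrightarrow> f w \<noteq> 0"
proof (cases "f constant_on ball 0 1")
  case True
  then obtain c where c: "\<And>w. w \<in> ball 0 1 \<Longrightarrow> f w = c" unfolding constant_on_def by blast
  have nz': "f w \<noteq> 0" if "cmod w < 1" for w using c[of w] c[of z] nz that by auto
  show ?thesis
  proof (rule that[of "max (1/2) ((a + 1) / 2)"])
    show "a < max (1/2) ((a + 1) / 2)" "0 < max (1/2) ((a + 1) / 2)" "max (1/2) ((a + 1) / 2) < 1"
      using a by (simp_all add: less_max_iff_disj)
    then show "f w \<noteq> 0" if "cmod w = max (1/2) ((a + 1) / 2)" for w using nz' that by simp
  qed
next
  case False
  define b where "b = (max a 0 + 1) / 2"
  have b: "max a 0 < b" "b < 1" using a by (auto simp: b_def max_def)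
  have "finite {z\<in>cball 0 b. f z = 0}"
    by (rule holomorphic_compact_finite_zeros[OF f _ _ _ _ False]) (use b in auto)
  then have "finite (cmod ` {z\<in>cball 0 b. f z = 0})" by (rule finite_imageI)
  moreover have "infinite {max a 0<..<b}" using b by (intro infinite_Ioo)
  ultimately have "\<not> {max a 0<..<b} \<subseteq> cmod ` {z\<in>cball 0 b. f z = 0}"
    using finite_subset by blast
  then obtain r where r: "r \<in> {max a 0<..<b}" "r \<notin> cmod ` {z\<in>cball 0 b. f z = 0}" by blast
  show ?thesis
    by (rule that[of r]) (use r b in auto)
qed

lemma holomorphic_radius_measurable:
  assumes "f holomorphic_on ball 0 1" "0 \<le> r" "r < 1"
  shows "(\<lambda>\<theta>. f (of_real r * cis \<theta>)) \<in> borel_measurable borel"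
  by (intro borel_measurable_continuous_onI
      continuous_on_compose2[OF holomorphic_on_imp_continuous_on[OF assms(1)]] continuous_intros)
    (use assms in \<open>auto simp: norm_mult\<close>)

text \<open>The means \<open>n r\<close> increase to a finite supremum, so beyond some
  \<open>r1\<close> they vary by at most \<open>\<delta>\<close>, and
  \<open>dilation_deviation_le\<close> bounds the distance by
  \<open>\<eta> * L' + \<delta> / \<eta>\<close>. Only the outer radius \<open>r\<close> has to
  avoid zeros.\<close>

lemma radial_cauchy:
  assumes f: "f holomorphic_on ball 0 1" and L: "\<And>r. 0 \<le> r \<Longrightarrow> r < 1 \<Longrightarrow> circ_norm 1 f r \<le> ennreal L"
    and \<epsilon>: "0 < \<epsilon>"
  obtains r0 where "0 < r0" "r0 < 1" "\<And>r r'. r0 \<le> r' \<Longrightarrow> r' < r \<Longrightarrow> r < 1 \<Longrightarrow> (\<And>w. cmod w = r \<Longrightarrow> f w \<noteq> 0) \<Longrightarrow>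
    (\<integral>\<^sup>+\<theta>. ennreal (cmod (f (of_real r * cis \<theta>) - f (of_real r' * cis \<theta>))) \<partial>circ) \<le> ennreal \<epsilon>"
proof -
  define L' where "L' = max L 0"
  define n where "n r = enn2real (circ_norm 1 f r)" for r
  have n: "circ_norm 1 f r = ennreal (n r)" "n r \<le> L'" "0 \<le> n r" if "0 \<le> r" "r < 1" for r
  proof -
    have le: "circ_norm 1 f r \<le> ennreal L'"
      using L[OF that] by (rule order_trans) (simp add: L'_def ennreal_leI)
    then show eq: "circ_norm 1 f r = ennreal (n r)"
      unfolding n_def by (intro ennreal_enn2real[symmetric]) (auto intro: le_less_trans)
    show "n r \<le> L'" using le unfolding eq by (subst (asm) ennreal_le_iff) (auto simp: L'_def)
  qed (simp add: n_def)
  have n_mono: "n r \<le> n s" if "0 \<le> r" "r \<le> s" "s < 1" for r s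
    using circ_norm_mono[OF f order_refl that] that by (simp add: n)
  \<comment> \<open>With these choices \<open>\<eta> * L'\<close> and
    \<open>\<delta> / \<eta>\<close> are each at most \<open>\<epsilon> / 2\<close>.\<close>
  define \<eta> where "\<eta> = \<epsilon> / (2 * (L' + 1))"
  define \<delta> where "\<delta> = \<eta> * \<epsilon> / 2"
  have L'0: "L' \<ge> 0" by (simp add: L'_def)
  have \<eta>: "\<eta> > 0" "\<eta> * L' \<le> \<epsilon> / 2" using \<epsilon> L'0 by (auto simp: \<eta>_def field_simps)
  have \<delta>: "\<delta> > 0" "\<delta> / \<eta> = \<epsilon> / 2" using \<epsilon> \<eta> by (auto simp: \<delta>_def)
  have bdd: "bdd_above (n ` {0..<1})" using n(2) by (intro bdd_aboveI[of _ L']) auto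
  define S where "S = (SUP r\<in>{0..<1}. n r)"
  have "S - \<delta> < (SUP r\<in>{0..<1}. n r)" using \<delta> by (simp add: S_def)
  then obtain r1 where r1: "0 \<le> r1" "r1 < 1" "S - \<delta> < n r1"
    using less_cSUP_iff[OF _ bdd] by auto
  show ?thesis
  proof (rule that[of "max r1 (1/2)"])
    fix r r' assume r: "max r1 (1/2) \<le> r'" "r' < r" "r < 1" and nz: "\<And>w. cmod w = r \<Longrightarrow> f w \<noteq> 0"
    have r0: "0 < r'" "0 < r" using r by auto
    define F where "F z = f (of_real r * z)" for z
    note F = holomorphic_dilate[OF f r0(2) r(3), folded F_def]
    have Fnz: "F w \<noteq> 0" if "cmod w = 1" for w using nz r0 that by (simp add: F_def norm_mult)
    \<comment> \<open>Two dilations by \<open>s\<close> lead from \<open>r\<close> to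
      \<open>r'\<close>; the intermediate radius \<open>r * s\<close> still lies above
      \<open>r'\<close>, hence above \<open>r1\<close>.\<close>
    define s where "s = sqrt (r' / r)"
    have ss: "s * s = r' / r" using r0 by (simp add: s_def)
    have s: "0 \<le> s" "s < 1" using r0 r by (auto simp: s_def)
    have rs: "r' \<le> r * s" "r * s < 1"
    proof -
      have "s * s \<le> s" using s by (simp add: mult_left_le)
      then have "r * (s * s) \<le> r * s" using r0 by (intro mult_left_mono) auto
      then show "r' \<le> r * s" using ss r0 by simp
      have "r * s \<le> r * 1" using s r0 by (intro mult_left_mono) auto
      then show "r * s < 1" using r by linarith
    qed
    define d where "d = (\<integral>\<^sup>+\<theta>. ennreal (cmod (f (of_real r * cis \<theta>) - f (of_real r' * cis \<theta>))) \<partial>circ)"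
    have e1: "F (of_real (s * s) * cis \<theta>) = f (of_real r' * cis \<theta>)" for \<theta>
    proof -
      have "of_real r * (of_real (s * s) * cis \<theta>) = of_real (r * (s * s)) * cis \<theta>" by simp
      also have "r * (s * s) = r'" using r0 by (simp add: ss)
      finally show ?thesis unfolding F_def by (rule arg_cong)
    qed
    have e2: "(\<integral>\<^sup>+\<theta>. ennreal (cmod (F (of_real s * cis \<theta>))) \<partial>circ) = ennreal (n (r * s))"
      using n(1)[of "r * s"] rs r0 by (simp add: F_def circ_norm_def Lpn_1 mult.assoc)
    have e3: "(\<integral>\<^sup>+\<theta>. ennreal (cmod (F (cis \<theta>))) \<partial>circ) = ennreal (n r)"
      using n(1)[of r] r r0 by (simp add: F_def circ_norm_def Lpn_1)
    have "d + ennreal (1 / \<eta>) * ennreal (n (r * s)) \<le> ennreal (\<eta> + 1 / \<eta>) * ennreal (n r)"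
      using dilation_deviation_le[OF F Fnz s \<eta>(1)] unfolding e1 e2 e3 by (simp add: d_def F_def)
    then have le: "d + ennreal (1 / \<eta> * n (r * s)) \<le> ennreal ((\<eta> + 1 / \<eta>) * n r)"
      using \<eta> n(3)[of "r * s"] n(3)[of r] rs r r0 by (subst (1 2) ennreal_mult) auto
    have "d < top"
      using le by (metis add_left_mono ennreal_less_top le_less_trans zero_le add.right_neutral)
    then obtain d' where d': "d = ennreal d'" "d' \<ge> 0" by (cases d) auto
    have "d' + 1 / \<eta> * n (r * s) \<le> (\<eta> + 1 / \<eta>) * n r"
      using le d' \<eta> n(3)[of "r * s"] n(3)[of r] rs r r0 by (simp flip: ennreal_plus)
    then have "d' \<le> \<eta> * n r + (n r - n (r * s)) / \<eta>"
      by (simp add: algebra_simps diff_divide_distrib)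
    also have "n r \<le> S" unfolding S_def using r r0 by (intro cSUP_upper bdd) auto
    then have "n r - n (r * s) \<le> \<delta>"
      using r1 n_mono[of r1 "r * s"] rs r by auto
    then have "\<eta> * n r + (n r - n (r * s)) / \<eta> \<le> \<eta> * L' + \<delta> / \<eta>"
      using \<eta> n(2)[of r] r r0 by (intro add_mono mult_left_mono divide_right_mono) auto
    also have "\<dots> \<le> \<epsilon>" using \<eta> \<delta> by simp
    finally show "(\<integral>\<^sup>+\<theta>. ennreal (cmod (f (of_real r * cis \<theta>) - f (of_real r' * cis \<theta>))) \<partial>circ) \<le> ennreal \<epsilon>"
      using d' by (simp add: d_def[symmetric] ennreal_leI)
  qed (use r1 in auto)
qed

text \<open>The rate \<open>4^-n\<close> is chosen so that, divided by the thresholds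
  \<open>2^-n\<close> of the weak type estimate, it remains summable.\<close>

lemma radial_sequence:
  assumes f: "f holomorphic_on ball 0 1" and L: "\<And>r. 0 \<le> r \<Longrightarrow> r < 1 \<Longrightarrow> circ_norm 1 f r \<le> ennreal L"
  obtains R :: "nat \<Rightarrow> real" where "\<And>n. 0 < R n" "\<And>n. R n < 1" "R \<longlonglongrightarrow> 1"
    "\<And>n. (\<integral>\<^sup>+\<theta>. ennreal (cmod (f (of_real (R (Suc n)) * cis \<theta>) - f (of_real (R n) * cis \<theta>))) \<partial>circ) \<le> ennreal ((1/4) ^ n)"
proof (cases "\<exists>z\<in>ball 0 1. f z \<noteq> 0")
  \<comment> \<open>The zero function has no zero-free radii and is treated separately, with
    explicit radii.\<close>
  case False
  then have z: "f z = 0" if "cmod z < 1" for z using that by auto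
  show ?thesis
  proof (rule that[of "\<lambda>n. 1 - 1 / (real n + 2)"])
    show "(\<lambda>n. 1 - 1 / (real n + 2)) \<longlonglongrightarrow> 1" by real_asymp
    have R: "0 \<le> 1 - 1 / (real n + 2)" "1 - 1 / (real n + 2) < 1" for n by auto
    have 0: "f (of_real r * cis \<theta>) = 0" if "0 \<le> r" "r < 1" for r \<theta> using that by (intro z) (simp add: norm_mult)
    show "(\<integral>\<^sup>+\<theta>. ennreal (cmod (f (of_real (1 - 1 / (real (Suc n) + 2)) * cis \<theta>) -
        f (of_real (1 - 1 / (real n + 2)) * cis \<theta>))) \<partial>circ) \<le> ennreal ((1/4) ^ n)" for n
      unfolding 0[OF R[of n]] 0[OF R[of "Suc n"]] by simp
  qed auto
next
  case True
  then obtain z where z: "z \<in> ball 0 1" "f z \<noteq> 0" by blast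
  define Q where "Q n r0 \<longleftrightarrow> 0 < r0 \<and> r0 < 1 \<and> (\<forall>r r'. r0 \<le> r' \<longrightarrow> r' < r \<longrightarrow> r < 1 \<longrightarrow>
    (\<forall>w. cmod w = r \<longrightarrow> f w \<noteq> 0) \<longrightarrow>
    (\<integral>\<^sup>+\<theta>. ennreal (cmod (f (of_real r * cis \<theta>) - f (of_real r' * cis \<theta>))) \<partial>circ) \<le> ennreal ((1/4) ^ n))"
    for n :: nat and r0
  have "\<exists>r0. Q n r0" for n
  proof -
    obtain r0 where "0 < r0" "r0 < 1" "\<And>r r'. r0 \<le> r' \<Longrightarrow> r' < r \<Longrightarrow> r < 1 \<Longrightarrow> (\<And>w. cmod w = r \<Longrightarrow> f w \<noteq> 0) \<Longrightarrow>
      (\<integral>\<^sup>+\<theta>. ennreal (cmod (f (of_real r * cis \<theta>) - f (of_real r' * cis \<theta>))) \<partial>circ) \<le> ennreal ((1/4) ^ n)"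
      by (rule radial_cauchy[OF f L, where \<epsilon>="(1/4)^n"]) (auto intro: that)
    then have "Q n r0" by (simp add: Q_def)
    then show ?thesis by blast
  qed
  then obtain \<rho> where Q: "\<And>n. Q n (\<rho> n)" by metis
  then have \<rho>: "0 < \<rho> n" "\<rho> n < 1" for n by (simp_all add: Q_def)
  define P where "P n r \<longleftrightarrow> \<rho> n < r \<and> 1 - 1 / (real n + 2) < r \<and> 0 < r \<and> r < 1 \<and> (\<forall>w. cmod w = r \<longrightarrow> f w \<noteq> 0)" for n r
  have ex: "\<exists>r. P n r \<and> a < r" if "a < 1" for n a
  proof -
    have "max a (max (\<rho> n) (1 - 1 / (real n + 2))) < 1" using that \<rho> by auto
    then obtain r where "max a (max (\<rho> n) (1 - 1 / (real n + 2))) < r" "0 < r" "r < 1" "\<And>w. cmod w = r \<Longrightarrow> f w \<noteq> 0"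
      using nonvanishing_radius[OF f z] by blast
    then show ?thesis unfolding P_def by (intro exI[of _ r]) auto
  qed
  have "\<exists>R. \<forall>n. P n (R n) \<and> R n < R (Suc n)"
  proof (rule dependent_nat_choice)
    show "\<exists>r. P 0 r" using ex[of 0] by auto
    fix r n assume "P n r"
    then show "\<exists>r'. P (Suc n) r' \<and> r < r'" using ex[of r "Suc n"] by (auto simp: P_def)
  qed
  then obtain R where R: "\<And>n. P n (R n)" "\<And>n. R n < R (Suc n)" by blast
  show ?thesis
  proof (rule that[of R])
    show "0 < R n" "R n < 1" for n using R(1)[of n] by (auto simp: P_def)
    show "R \<longlonglongrightarrow> 1"
    proof (rule tendsto_sandwich)
      show "(\<lambda>n. 1 - 1 / (real n + 2)) \<longlonglongrightarrow> 1" by real_asymp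
      show "eventually (\<lambda>n. 1 - 1 / (real n + 2) \<le> R n) sequentially" "eventually (\<lambda>n. R n \<le> 1) sequentially"
        using R(1) by (auto simp: P_def less_imp_le)
    qed simp
    show "(\<integral>\<^sup>+\<theta>. ennreal (cmod (f (of_real (R (Suc n)) * cis \<theta>) - f (of_real (R n) * cis \<theta>))) \<partial>circ) \<le> ennreal ((1/4) ^ n)" for n
      using R(1)[of n] R(1)[of "Suc n"] R(2)[of n] Q[of n] by (simp add: P_def Q_def)
  qed
qed

section \<open>Nontangential limits\<close>

lemma nn_integral_circ_centered:
  fixes h :: "real \<Rightarrow> ennreal"
  assumes [measurable]: "h \<in> borel_measurable borel" and per: "\<And>x. h (x + 2 * pi) = h x"
  shows "(\<integral>\<^sup>+x. h x \<partial>circ) = (\<integral>\<^sup>+x. h (\<theta> + x) * indicator {-pi..pi} x \<partial>lborel)"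
proof -
  have "(\<integral>\<^sup>+x. h x \<partial>circ) = (\<integral>\<^sup>+x. h (x + (\<theta> - pi)) \<partial>circ)"
    by (rule nn_integral_circ_shift[symmetric]) (auto simp: per)
  also have "\<dots> = (\<integral>\<^sup>+x. h (x + (\<theta> - pi)) * indicator {0..2*pi} x \<partial>lborel)"
    by (rule nn_integral_circ) measurable
  also have "\<dots> = (\<integral>\<^sup>+x. h (\<theta> + x) * indicator {-pi..pi} x \<partial>lborel)"
    by (subst (2) nn_integral_real_affine[where c=1 and t="-pi"])
       (auto intro!: nn_integral_cong simp: algebra_simps split: split_indicator)
  finally show ?thesis .
qed

section \<open>Dyadic bounds for the Poisson kernel in a Stolz region\<close>

lemma norm_cis_diff_ge:
  assumes "\<bar>x\<bar> \<le> pi" shows "\<bar>x\<bar> / 2 \<le> cmod (cis (\<theta> + x) - cis \<theta>)"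
proof -
  \<comment> \<open>With \<open>y = 2 t\<close> one has
    \<open>sin y = 2 sin t cos t \<ge> y (cos t)^2\<close> from \<open>tan t \<ge> t\<close>, and
    \<open>(cos t)^2 \<ge> 1/2\<close> because \<open>cos y \<ge> 0\<close>.\<close>
  have sin_ge: "y / 2 \<le> sin y" if y: "0 \<le> y" "y \<le> pi / 2" for y :: real
  proof -
    define t where "t = y / 2"
    have t: "0 \<le> t" "t < pi / 2" using y pi_gt_zero unfolding t_def by linarith+
    have c: "cos t > 0" using t by (intro cos_gt_zero_pi) auto
    have "0 \<le> tan t" using c t by (auto simp: tan_def intro!: divide_nonneg_pos sin_ge_zero)
    then have "t \<le> tan t" using abs_tan_ge[of t] t by auto
    then have "t * cos t \<le> sin t" using c by (simp add: tan_def field_simps)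
    then have "2 * (t * cos t) * cos t \<le> 2 * sin t * cos t" using c by (simp add: mult_right_mono)
    also have "\<dots> = sin y" unfolding t_def by (simp flip: sin_double)
    finally have "y * (cos t)\<^sup>2 \<le> sin y" by (simp add: t_def power2_eq_square mult.assoc)
    moreover have "1 / 2 \<le> (cos t)\<^sup>2"
    proof -
      have "0 \<le> cos y" using y by (intro cos_ge_zero) auto
      moreover have "cos y = 2 * (cos t)\<^sup>2 - 1" unfolding t_def using cos_double_cos[of "y/2"] by simp
      ultimately show ?thesis by simp
    qed
    ultimately show ?thesis using y mult_left_mono[of "1/2" "(cos t)\<^sup>2" y] by simp
  qed
  have "\<bar>x\<bar> / 2 / 2 \<le> sin (\<bar>x\<bar> / 2)" by (rule sin_ge) (use assms in auto)
  also have "\<dots> \<le> \<bar>sin (x / 2)\<bar>" by (cases "x \<ge> 0") auto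
  finally have "\<bar>x\<bar> / 2 \<le> 2 * \<bar>sin (x / 2)\<bar>" by simp
  also have "\<dots> = cmod (cis x - 1)" using dist_exp_i_1[of x] by (simp add: cis_conv_exp)
  also have "\<dots> = cmod (cis \<theta> * (cis x - 1))" by (simp add: norm_mult)
  also have "cis \<theta> * (cis x - 1) = cis (\<theta> + x) - cis \<theta>" by (simp add: cis_mult algebra_simps)
  finally show ?thesis .
qed

text \<open>In the Stolz region both \<open>1 - cmod z\<close> and \<open>\<bar>x\<bar>\<close> are
  at most \<open>2 * (1 + a)\<close> times the distance from \<open>z\<close> to
  \<open>cis (\<theta> + x)\<close>.\<close>

lemma poisson_le_box:
  assumes z: "cmod z < 1" and near: "cmod (z - cis \<theta>) \<le> a * (1 - cmod z)" and a: "0 \<le> a" and x: "\<bar>x\<bar> \<le> pi"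
  shows "poisson z (\<theta> + x) \<le> 4 * (1 + a)\<^sup>2 * ((1 - cmod z) / (max (1 - cmod z) \<bar>x\<bar>)\<^sup>2)"
proof -
  define \<delta> where "\<delta> = 1 - cmod z"
  define d where "d = cmod (cis (\<theta> + x) - z)"
  define m where "m = max \<delta> \<bar>x\<bar>"
  have \<delta>: "0 < \<delta>" "\<delta> \<le> 1" using z by (auto simp: \<delta>_def)
  have d1: "\<delta> \<le> d" unfolding d_def \<delta>_def using norm_triangle_ineq2[of "cis (\<theta> + x)" z] by simp
  have "\<bar>x\<bar> / 2 \<le> cmod (cis (\<theta> + x) - cis \<theta>)" by (rule norm_cis_diff_ge[OF x])
  also have "\<dots> \<le> d + cmod (z - cis \<theta>)"
    unfolding d_def using norm_triangle_ineq[of "cis (\<theta> + x) - z" "z - cis \<theta>"] by simp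
  also have "\<dots> \<le> d + a * d" using near d1 mult_left_mono[OF d1 a] by (simp add: \<delta>_def)
  finally have "\<bar>x\<bar> \<le> 2 * (1 + a) * d" by (simp add: algebra_simps)
  moreover have "\<delta> \<le> 2 * (1 + a) * d"
  proof -
    have "1 * d \<le> 2 * (1 + a) * d" using a d1 \<delta> by (intro mult_right_mono) auto
    then show ?thesis using d1 by simp
  qed
  ultimately have "m \<le> 2 * (1 + a) * d" by (simp add: m_def)
  then have "m\<^sup>2 \<le> (2 * (1 + a) * d)\<^sup>2" using \<delta> by (intro power_mono) (auto simp: m_def)
  then have m2: "m\<^sup>2 \<le> 4 * (1 + a)\<^sup>2 * d\<^sup>2" unfolding power_mult_distrib by simp
  have pos: "0 < d\<^sup>2" "0 < m\<^sup>2" using d1 \<delta> by (auto simp: m_def)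
  have "poisson z (\<theta> + x) = \<delta> * (1 + cmod z) / d\<^sup>2 * (1 / (2 * pi))"
    by (simp add: poisson_def \<delta>_def d_def power2_eq_square algebra_simps)
  also have "\<dots> \<le> \<delta> * 2 / d\<^sup>2 * (1 / 2)"
    using \<delta> z pi_gt3 by (intro mult_mono divide_right_mono mult_left_mono) (auto simp: field_simps)
  also have "\<dots> = \<delta> * (1 / d\<^sup>2)" by simp
  also have "1 / d\<^sup>2 \<le> 4 * (1 + a)\<^sup>2 / m\<^sup>2" using m2 pos by (simp add: field_simps)
  also have "\<delta> * (4 * (1 + a)\<^sup>2 / m\<^sup>2) = 4 * (1 + a)\<^sup>2 * (\<delta> / m\<^sup>2)" by simp
  finally show ?thesis using \<delta> by (simp add: \<delta>_def m_def mult_left_mono)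
qed

lemma ennreal_le_suminf: "f k \<le> (\<Sum>k. f k :: ennreal)"
  using sum_le_suminf[of f "{k}"] by simp

text \<open>One term of the series suffices: for the least \<open>k\<close> with
  \<open>\<bar>x\<bar> < 2 ^ k * \<delta>\<close> the radius \<open>2 ^ k * \<delta>\<close> is at
  most twice the maximum on the left.\<close>

lemma box_kernel_le_dyadic:
  assumes \<delta>: "0 < \<delta>"
  shows "ennreal (\<delta> / (max \<delta> \<bar>x\<bar>)\<^sup>2) \<le>
    (\<Sum>k. ennreal (4 * (1/4) ^ k / \<delta>) * indicator {-(2 ^ k * \<delta>)<..<2 ^ k * \<delta>} x)"
proof -
  let ?P = "\<lambda>k::nat. \<bar>x\<bar> < 2 ^ k * \<delta>"
  have "\<exists>k. ?P k"
    using real_arch_pow[of 2 "\<bar>x\<bar> / \<delta>"] \<delta> by (auto simp: field_simps)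
  then have P: "?P (LEAST k. ?P k)" by (rule LeastI_ex)
  define k where "k = (LEAST k. ?P k)"
  have xk: "\<bar>x\<bar> < 2 ^ k * \<delta>" using P by (simp add: k_def)
  have "2 ^ k * \<delta> \<le> 2 * max \<delta> \<bar>x\<bar>"
  proof (cases k)
    case 0
    then show ?thesis using \<delta> by simp
  next
    case (Suc j)
    then have "\<not> ?P j" using not_less_Least[of j ?P] by (simp add: k_def)
    then show ?thesis using Suc by simp
  qed
  then have "(2 ^ k * \<delta>)\<^sup>2 \<le> (2 * max \<delta> \<bar>x\<bar>)\<^sup>2" using \<delta> by (intro power_mono) auto
  then have "4 ^ k * \<delta>\<^sup>2 \<le> 4 * (max \<delta> \<bar>x\<bar>)\<^sup>2"
    by (simp add: power_mult_distrib power_mult[symmetric] mult.commute[of k] power_mult)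
  moreover have "0 < (max \<delta> \<bar>x\<bar>)\<^sup>2" using \<delta> by simp
  ultimately have "\<delta> / (max \<delta> \<bar>x\<bar>)\<^sup>2 \<le> 4 / (4 ^ k * \<delta>)"
    using \<delta> by (simp add: divide_simps power2_eq_square[of \<delta>] ac_simps)
  then have "\<delta> / (max \<delta> \<bar>x\<bar>)\<^sup>2 \<le> 4 * (1/4) ^ k / \<delta>"
    by (simp add: power_one_over)
  then have "ennreal (\<delta> / (max \<delta> \<bar>x\<bar>)\<^sup>2) \<le> ennreal (4 * (1/4) ^ k / \<delta>) * indicator {-(2 ^ k * \<delta>)<..<2 ^ k * \<delta>} x"
    using xk by (auto simp: indicator_def ennreal_leI)
  also have "\<dots> \<le> (\<Sum>k. ennreal (4 * (1/4) ^ k / \<delta>) * indicator {-(2 ^ k * \<delta>)<..<2 ^ k * \<delta>} x)"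
    by (rule ennreal_le_suminf)
  finally show ?thesis .
qed

text \<open>This serves two purposes: with \<open>h\<close> the modulus of a holomorphic function it
  gives the weak type estimate, and with \<open>h = osc\<close> and a radial \<open>z\<close> it
  bounds the Poisson deviation.\<close>

lemma nn_integral_poisson_le_dyadic:
  fixes h :: "real \<Rightarrow> ennreal"
  assumes h [measurable]: "h \<in> borel_measurable borel" and per: "\<And>x. h (x + 2 * pi) = h x"
    and z: "cmod z < 1" and near: "cmod (z - cis \<theta>) \<le> a * (1 - cmod z)" and a: "0 \<le> a"
  shows "(\<integral>\<^sup>+x. h x * ennreal (poisson z x) \<partial>circ) \<le> ennreal (16 * (1 + a)\<^sup>2) *
    (\<Sum>k. ennreal ((1/4) ^ k / (1 - cmod z)) *
      (\<integral>\<^sup>+x. h (\<theta> + x) * indicator {-pi..pi} x * indicator {-(2 ^ k * (1 - cmod z))<..<2 ^ k * (1 - cmod z)} x \<partial>lborel))"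
proof -
  define \<delta> where "\<delta> = 1 - cmod z"
  have \<delta>: "0 < \<delta>" using z by (simp add: \<delta>_def)
  have "(\<integral>\<^sup>+x. h x * ennreal (poisson z x) \<partial>circ) =
      (\<integral>\<^sup>+x. h (\<theta> + x) * ennreal (poisson z (\<theta> + x)) * indicator {-pi..pi} x \<partial>lborel)"
    by (rule nn_integral_circ_centered) (auto simp: per poisson_periodic)
  also have "\<dots> \<le> (\<integral>\<^sup>+x. (\<Sum>k. ennreal (16 * (1 + a)\<^sup>2) * (ennreal ((1/4) ^ k / \<delta>) *
      (h (\<theta> + x) * indicator {-pi..pi} x * indicator {-(2 ^ k * \<delta>)<..<2 ^ k * \<delta>} x))) \<partial>lborel)"
  proof (rule nn_integral_mono)
    fix x
    show "h (\<theta> + x) * ennreal (poisson z (\<theta> + x)) * indicator {-pi..pi} x \<le>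
      (\<Sum>k. ennreal (16 * (1 + a)\<^sup>2) * (ennreal ((1/4) ^ k / \<delta>) *
      (h (\<theta> + x) * indicator {-pi..pi} x * indicator {-(2 ^ k * \<delta>)<..<2 ^ k * \<delta>} x)))"
    proof (cases "x \<in> {-pi..pi}")
      case True
      then have "ennreal (poisson z (\<theta> + x)) \<le> ennreal (4 * (1 + a)\<^sup>2 * (\<delta> / (max \<delta> \<bar>x\<bar>)\<^sup>2))"
        unfolding \<delta>_def by (intro ennreal_leI poisson_le_box z near a) auto
      also have "\<dots> = ennreal (4 * (1 + a)\<^sup>2) * ennreal (\<delta> / (max \<delta> \<bar>x\<bar>)\<^sup>2)"
        using \<delta> by (intro ennreal_mult) auto
      also have "\<dots> \<le> ennreal (4 * (1 + a)\<^sup>2) * (\<Sum>k. ennreal (4 * (1/4) ^ k / \<delta>) * indicator {-(2 ^ k * \<delta>)<..<2 ^ k * \<delta>} x)"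
        by (intro mult_left_mono box_kernel_le_dyadic \<delta>) simp
      also have "\<dots> = (\<Sum>k. ennreal (16 * (1 + a)\<^sup>2) * (ennreal ((1/4) ^ k / \<delta>) * indicator {-(2 ^ k * \<delta>)<..<2 ^ k * \<delta>} x))"
      proof -
        have "ennreal (4 * (1 + a)\<^sup>2) * ennreal (4 * (1/4) ^ k / \<delta>) = ennreal (16 * (1 + a)\<^sup>2) * ennreal ((1/4) ^ k / \<delta>)" for k :: nat
          using \<delta> by (simp flip: ennreal_mult)
        then show ?thesis
          unfolding ennreal_suminf_cmult[symmetric] mult.assoc[symmetric] by simp
      qed
      finally have "h (\<theta> + x) * ennreal (poisson z (\<theta> + x)) \<le> h (\<theta> + x) * \<dots>" by (rule mult_left_mono) simp
      then show ?thesis using True by (simp add: ac_simps flip: ennreal_suminf_cmult)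
    qed simp
  qed
  also have "\<dots> = (\<Sum>k. ennreal (16 * (1 + a)\<^sup>2) * (ennreal ((1/4) ^ k / \<delta>) *
      (\<integral>\<^sup>+x. h (\<theta> + x) * indicator {-pi..pi} x * indicator {-(2 ^ k * \<delta>)<..<2 ^ k * \<delta>} x \<partial>lborel)))"
    by (simp add: nn_integral_suminf nn_integral_cmult)
  finally show ?thesis by (simp only: ennreal_suminf_cmult \<delta>_def)
qed

lemma suminf_half_ennreal: "(\<Sum>k. ennreal ((1/2) ^ k)) = 2"
  using suminf_geometric[of "1/2::real"]
  by (subst suminf_ennreal2) (auto intro!: summable_geometric)

text \<open>Vitali's covering lemma is applied to intervals over which the integral of \<open>|g|\<close> exceeds a
  multiple of \<open>\<kappa>\<close> times their length.\<close>

lemma nontangential_weak_type: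
  assumes g: "g holomorphic_on ball 0 R" and R: "1 < R" and a: "0 \<le> a" and \<kappa>: "0 < \<kappa>"
  obtains A where "A \<in> sets borel" "{\<theta>\<in>{0..2*pi}. \<exists>z\<in>stolz_region a (cis \<theta>). \<kappa> < cmod (g z)} \<subseteq> A"
    "emeasure lborel A \<le> ennreal (640 * (1 + a)\<^sup>2 / \<kappa>) * (\<integral>\<^sup>+\<theta>. ennreal (cmod (g (cis \<theta>))) \<partial>circ)"
proof -
  define E where "E = {\<theta>\<in>{0..2*pi}. \<exists>z\<in>stolz_region a (cis \<theta>). \<kappa> < cmod (g z)}"
  note [measurable] = borel_measurable_cis_holomorphic[OF g R]
  \<comment> \<open>The window \<open>[-pi, 3 pi]\<close> contains every interval of radius
    \<open>pi\<close> centred in \<open>[0, 2 pi]\<close>. It consists of two periods, hence the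
    bound \<open>2 * I\<close>.\<close>
  define G where "G x = ennreal (cmod (g (cis x))) * indicator {-pi..3*pi} x" for x
  have [measurable]: "G \<in> borel_measurable borel" unfolding G_def by measurable
  define I where "I = (\<integral>\<^sup>+\<theta>. ennreal (cmod (g (cis \<theta>))) \<partial>circ)"
  \<comment> \<open>Chosen so that \<open>16 (1 + a)^2\<close> times the sum of
    \<open>\<eta> * (1/2)^k\<close> over \<open>k\<close> is exactly
    \<open>\<kappa>\<close>.\<close>
  define \<eta> where "\<eta> = \<kappa> / (32 * (1 + a)\<^sup>2)"
  have \<eta>: "0 < \<eta>" using \<kappa> a by (simp add: \<eta>_def)
  have G_le: "(\<integral>\<^sup>+x. G x \<partial>lborel) \<le> 2 * I"
  proof -
    have "(\<integral>\<^sup>+x. G x \<partial>lborel) \<le> (\<integral>\<^sup>+x. ennreal (cmod (g (cis x))) * indicator {-pi..pi} x +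
        ennreal (cmod (g (cis x))) * indicator {pi..3*pi} x \<partial>lborel)"
      unfolding G_def by (intro nn_integral_mono) (auto split: split_indicator)
    also have "\<dots> = (\<integral>\<^sup>+x. ennreal (cmod (g (cis x))) * indicator {-pi..pi} x \<partial>lborel) +
       (\<integral>\<^sup>+x. ennreal (cmod (g (cis x))) * indicator {pi..3*pi} x \<partial>lborel)"
      by (subst nn_integral_add) auto
    also have "(\<integral>\<^sup>+x. ennreal (cmod (g (cis x))) * indicator {-pi..pi} x \<partial>lborel) = I"
      unfolding I_def by (subst nn_integral_circ_centered[where \<theta>=0]) (auto simp: cis_periodic)
    also have "(\<integral>\<^sup>+x. ennreal (cmod (g (cis x))) * indicator {pi..3*pi} x \<partial>lborel) = I"
      unfolding I_def
      by (subst nn_integral_circ_centered[where \<theta>="2*pi"], (auto simp: cis_periodic)[2])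
         (subst nn_integral_real_affine[where c=1 and t="2*pi"],
          auto intro!: nn_integral_cong simp: algebra_simps split: split_indicator)
    finally show ?thesis by (simp add: mult_2)
  qed
  have I_fin: "I < top"
  proof -
    have "I = ennreal (integral {0..2*pi} (\<lambda>\<theta>. cmod (g (cis \<theta>))))"
      unfolding I_def by (intro nn_integral_circ_has_integral continuous_intros continuous_on_cis_holomorphic[OF g R]) auto
    then show ?thesis by simp
  qed
  then obtain J where J: "(\<integral>\<^sup>+x. G x \<partial>lborel) = ennreal J" "J \<ge> 0"
    using G_le by (cases "\<integral>\<^sup>+x. G x \<partial>lborel") (auto simp: top_unique ennreal_mult_eq_top_iff)
  \<comment> \<open>If no interval centred at \<open>\<theta>\<close> carried more than
    \<open>\<eta>\<close> times its radius, the dyadic bound for the Poisson integral would give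
    \<open>cmod (g z) \<le> \<kappa>\<close> throughout the Stolz region.\<close>
  have ball_ex: "\<exists>\<rho>>0. ennreal (\<eta> * \<rho>) < (\<integral>\<^sup>+x. G x * indicator (cball \<theta> \<rho>) x \<partial>lborel)" if \<theta>: "\<theta> \<in> E" for \<theta>
  proof (rule ccontr)
    assume neg: "\<not> (\<exists>\<rho>>0. ennreal (\<eta> * \<rho>) < (\<integral>\<^sup>+x. G x * indicator (cball \<theta> \<rho>) x \<partial>lborel))"
    obtain z where z: "z \<in> stolz_region a (cis \<theta>)" "\<kappa> < cmod (g z)" and \<theta>': "\<theta> \<in> {0..2*pi}" using \<theta> by (auto simp: E_def)
    have z1: "cmod z < 1" "cmod (z - cis \<theta>) \<le> a * (1 - cmod z)" using z(1) by (auto simp: stolz_region_def)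
    define \<delta> where "\<delta> = 1 - cmod z"
    have \<delta>: "0 < \<delta>" using z1 by (simp add: \<delta>_def)
    have "ennreal (cmod (g z)) \<le> (\<integral>\<^sup>+x. ennreal (cmod (g (cis x))) * ennreal (poisson z x) \<partial>circ)"
      by (rule norm_le_poisson[OF g R z1(1)])
    also have "\<dots> \<le> ennreal (16 * (1 + a)\<^sup>2) * (\<Sum>k. ennreal ((1/4) ^ k / \<delta>) *
      (\<integral>\<^sup>+x. ennreal (cmod (g (cis (\<theta> + x)))) * indicator {-pi..pi} x * indicator {-(2 ^ k * \<delta>)<..<2 ^ k * \<delta>} x \<partial>lborel))"
      unfolding \<delta>_def by (rule nn_integral_poisson_le_dyadic) (use z1 a in \<open>auto simp: cis_periodic\<close>)
    also have "\<dots> \<le> ennreal (16 * (1 + a)\<^sup>2) * (\<Sum>k. ennreal \<eta> * ennreal ((1/2) ^ k))"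
    proof (intro mult_left_mono suminf_le)
      fix k
      have "(\<integral>\<^sup>+x. ennreal (cmod (g (cis (\<theta> + x)))) * indicator {-pi..pi} x * indicator {-(2 ^ k * \<delta>)<..<2 ^ k * \<delta>} x \<partial>lborel)
        \<le> (\<integral>\<^sup>+x. G (\<theta> + x) * indicator (cball \<theta> (2 ^ k * \<delta>)) (\<theta> + x) \<partial>lborel)"
        unfolding G_def using \<theta>' by (intro nn_integral_mono) (auto split: split_indicator simp: dist_real_def)
      also have "\<dots> = (\<integral>\<^sup>+x. G x * indicator (cball \<theta> (2 ^ k * \<delta>)) x \<partial>lborel)"
      proof -
        have "(\<lambda>x. G x * indicator (cball \<theta> (2 ^ k * \<delta>)) x) \<in> borel_measurable borel"
          by (intro borel_measurable_times_ennreal borel_measurable_indicator) auto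
        from nn_integral_real_affine[OF this, of 1 \<theta>] show ?thesis by simp
      qed
      also have "\<dots> \<le> ennreal (\<eta> * (2 ^ k * \<delta>))"
      proof -
        have "0 < 2 ^ k * \<delta>" using \<delta> by simp
        then show ?thesis using neg by (meson linorder_not_le)
      qed
      finally have "ennreal ((1/4) ^ k / \<delta>) * (\<integral>\<^sup>+x. ennreal (cmod (g (cis (\<theta> + x)))) * indicator {-pi..pi} x * indicator {-(2 ^ k * \<delta>)<..<2 ^ k * \<delta>} x \<partial>lborel)
        \<le> ennreal ((1/4) ^ k / \<delta>) * ennreal (\<eta> * (2 ^ k * \<delta>))" by (rule mult_left_mono) simp
      also have "\<dots> = ennreal ((1/4) ^ k / \<delta> * (\<eta> * (2 ^ k * \<delta>)))" using \<delta> \<eta> by (simp flip: ennreal_mult)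
      also have "(1/4) ^ k / \<delta> * (\<eta> * (2 ^ k * \<delta>)) = \<eta> * (1/2) ^ k"
      proof -
        have "(1/4::real) ^ k * 2 ^ k = (1/2) ^ k" by (simp flip: power_mult_distrib)
        then show ?thesis using \<delta> by (simp add: field_simps)
      qed
      finally show "ennreal ((1/4) ^ k / \<delta>) * (\<integral>\<^sup>+x. ennreal (cmod (g (cis (\<theta> + x)))) * indicator {-pi..pi} x * indicator {-(2 ^ k * \<delta>)<..<2 ^ k * \<delta>} x \<partial>lborel)
        \<le> ennreal \<eta> * ennreal ((1/2) ^ k)" using \<eta> by (simp add: ennreal_mult)
    qed auto
    also have "\<dots> = ennreal (16 * (1 + a)\<^sup>2) * (ennreal \<eta> * ennreal 2)" by (simp add: suminf_half_ennreal)
    also have "\<dots> = ennreal (16 * (1 + a)\<^sup>2 * (\<eta> * 2))" using \<eta> by (simp flip: ennreal_mult del: ennreal_numeral)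
    also have "16 * (1 + a)\<^sup>2 * (\<eta> * 2) = \<kappa>" using a by (simp add: \<eta>_def)
    finally show False using z(2) \<kappa> by (simp add: ennreal_le_iff)
  qed
  then have "\<forall>\<theta>\<in>E. \<exists>\<rho>. 0 < \<rho> \<and> ennreal (\<eta> * \<rho>) < (\<integral>\<^sup>+x. G x * indicator (cball \<theta> \<rho>) x \<partial>lborel)" by blast
  then obtain \<rho> where \<rho>: "\<And>\<theta>. \<theta> \<in> E \<Longrightarrow> 0 < \<rho> \<theta>"
    "\<And>\<theta>. \<theta> \<in> E \<Longrightarrow> ennreal (\<eta> * \<rho> \<theta>) < (\<integral>\<^sup>+x. G x * indicator (cball \<theta> (\<rho> \<theta>)) x \<partial>lborel)"
    using bchoice[of E "\<lambda>\<theta> \<rho>. 0 < \<rho> \<and> ennreal (\<eta> * \<rho>) < (\<integral>\<^sup>+x. G x * indicator (cball \<theta> \<rho>) x \<partial>lborel)"] by blast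
  have \<rho>_le: "\<rho> \<theta> \<le> J / \<eta>" if "\<theta> \<in> E" for \<theta>
  proof -
    have "ennreal (\<eta> * \<rho> \<theta>) \<le> (\<integral>\<^sup>+x. G x \<partial>lborel)"
      by (rule order_trans[OF less_imp_le[OF \<rho>(2)[OF that]]]) (auto intro!: nn_integral_mono split: split_indicator)
    then have "\<eta> * \<rho> \<theta> \<le> J" using J by (simp add: ennreal_le_iff)
    then show ?thesis using \<eta> by (simp add: field_simps)
  qed
  obtain C where C: "countable C" "C \<subseteq> E" "pairwise (\<lambda>i j. disjnt (cball i (\<rho> i)) (cball j (\<rho> j))) C"
     "E \<subseteq> (\<Union>i\<in>C. cball i (5 * \<rho> i))"
  proof (rule Vitali_covering_lemma_cballs[where S=E and K=E and a="\<lambda>i. i" and r=\<rho> and B="J / \<eta>"])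
    show "E \<subseteq> (\<Union>i\<in>E. cball i (\<rho> i))" using \<rho>(1) by (force simp: less_imp_le)
  qed (use \<rho>(1) \<rho>_le in auto)
  \<comment> \<open>The countable set \<open>C\<close> is enumerated so that \<open>D n\<close>
    holds at most one centre; unions over \<open>C\<close> become unions of sequences of Borel
    sets.\<close>
  define D where "D n = {c\<in>C. to_nat_on C c = n}" for n
  have D_cases: "D n = {} \<or> (\<exists>c\<in>C. D n = {c})" for n
    using inj_on_to_nat_on[OF C(1)] unfolding D_def inj_on_def by blast
  have D_un: "(\<Union>n. D n) = C" by (auto simp: D_def)
  define B where "B n = (\<Union>c\<in>D n. cball c (\<rho> c))" for n
  define B5 where "B5 n = (\<Union>c\<in>D n. cball c (5 * \<rho> c))" for n
  have meas [measurable]: "B n \<in> sets borel" "B5 n \<in> sets borel" for n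
    using D_cases[of n] by (auto simp: B_def B5_def)
  have disj: "disjoint_family B"
    unfolding disjoint_family_on_def
  proof (intro ballI impI)
    fix m n :: nat assume "m \<noteq> n"
    then have "disjnt (cball c (\<rho> c)) (cball d (\<rho> d))" if "c \<in> D m" "d \<in> D n" for c d
      using that C(3) unfolding D_def pairwise_def by auto
    then show "B m \<inter> B n = {}" unfolding B_def disjnt_def by blast
  qed
  \<comment> \<open>An interval of radius \<open>5 * \<rho> c\<close> has length
    \<open>10 * \<rho> c\<close>. The final constant 640 is this 10, times 32 from
    \<open>\<eta>\<close>, times 2 from the two periods.\<close>
  have le: "emeasure lborel (B5 n) \<le> ennreal (10 / \<eta>) * (\<integral>\<^sup>+x. G x * indicator (B n) x \<partial>lborel)" for n
    using D_cases[of n]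
  proof
    assume "\<exists>c\<in>C. D n = {c}"
    then obtain c where c: "c \<in> C" "D n = {c}" by blast
    then have cE: "c \<in> E" using C by auto
    have "emeasure lborel (B5 n) = ennreal (10 * \<rho> c)"
      using c \<rho>(1)[OF cE] by (simp add: B5_def cball_eq_atLeastAtMost)
    also have "\<dots> = ennreal (10 / \<eta>) * ennreal (\<eta> * \<rho> c)"
      using \<eta> \<rho>(1)[OF cE] by (simp flip: ennreal_mult)
    also have "\<dots> \<le> ennreal (10 / \<eta>) * (\<integral>\<^sup>+x. G x * indicator (B n) x \<partial>lborel)"
      using \<rho>(2)[OF cE] c by (intro mult_left_mono) (auto simp: B_def)
    finally show ?thesis .
  qed (simp add: B5_def)
  show ?thesis
  proof (rule that[of "\<Union>n. B5 n"])
    show "(\<Union>n. B5 n) \<in> sets borel" by measurable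
    show "{\<theta>\<in>{0..2*pi}. \<exists>z\<in>stolz_region a (cis \<theta>). \<kappa> < cmod (g z)} \<subseteq> (\<Union>n. B5 n)"
      using C(4) D_un unfolding E_def B5_def by blast
    have "emeasure lborel (\<Union>n. B5 n) \<le> (\<Sum>n. emeasure lborel (B5 n))"
      by (rule emeasure_subadditive_countably) auto
    also have "\<dots> \<le> (\<Sum>n. ennreal (10 / \<eta>) * (\<integral>\<^sup>+x. G x * indicator (B n) x \<partial>lborel))"
      by (intro suminf_le le) auto
    also have "\<dots> = ennreal (10 / \<eta>) * (\<integral>\<^sup>+x. (\<Sum>n. G x * indicator (B n) x) \<partial>lborel)"
    proof -
      have "(\<lambda>x. G x * indicator (B n) x) \<in> borel_measurable lborel" for n
        by (intro borel_measurable_times_ennreal borel_measurable_indicator) (simp_all add: meas)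
      from nn_integral_suminf[OF this] show ?thesis by (simp only: ennreal_suminf_cmult)
    qed
    also have "\<dots> \<le> ennreal (10 / \<eta>) * (\<integral>\<^sup>+x. G x \<partial>lborel)"
      using suminf_indicator[OF disj]
      by (intro mult_left_mono nn_integral_mono) (auto split: split_indicator)
    also have "\<dots> \<le> ennreal (10 / \<eta>) * (ennreal 2 * I)"
      using G_le by (intro mult_left_mono) auto
    also have "\<dots> = ennreal (640 * (1 + a)\<^sup>2 / \<kappa>) * I"
      using \<eta> \<kappa> by (simp add: \<eta>_def mult.assoc[symmetric] del: ennreal_numeral flip: ennreal_mult)
    finally show "emeasure lborel (\<Union>n. B5 n) \<le> ennreal (640 * (1 + a)\<^sup>2 / \<kappa>) * (\<integral>\<^sup>+\<theta>. ennreal (cmod (g (cis \<theta>))) \<partial>circ)"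
      by (simp add: I_def)
  qed
qed

section \<open>From dilations to nontangential limits\<close>

lemma radial_in_stolz_region:
  assumes "cmod \<zeta> = 1" "1 < a" "0 \<le> r" "r < 1"
  shows "of_real r * \<zeta> \<in> stolz_region a \<zeta>"
proof -
  have "of_real r * \<zeta> - \<zeta> = of_real (r - 1) * \<zeta>" by (simp add: algebra_simps)
  then have "cmod (of_real r * \<zeta> - \<zeta>) = 1 - r" using assms by (simp only: norm_mult norm_of_real) simp
  moreover have "1 * (1 - r) < a * (1 - r)" using assms by (intro mult_strict_right_mono) auto
  ultimately show ?thesis using assms by (simp add: stolz_region_def norm_mult)
qed

lemma radial_filterlim:
  assumes z: "cmod \<zeta> = 1" and a: "1 < a" and R: "\<And>n. 0 < R n" "\<And>n. R n < 1" "R \<longlonglongrightarrow> 1"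
  shows "filterlim (\<lambda>n. of_real (R n) * \<zeta>) (at \<zeta> within stolz_region a \<zeta>) sequentially"
  unfolding filterlim_at
proof
  show "\<forall>\<^sub>F n in sequentially. of_real (R n) * \<zeta> \<in> stolz_region a \<zeta> \<and> of_real (R n) * \<zeta> \<noteq> \<zeta>"
  proof (intro always_eventually allI conjI)
    fix n
    show "of_real (R n) * \<zeta> \<in> stolz_region a \<zeta>" by (rule radial_in_stolz_region) (use assms less_imp_le in auto)
    have "cmod (of_real (R n) * \<zeta>) \<noteq> cmod \<zeta>" using R(1)[of n] R(2)[of n] z by (simp add: norm_mult)
    then show "of_real (R n) * \<zeta> \<noteq> \<zeta>" by auto
  qed
  have "(\<lambda>n. of_real (R n) * \<zeta>) \<longlonglongrightarrow> of_real 1 * \<zeta>"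
    by (intro tendsto_intros R)
  then show "(\<lambda>n. of_real (R n) * \<zeta>) \<longlonglongrightarrow> \<zeta>" by simp
qed

lemma nontangential_limit_radial:
  assumes "has_nontangential_limit f L \<zeta>" "cmod \<zeta> = 1" "\<And>n. 0 < R n" "\<And>n. R n < 1" "R \<longlonglongrightarrow> 1"
  shows "(\<lambda>n. f (of_real (R n) * \<zeta>)) \<longlonglongrightarrow> L"
proof -
  have "(f \<longlongrightarrow> L) (at \<zeta> within stolz_region 2 \<zeta>)"
    using assms(1) by (simp add: has_nontangential_limit_def)
  then show ?thesis
    by (rule filterlim_compose) (rule radial_filterlim, use assms in auto)
qed

lemma boundary_value_eqI:
  assumes "has_nontangential_limit f L \<zeta>" "cmod \<zeta> = 1"
  shows "boundary_value f \<zeta> = L"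
  unfolding boundary_value_def
proof (rule the_equality)
  define R where "R n = 1 - 1 / (real n + 2)" for n
  have R: "0 < R n" "R n < 1" for n by (auto simp: R_def)
  have lim: "R \<longlonglongrightarrow> 1" unfolding R_def by real_asymp
  fix L' assume "has_nontangential_limit f L' \<zeta>"
  from nontangential_limit_radial[OF this assms(2) R lim] nontangential_limit_radial[OF assms R lim]
  show "L' = L" by (rule LIMSEQ_unique)
qed fact

text \<open>Each dilate is continuous at \<open>\<zeta>\<close>, and by telescoping the dilates
  converge to \<open>f\<close> uniformly on every Stolz region, so the two limits may be exchanged.
  The apertures \<open>m + 2\<close> are cofinal among all \<open>a > 1\<close>.\<close>

lemma nontangential_limit_of_dilations:
  assumes f: "f holomorphic_on ball 0 1" and z: "cmod \<zeta> = 1"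
    and R: "\<And>n. 0 < R n" "\<And>n. R n < 1" "R \<longlonglongrightarrow> 1"
    and ev: "\<And>m::nat. \<forall>\<^sub>F n in sequentially. \<forall>z\<in>stolz_region (real m + 2) \<zeta>.
      cmod (f (of_real (R (Suc n)) * z) - f (of_real (R n) * z)) \<le> (1/2) ^ n"
  obtains L where "has_nontangential_limit f L \<zeta>"
proof -
  have cont: "isCont (\<lambda>w. f (of_real (R n) * w)) w" if "cmod w \<le> 1" for n w
  proof -
    have "R n * cmod w < 1" using that R(1,2)[of n] by (metis less_eq_real_def le_less_trans mult.right_neutral mult_left_mono)
    then have "isCont f (of_real (R n) * w)"
      using f R(1)[of n] by (intro holomorphic_on_imp_continuous_on[THEN continuous_on_interior]) (auto simp: norm_mult)
    moreover have "isCont (\<lambda>w. of_real (R n) * w) w" by simp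
    ultimately show ?thesis by (rule isCont_o2[where f="\<lambda>w. of_real (R n) * w" and g=f, rotated])
  qed
  have tail: "cmod (x (n + k) - x n) \<le> 2 * (1/2) ^ n"
    if "\<And>j. n \<le> j \<Longrightarrow> cmod (x (Suc j) - x j) \<le> (1/2) ^ j" for x :: "nat \<Rightarrow> complex" and n k
  proof -
    have "cmod (x (n + k) - x n) \<le> 2 * (1/2) ^ n - 2 * (1/2) ^ (n + k)"
    proof (induction k)
      case (Suc k)
      have "cmod (x (n + Suc k) - x n) \<le> cmod (x (Suc (n + k)) - x (n + k)) + cmod (x (n + k) - x n)"
        using norm_triangle_ineq[of "x (Suc (n + k)) - x (n + k)" "x (n + k) - x n"] by simp
      also have "\<dots> \<le> (1/2) ^ (n + k) + (2 * (1/2) ^ n - 2 * (1/2) ^ (n + k))"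
        using Suc that[of "n + k"] by simp
      finally show ?case by simp
    qed simp
    moreover have "0 \<le> 2 * (1/2::real) ^ (n + k)" by simp
    ultimately show ?thesis by linarith
  qed
  \<comment> \<open>The point \<open>\<zeta>\<close> is not in the Stolz region; the bound reaches
    it by continuity along radial points.\<close>
  have bd: "\<forall>\<^sub>F n in sequentially. cmod (f (of_real (R (Suc n)) * \<zeta>) - f (of_real (R n) * \<zeta>)) \<le> (1/2) ^ n"
    using ev[of 0]
  proof eventually_elim
    case (elim n)
    define g where "g w = cmod (f (of_real (R (Suc n)) * w) - f (of_real (R n) * w))" for w
    have "isCont g \<zeta>" unfolding g_def using z by (intro continuous_intros cont) auto
    then have "(g \<longlongrightarrow> g \<zeta>) (at \<zeta> within stolz_region 2 \<zeta>)"
      using continuous_at_imp_continuous_at_within continuous_within by blast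
    from filterlim_compose[OF this radial_filterlim[OF z _ R]]
    have "(\<lambda>k. g (of_real (R k) * \<zeta>)) \<longlonglongrightarrow> g \<zeta>" by simp
    moreover have "g (of_real (R k) * \<zeta>) \<le> (1/2) ^ n" for k
      using elim radial_in_stolz_region[OF z, of 2 "R k"] R(1,2)[of k] by (simp add: g_def)
    ultimately have "g \<zeta> \<le> (1/2) ^ n" by (intro LIMSEQ_le_const2) auto
    then show ?case by (simp add: g_def)
  qed
  define x where "x n = f (of_real (R n) * \<zeta>)" for n
  obtain N where N: "\<And>j. N \<le> j \<Longrightarrow> cmod (x (Suc j) - x j) \<le> (1/2) ^ j"
    using bd by (auto simp: eventually_sequentially x_def)
  have small: "(\<lambda>n. 2 * (1/2::real) ^ n) \<longlonglongrightarrow> 0" by real_asymp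
  have "Cauchy x"
  proof (rule metric_CauchyI)
    fix e :: real assume e: "e > 0"
    then have "\<forall>\<^sub>F n in sequentially. 2 * (1/2) ^ n < e / 2"
      using order_tendstoD(2)[OF small, of "e / 2"] by simp
    then obtain M where M: "\<And>n. M \<le> n \<Longrightarrow> 2 * (1/2::real) ^ n < e / 2" by (auto simp: eventually_sequentially)
    define K where "K = max N M"
    have "dist (x i) (x K) < e / 2" if "K \<le> i" for i
    proof -
      have "cmod (x (K + (i - K)) - x K) \<le> 2 * (1/2) ^ K" by (rule tail) (auto intro: N simp: K_def)
      also have "\<dots> < e / 2" by (rule M) (simp add: K_def)
      finally show ?thesis using that by (simp add: dist_norm)
    qed
    then show "\<exists>K. \<forall>m\<ge>K. \<forall>n\<ge>K. dist (x m) (x n) < e"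
      by (intro exI[of _ K]) (metis dist_commute dist_triangle_half_l)
  qed
  then obtain L where L: "x \<longlonglongrightarrow> L" using Cauchy_convergent convergent_def by blast
  have "has_nontangential_limit f L \<zeta>"
    unfolding has_nontangential_limit_def
  proof (intro allI impI)
    fix a :: real assume a: "1 < a"
    obtain m :: nat where m: "a \<le> real m + 2" using real_arch_simple[of a] by (meson add_increasing2 zero_le_numeral)
    have sub: "stolz_region a \<zeta> \<subseteq> stolz_region (real m + 2) \<zeta>"
    proof
      fix w assume w: "w \<in> stolz_region a \<zeta>"
      then have "a * (1 - cmod w) \<le> (real m + 2) * (1 - cmod w)"
        using m by (intro mult_right_mono) (auto simp: stolz_region_def)
      then show "w \<in> stolz_region (real m + 2) \<zeta>"
        using w unfolding stolz_region_def mem_Collect_eq by linarith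
    qed
    obtain M where M: "\<And>n z. M \<le> n \<Longrightarrow> z \<in> stolz_region a \<zeta> \<Longrightarrow>
        cmod (f (of_real (R (Suc n)) * z) - f (of_real (R n) * z)) \<le> (1/2) ^ n"
      using ev[of m] sub unfolding eventually_sequentially by blast
    show "(f \<longlongrightarrow> L) (at \<zeta> within stolz_region a \<zeta>)"
    proof (rule tendstoI)
      fix e :: real assume e: "e > 0"
      have "\<forall>\<^sub>F n in sequentially. 2 * (1/2) ^ n < e / 3"
        using order_tendstoD(2)[OF small, of "e / 3"] e by simp
      moreover have "\<forall>\<^sub>F n in sequentially. dist (x n) L < e / 3" using tendstoD[OF L, of "e/3"] e by simp
      ultimately have "\<forall>\<^sub>F n in sequentially. 2 * (1/2) ^ n < e / 3 \<and> dist (x n) L < e / 3 \<and> M \<le> n"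
        using eventually_ge_at_top[of M] by eventually_elim auto
      then obtain n where n: "2 * (1/2) ^ n < e / 3" "dist (x n) L < e / 3" "M \<le> n"
        by (metis (no_types, lifting) eventually_happens' sequentially_bot)
      have c: "((\<lambda>w. f (of_real (R n) * w)) \<longlongrightarrow> x n) (at \<zeta> within stolz_region a \<zeta>)"
        using cont[of \<zeta> n] z continuous_at_imp_continuous_at_within continuous_within unfolding x_def by (metis order_refl)
      have near: "cmod (f w - f (of_real (R n) * w)) \<le> 2 * (1/2) ^ n" if w: "w \<in> stolz_region a \<zeta>" for w
      proof -
        have w1: "cmod w < 1" using w by (simp add: stolz_region_def)
        have "isCont f w" using f w1 by (intro holomorphic_on_imp_continuous_on[THEN continuous_on_interior]) auto
        moreover have "(\<lambda>k. of_real (R (n + k)) * w) \<longlonglongrightarrow> w"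
          using tendsto_mult_right[OF tendsto_of_real[OF LIMSEQ_ignore_initial_segment[OF R(3), of n]], of w]
          by (simp add: add.commute)
        ultimately have "(\<lambda>k. f (of_real (R (n + k)) * w)) \<longlonglongrightarrow> f w" by (rule isCont_tendsto_compose)
        then have "(\<lambda>k. cmod (f (of_real (R (n + k)) * w) - f (of_real (R n) * w))) \<longlonglongrightarrow> cmod (f w - f (of_real (R n) * w))"
          by (intro tendsto_intros)
        moreover have "cmod (f (of_real (R (n + k)) * w) - f (of_real (R n) * w)) \<le> 2 * (1/2) ^ n" for k
          by (rule tail[of n "\<lambda>j. f (of_real (R j) * w)"]) (use M n(3) w in auto)
        ultimately show ?thesis by (intro LIMSEQ_le_const2) auto
      qed
      have "\<forall>\<^sub>F w in at \<zeta> within stolz_region a \<zeta>. dist (f (of_real (R n) * w)) (x n) < e / 3"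
        using tendstoD[OF c, of "e/3"] e by simp
      moreover have "\<forall>\<^sub>F w in at \<zeta> within stolz_region a \<zeta>. w \<in> stolz_region a \<zeta>"
        by (simp add: eventually_at_filter)
      ultimately show "\<forall>\<^sub>F w in at \<zeta> within stolz_region a \<zeta>. dist (f w) L < e"
      proof eventually_elim
        case (elim w)
        have "dist (f w) L \<le> dist (f w) (f (of_real (R n) * w)) + dist (f (of_real (R n) * w)) (x n) + dist (x n) L"
          by (metis add_right_mono dist_triangle order_trans)
        also have "\<dots> < e / 3 + e / 3 + e / 3"
          using near[OF elim(2)] elim(1) n by (intro add_strict_mono) (auto simp: dist_norm)
        finally show ?case by simp
      qed
    qed
  qed
  then show ?thesis by (rule that)
qed

text \<open>Borel-Cantelli: the angles at which the \<open>n\<close>-th difference exceeds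
  \<open>2^-n\<close> somewhere in the region of aperture \<open>m + 2\<close> have measure at most
  a multiple of \<open>4^-n / 2^-n = 2^-n\<close>. Countably many apertures leave a single null
  set.\<close>

lemma boundary_convergence:
  assumes f: "f holomorphic_on ball 0 1" and R: "\<And>n. 0 < R n" "\<And>n. R n < 1" "R \<longlonglongrightarrow> 1"
    and diff: "\<And>n. (\<integral>\<^sup>+\<theta>. ennreal (cmod (f (of_real (R (Suc n)) * cis \<theta>) - f (of_real (R n) * cis \<theta>))) \<partial>circ) \<le> ennreal ((1/4) ^ n)"
  shows "AE \<theta> in lborel. \<theta> \<in> {0..2*pi} \<longrightarrow> has_nontangential_limit f (boundary_value f (cis \<theta>)) (cis \<theta>)"
proof -
  define g where "g n z = f (of_real (R (Suc n)) * z) - f (of_real (R n) * z)" for n z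
  define Q where "Q m n A \<longleftrightarrow> A \<in> sets borel \<and> {\<theta>\<in>{0..2*pi}. \<exists>z\<in>stolz_region (real m + 2) (cis \<theta>). (1/2) ^ n < cmod (g n z)} \<subseteq> A \<and>
    emeasure lborel A \<le> ennreal (640 * (real m + 3)\<^sup>2 * (1/2) ^ n)" for m n :: nat and A
  have ex: "\<exists>A. Q m n A" for m n
  proof -
    define S where "S = min (1 / R (Suc n)) (1 / R n)"
    have S: "1 < S" using R(1,2)[of n] R(1,2)[of "Suc n"] by (auto simp: S_def)
    have "g n holomorphic_on ball 0 S"
      unfolding g_def S_def
      by (intro holomorphic_intros holomorphic_on_subset[OF holomorphic_dilate(1)[OF f R(1,2)]]) auto
    from nontangential_weak_type[OF this S, of "real m + 2" "(1/2) ^ n"]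
    obtain A where A: "A \<in> sets borel" "{\<theta>\<in>{0..2*pi}. \<exists>z\<in>stolz_region (real m + 2) (cis \<theta>). (1/2) ^ n < cmod (g n z)} \<subseteq> A"
     "emeasure lborel A \<le> ennreal (640 * (1 + (real m + 2))\<^sup>2 / (1/2) ^ n) * (\<integral>\<^sup>+\<theta>. ennreal (cmod (g n (cis \<theta>))) \<partial>circ)" by auto
    note A(3)
    also have "ennreal (640 * (1 + (real m + 2))\<^sup>2 / (1/2) ^ n) * (\<integral>\<^sup>+\<theta>. ennreal (cmod (g n (cis \<theta>))) \<partial>circ) \<le>
        ennreal (640 * (1 + (real m + 2))\<^sup>2 / (1/2) ^ n) * ennreal ((1/4) ^ n)"
      using diff[of n] unfolding g_def by (intro mult_left_mono) auto
    also have "\<dots> = ennreal (640 * (1 + (real m + 2))\<^sup>2 / (1/2) ^ n * (1/4) ^ n)" by (rule ennreal_mult[symmetric]) auto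
    also have "640 * (1 + (real m + 2))\<^sup>2 / (1/2) ^ n * (1/4) ^ n = 640 * (real m + 3)\<^sup>2 * (1/2) ^ n"
    proof -
      have "(1/4::real) ^ n = (1/2) ^ n * (1/2) ^ n" by (simp flip: power_mult_distrib)
      then show ?thesis by (simp add: add.commute)
    qed
    finally show ?thesis using A unfolding Q_def by blast
  qed
  then obtain A where Q: "\<And>m n. Q m n (A m n)" by metis
  have A: "A m n \<in> sets borel"
    "{\<theta>\<in>{0..2*pi}. \<exists>z\<in>stolz_region (real m + 2) (cis \<theta>). (1/2) ^ n < cmod (g n z)} \<subseteq> A m n"
    "emeasure lborel (A m n) \<le> ennreal (640 * (real m + 3)\<^sup>2 * (1/2) ^ n)" for m n
    using Q[of m n] unfolding Q_def by blast+
  have "AE \<theta> in lborel. \<forall>\<^sub>F n in sequentially. \<theta> \<in> space lborel - A m n" for m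
  proof (rule borel_cantelli_AE1)
    show fin: "emeasure lborel (A m n) < \<infinity>" for n
      using A(3)[of m n] by (metis ennreal_less_top infinity_ennreal_def le_less_trans)
    show "summable (\<lambda>n. measure lborel (A m n))"
    proof (rule summable_comparison_test)
      show "summable (\<lambda>n. 640 * (real m + 3)\<^sup>2 * (1/2) ^ n)" by (intro summable_mult summable_geometric) simp
      show "\<exists>N. \<forall>n\<ge>N. norm (measure lborel (A m n)) \<le> 640 * (real m + 3)\<^sup>2 * (1/2) ^ n"
        using A(3)[of m] by (auto simp: measure_def intro!: enn2real_leI)
    qed
  qed (use A(1) in auto)
  then have "AE \<theta> in lborel. \<forall>m. \<forall>\<^sub>F n in sequentially. \<theta> \<notin> A m n" by (simp add: AE_all_countable)
  then show ?thesis
  proof eventually_elim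
    case (elim \<theta>)
    show ?case
    proof
      assume \<theta>: "\<theta> \<in> {0..2*pi}"
      have ev: "\<forall>\<^sub>F n in sequentially. \<forall>z\<in>stolz_region (real m + 2) (cis \<theta>).
        cmod (f (of_real (R (Suc n)) * z) - f (of_real (R n) * z)) \<le> (1/2) ^ n" for m
      proof -
        have "\<forall>\<^sub>F n in sequentially. \<theta> \<notin> A m n" using elim by blast
        then show ?thesis
        proof eventually_elim
          case (elim n)
          then have "\<not> (\<exists>z\<in>stolz_region (real m + 2) (cis \<theta>). (1/2) ^ n < cmod (g n z))"
            using A(2)[of m n] \<theta> by blast
          then show ?case unfolding g_def by (simp add: not_less)
        qed
      qed
      obtain L where L: "has_nontangential_limit f L (cis \<theta>)"
        by (rule nontangential_limit_of_dilations[OF f _ R ev]) auto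
      then show "has_nontangential_limit f (boundary_value f (cis \<theta>)) (cis \<theta>)"
        using boundary_value_eqI[OF L] by simp
    qed
  qed
qed

section \<open>The boundary function\<close>

lemma nn_integral_lebesgue_circ:
  assumes "f \<in> borel_measurable borel"
  shows "(\<integral>\<^sup>+x\<in>{0..2*pi}. f x \<partial>lebesgue) = (\<integral>\<^sup>+x. f x \<partial>circ)"
  by (simp add: nn_integral_completion nn_integral_circ[OF assms])

lemma Mp_eq_circ_norm:
  assumes f: "f holomorphic_on ball 0 1" and r: "0 \<le> r" "r < 1" and p: "0 < p"
  shows "Mp p r f = ennreal ((1 / (2 * pi)) powr (1 / p)) * circ_norm p f r"
proof -
  note [measurable] = holomorphic_radius_measurable[OF f r]
  have "(\<integral>\<^sup>+\<theta>\<in>{0..2*pi}. ennreal (cmod (f (of_real r * cis \<theta>)) powr p) \<partial>lebesgue) =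
      (\<integral>\<^sup>+\<theta>. ennreal (cmod (f (of_real r * cis \<theta>)) powr p) \<partial>circ)"
    by (rule nn_integral_lebesgue_circ) measurable
  then show ?thesis using p
    by (simp add: Mp_def ennpowr_mult ennpowr_ennreal circ_norm_def Lpn_def del: ennreal_divide_numeral)
qed

lemma circ_norm_1_le_Mp:
  assumes f: "f holomorphic_on ball 0 1" and r: "0 \<le> r" "r < 1" and p: "1 \<le> p"
  shows "circ_norm 1 f r \<le> ennreal (2 * pi) * Mp p r f"
proof -
  note [measurable] = holomorphic_radius_measurable[OF f r]
  define P where "P = density circ (\<lambda>_. ennreal (1 / (2 * pi)))"
  have P1: "emeasure P (space P) = 1"
    by (simp add: P_def emeasure_density nn_integral_cmult emeasure_circ flip: ennreal_mult)
  let ?F = "\<lambda>\<theta>. ennreal (cmod (f (of_real r * cis \<theta>)))"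
  have "ennpowr (\<integral>\<^sup>+\<theta>. ?F \<theta> \<partial>P) p \<le> (\<integral>\<^sup>+\<theta>. ennpowr (?F \<theta>) p \<partial>P)"
    by (rule ennpowr_nn_integral_le[OF P1 _ p]) (simp add: P_def)
  also have "\<dots> = ennpowr (Mp p r f) p"
    using p by (simp add: Mp_eq_circ_norm[OF f r] circ_norm_def Lpn_def P_def nn_integral_density nn_integral_cmult
        ennpowr_mult ennpowr_ennpowr ennpowr_ennreal powr_powr)
  finally have "(\<integral>\<^sup>+\<theta>. ?F \<theta> \<partial>P) \<le> Mp p r f" using p by (simp add: ennpowr_le_iff)
  also have "(\<integral>\<^sup>+\<theta>. ?F \<theta> \<partial>P) = ennreal (1 / (2 * pi)) * circ_norm 1 f r"
    by (simp add: P_def nn_integral_density nn_integral_cmult circ_norm_def Lpn_1)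
  finally have "ennreal (2 * pi) * (ennreal (1 / (2 * pi)) * circ_norm 1 f r) \<le> ennreal (2 * pi) * Mp p r f"
    by (rule mult_left_mono) simp
  then show ?thesis by (simp add: mult.assoc[symmetric] flip: ennreal_mult)
qed

text \<open>Every point has an integer translate by multiples of \<open>2 * pi\<close> in the base
  interval, and countably many translates of a null set form a null set.\<close>

lemma AE_periodic:
  fixes P :: "real \<Rightarrow> bool"
  assumes ae: "AE x in lborel. x \<in> {0..2*pi} \<longrightarrow> P x" and per: "\<And>x. P (x + 2 * pi) \<longleftrightarrow> P x"
  shows "AE x in lborel. P x"
proof -
  have "AE x in lborel. x + 2 * pi * of_int k \<in> {0..2*pi} \<longrightarrow> P (x + 2 * pi * of_int k)" for k :: int

  proof -
    obtain N where N: "{x. \<not> (x \<in> {0..2*pi} \<longrightarrow> P x)} \<subseteq> N" "N \<in> null_sets lborel"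
      using ae by (auto simp: eventually_ae_filter)
    have N' [measurable]: "N \<in> sets borel" using N(2) by (simp add: null_sets_def)
    have "AE x in lborel. x \<notin> N" using N(2) by (rule AE_not_in)
    then have "AE x in lborel. 2 * pi * of_int k + 1 * x \<notin> N"
      by (intro AE_borel_affine) auto
    then show ?thesis by eventually_elim (use N(1) in \<open>auto simp: add.commute\<close>)
  qed
  then have "AE x in lborel. \<forall>k::int. x + 2 * pi * of_int k \<in> {0..2*pi} \<longrightarrow> P (x + 2 * pi * of_int k)"
    by (simp only: AE_all_countable) simp
  then show ?thesis
  proof eventually_elim
    case (elim x)
    define k where "k = - \<lfloor>x / (2*pi)\<rfloor>"
    define j where "j = real_of_int k"
    have "- j \<le> x / (2*pi)" "x / (2*pi) < 1 - j" unfolding j_def k_def by linarith+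
    then have "- j * (2*pi) \<le> x" "x < (1 - j) * (2*pi)"
      using pos_le_divide_eq[of "2*pi" "-j" x] pos_divide_less_eq[of "2*pi" x "1 - j"] by simp_all
    then have "x + 2 * pi * j \<in> {0..2*pi}" by (simp add: algebra_simps)
    then have "x + 2 * pi * of_int k \<in> {0..2*pi}" by (simp add: j_def)
    then show ?case using elim periodic_add_int[where f=P, OF per] by blast
  qed
qed

text \<open>As a definite description, \<open>boundary_value f\<close> comes without Borel
  measurability. \<open>\<psi>\<close> is a Borel, periodic version of it, to which translation,
  Fubini and Minkowski apply. Convergence is recorded in \<open>L^1\<close> along \<open>R\<close>
  for every \<open>p\<close>.\<close>

locale hardy_boundary =
  fixes p :: real and f :: "complex \<Rightarrow> complex" and R :: "nat \<Rightarrow> real" and \<psi> :: "real \<Rightarrow> complex"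
  assumes p: "1 \<le> p" and hol: "f holomorphic_on ball 0 1"
    and R: "\<And>n. 0 < R n" "\<And>n. R n < 1" "R \<longlonglongrightarrow> 1"
    and borel_psi [measurable]: "\<psi> \<in> borel_measurable borel"
    and psi_periodic: "\<And>x. \<psi> (x + 2 * pi) = \<psi> x"
    and boundary_value_AE: "AE x in lborel. boundary_value f (cis x) = \<psi> x"
    and nontangential_AE: "AE x in lborel. has_nontangential_limit f (\<psi> x) (cis x)"
    and psi_L1: "(\<lambda>n. \<integral>\<^sup>+x. ennreal (cmod (f (of_real (R n) * cis x) - \<psi> x)) \<partial>circ) \<longlonglongrightarrow> 0"

lemma AE_circ: "AE x in lborel. P x \<Longrightarrow> AE x in circ. P x"
  unfolding circ_def by (subst AE_density) auto

text \<open>\<open>\<psi>\<close> is the pointwise limit along the fast sequence of radii, equal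
  almost everywhere to the nontangential limit; Fatou's lemma passes the telescoped
  \<open>L^1\<close> bounds to it.\<close>

lemma hardy_boundary_exists:
  assumes p: "1 \<le> p" and f: "f \<in> hardy_space p"
  obtains R \<psi> where "hardy_boundary p f R \<psi>"
proof -
  have hol: "f holomorphic_on ball 0 1" and fin: "hardy_norm p f < \<infinity>" using f by (auto simp: hardy_space_def)
  obtain H where H: "hardy_norm p f = ennreal H" "H \<ge> 0" using fin by (cases "hardy_norm p f") auto
  have "circ_norm 1 f r \<le> ennreal (2 * pi * H)" if r: "0 \<le> r" "r < 1" for r
  proof -
    have "Mp p r f \<le> hardy_norm p f" unfolding hardy_norm_def using r by (intro SUP_upper) auto
    then have "ennreal (2 * pi) * Mp p r f \<le> ennreal (2 * pi) * ennreal H" unfolding H by (rule mult_left_mono) simp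
    then show ?thesis using circ_norm_1_le_Mp[OF hol r p] H by (simp add: ennreal_mult)
  qed
  then obtain R :: "nat \<Rightarrow> real" where R: "\<And>n. 0 < R n" "\<And>n. R n < 1" "R \<longlonglongrightarrow> 1"
    and diff: "\<And>n. (\<integral>\<^sup>+\<theta>. ennreal (cmod (f (of_real (R (Suc n)) * cis \<theta>) - f (of_real (R n) * cis \<theta>))) \<partial>circ) \<le> ennreal ((1/4) ^ n)"
    by (rule radial_sequence[OF hol]) (auto intro: that)
  define u where "u n x = f (of_real (R n) * cis x)" for n x
  have [measurable]: "u n \<in> borel_measurable borel" for n
    unfolding u_def using R(1,2)[of n] by (intro holomorphic_radius_measurable hol) auto
  define \<psi> where "\<psi> x = lim (\<lambda>n. u n x)" for x
  have [measurable]: "\<psi> \<in> borel_measurable borel"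
    unfolding \<psi>_def by (intro borel_measurable_lim_metric) simp
  have "AE x in lborel. has_nontangential_limit f (boundary_value f (cis x)) (cis x)"
    by (rule AE_periodic[OF boundary_convergence[OF hol R(1-3) diff]]) (simp add: cis_periodic)
  then have nt: "AE x in lborel. has_nontangential_limit f (boundary_value f (cis x)) (cis x) \<and>
      (\<lambda>n. u n x) \<longlonglongrightarrow> boundary_value f (cis x)"
  proof eventually_elim
    case (elim x)
    then show ?case unfolding u_def by (auto intro: nontangential_limit_radial R)
  qed
  have lim: "AE x in lborel. (\<lambda>n. u n x) \<longlonglongrightarrow> \<psi> x \<and> boundary_value f (cis x) = \<psi> x \<and> has_nontangential_limit f (\<psi> x) (cis x)"
    using nt
  proof eventually_elim
    case (elim x)
    then have "\<psi> x = boundary_value f (cis x)" unfolding \<psi>_def by (intro limI) simp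
    then show ?case using elim by simp
  qed
  have d: "(\<integral>\<^sup>+x. ennreal (cmod (u (n + k) x - u n x)) \<partial>circ) \<le> ennreal (2 * (1/4) ^ n)" for n k
  proof -
    \<comment> \<open>Subtracting \<open>2 * (1/4) ^ (n + k)\<close> strengthens the bound enough
      for the induction on \<open>k\<close> to close.\<close>
    have "(\<integral>\<^sup>+x. ennreal (cmod (u (n + k) x - u n x)) \<partial>circ) \<le> ennreal (2 * (1/4) ^ n - 2 * (1/4) ^ (n + k))"
    proof (induction k)
      case (Suc k)
      have "(\<integral>\<^sup>+x. ennreal (cmod (u (n + Suc k) x - u n x)) \<partial>circ) \<le>
          (\<integral>\<^sup>+x. ennreal (cmod (u (Suc (n + k)) x - u (n + k) x)) + ennreal (cmod (u (n + k) x - u n x)) \<partial>circ)"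
      proof (rule nn_integral_mono)
        fix x
        show "ennreal (cmod (u (n + Suc k) x - u n x)) \<le> ennreal (cmod (u (Suc (n + k)) x - u (n + k) x)) + ennreal (cmod (u (n + k) x - u n x))"
          using norm_triangle_ineq[of "u (Suc (n + k)) x - u (n + k) x" "u (n + k) x - u n x"]
          by (simp flip: ennreal_plus add: ennreal_leI)
      qed
      also have "\<dots> = (\<integral>\<^sup>+x. ennreal (cmod (u (Suc (n + k)) x - u (n + k) x)) \<partial>circ) + (\<integral>\<^sup>+x. ennreal (cmod (u (n + k) x - u n x)) \<partial>circ)"
        by (rule nn_integral_add) auto
      also have "\<dots> \<le> ennreal ((1/4) ^ (n + k)) + ennreal (2 * (1/4) ^ n - 2 * (1/4) ^ (n + k))"
        using diff[of "n + k"] Suc by (intro add_mono) (auto simp: u_def)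
      also have "\<dots> = ennreal ((1/4) ^ (n + k) + (2 * (1/4) ^ n - 2 * (1/4) ^ (n + k)))"
        by (intro ennreal_plus[symmetric]) (auto intro!: power_decreasing)
      also have "\<dots> \<le> ennreal (2 * (1/4) ^ n - 2 * (1/4) ^ (n + Suc k))" by (intro ennreal_leI) simp
      finally show ?case .
    qed simp
    also have "\<dots> \<le> ennreal (2 * (1/4) ^ n)" by (intro ennreal_leI) simp
    finally show ?thesis .
  qed
  have L1: "(\<integral>\<^sup>+x. ennreal (cmod (u n x - \<psi> x)) \<partial>circ) \<le> ennreal (2 * (1/4) ^ n)" for n
  proof -
    have "(\<integral>\<^sup>+x. ennreal (cmod (u n x - \<psi> x)) \<partial>circ) = (\<integral>\<^sup>+x. liminf (\<lambda>k. ennreal (cmod (u (n + k) x - u n x))) \<partial>circ)"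
    proof (rule nn_integral_cong_AE)
      show "AE x in circ. ennreal (cmod (u n x - \<psi> x)) = liminf (\<lambda>k. ennreal (cmod (u (n + k) x - u n x)))"
        using AE_circ[OF lim]
      proof eventually_elim
        case (elim x)
        then have "(\<lambda>k. u (k + n) x) \<longlonglongrightarrow> \<psi> x" by (intro LIMSEQ_ignore_initial_segment) auto
        then have "(\<lambda>k. ennreal (cmod (u (n + k) x - u n x))) \<longlonglongrightarrow> ennreal (cmod (\<psi> x - u n x))"
          by (intro tendsto_intros tendsto_ennrealI) (simp add: add.commute)
        from lim_imp_Liminf[OF _ this] show ?case by (simp add: norm_minus_commute)
      qed
    qed
    also have "\<dots> \<le> liminf (\<lambda>k. \<integral>\<^sup>+x. ennreal (cmod (u (n + k) x - u n x)) \<partial>circ)"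
      by (rule nn_integral_liminf) measurable
    also have "\<dots> \<le> ennreal (2 * (1/4) ^ n)"
      using d by (intro Liminf_le) (auto intro: always_eventually)
    finally show ?thesis .
  qed
  have "hardy_boundary p f R \<psi>"
  proof
    show "\<psi> (x + 2 * pi) = \<psi> x" for x by (simp add: \<psi>_def u_def cis_periodic)
    show "AE x in lborel. boundary_value f (cis x) = \<psi> x" "AE x in lborel. has_nontangential_limit f (\<psi> x) (cis x)"
      using lim by auto
    have z: "(\<lambda>n. ennreal (2 * (1/4) ^ n)) \<longlonglongrightarrow> ennreal 0" by (intro tendsto_ennrealI) real_asymp
    show "(\<lambda>n. \<integral>\<^sup>+x. ennreal (cmod (f (of_real (R n) * cis x) - \<psi> x)) \<partial>circ) \<longlonglongrightarrow> 0"
    proof (rule tendsto_sandwich)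
      show "\<forall>\<^sub>F n in sequentially. (\<integral>\<^sup>+x. ennreal (cmod (f (of_real (R n) * cis x) - \<psi> x)) \<partial>circ) \<le> ennreal (2 * (1/4) ^ n)"
        using L1 unfolding u_def by (intro always_eventually allI)
      show "\<forall>\<^sub>F n in sequentially. 0 \<le> (\<integral>\<^sup>+x. ennreal (cmod (f (of_real (R n) * cis x) - \<psi> x)) \<partial>circ)" by simp
      show "(\<lambda>n. ennreal (2 * (1/4) ^ n)) \<longlonglongrightarrow> 0" using z by simp
    qed (rule tendsto_const)
  qed (use p hol R in auto)
  then show ?thesis by (rule that)
qed

text \<open>The Blaschke factor at \<open>z\<close> divides \<open>F - F z\<close> and has modulus one on the circle.\<close>

lemma norm_deriv_le_poisson:
  assumes F: "F holomorphic_on ball 0 R" and R: "1 < R" and z: "cmod z < 1"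
  shows "ennreal ((1 - (cmod z)\<^sup>2) * cmod (deriv F z)) \<le>
    (\<integral>\<^sup>+\<theta>. ennreal (cmod (F (cis \<theta>) - F z)) * ennreal (poisson z \<theta>) \<partial>circ)"
proof -
  define g where "g w = (if w = z then deriv F z else (F w - F z) / (w - z))" for w
  define h where "h w = g w * (1 - cnj z * w)" for w
  have "g holomorphic_on ball 0 R" unfolding g_def by (rule pole_lemma_open[OF F]) simp
  then have h: "h holomorphic_on ball 0 R" unfolding h_def by (intro holomorphic_intros)
  have "1 - cnj z * z = of_real (1 - (cmod z)\<^sup>2)"
    by (simp add: complex_norm_square[unfolded of_real_power] mult.commute)
  then have "cmod (h z) = cmod (deriv F z) * \<bar>1 - (cmod z)\<^sup>2\<bar>"
    by (simp only: h_def g_def norm_mult norm_of_real) simp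
  moreover have "\<bar>1 - (cmod z)\<^sup>2\<bar> = 1 - (cmod z)\<^sup>2" using z by (simp add: abs_square_le_1)
  moreover have "cmod (h (cis \<theta>)) = cmod (F (cis \<theta>) - F z)" for \<theta>
    using norm_diff_eq_norm_blaschke[of "cis \<theta>" z] cis_ne[OF z, of \<theta>]
    by (simp add: h_def g_def norm_mult norm_divide)
  ultimately show ?thesis using norm_le_poisson[OF h R z] by (simp add: mult.commute)
qed

section \<open>Poisson estimates for the boundary function\<close>

context hardy_boundary
begin

lemma borel_f [measurable]: "0 \<le> r \<Longrightarrow> r < 1 \<Longrightarrow> (\<lambda>x. f (of_real r * cis x)) \<in> borel_measurable borel"
  by (rule holomorphic_radius_measurable[OF hol])

lemma borel_fR [measurable]: "(\<lambda>x. f (of_real (R n) * cis x)) \<in> borel_measurable borel"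
  using R(1,2)[of n] by (intro borel_f) auto

text \<open>For fixed \<open>z\<close> the kernel is at most \<open>1 / (1 - cmod z)\<close>, so
  \<open>L^1\<close> convergence of the dilations suffices. The centre \<open>y n\<close> may vary
  because the derivative estimate for a dilate is centred at \<open>f (R n * z)\<close>.\<close>

lemma limit_poisson:
  assumes z: "cmod z < 1" and y: "y \<longlonglongrightarrow> y'" and x: "x \<longlonglongrightarrow> x'"
    and le: "\<And>n. ennreal (x n) \<le> (\<integral>\<^sup>+\<theta>. ennreal (cmod (f (of_real (R n) * cis \<theta>) - y n)) * ennreal (poisson z \<theta>) \<partial>circ)"
  shows "ennreal x' \<le> (\<integral>\<^sup>+\<theta>. ennreal (cmod (\<psi> \<theta> - y')) * ennreal (poisson z \<theta>) \<partial>circ)" (is "_ \<le> ?J")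
proof (rule LIMSEQ_le)
  define e where "e n = (\<integral>\<^sup>+\<theta>. ennreal (cmod (f (of_real (R n) * cis \<theta>) - \<psi> \<theta>)) \<partial>circ)" for n
  define b where "b = 1 / (1 - cmod z)"
  have b: "b \<ge> 0" using z by (simp add: b_def)
  show "(\<lambda>n. ennreal (x n)) \<longlonglongrightarrow> ennreal x'" by (intro tendsto_ennrealI x)
  have "(\<lambda>n. ?J + ennreal b * e n + ennreal (cmod (y' - y n))) \<longlonglongrightarrow> ?J + ennreal b * 0 + ennreal (cmod (y' - y'))"
    using psi_L1 by (intro tendsto_intros tendsto_ennrealI ennreal_tendsto_cmult y) (auto simp: e_def)
  then show "(\<lambda>n. ?J + ennreal b * e n + ennreal (cmod (y' - y n))) \<longlonglongrightarrow> ?J" by simp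
  have "ennreal (x n) \<le> ?J + ennreal b * e n + ennreal (cmod (y' - y n))" for n
  proof -
    note le[of n]
    also have "(\<integral>\<^sup>+\<theta>. ennreal (cmod (f (of_real (R n) * cis \<theta>) - y n)) * ennreal (poisson z \<theta>) \<partial>circ) \<le>
      (\<integral>\<^sup>+\<theta>. ennreal (cmod (\<psi> \<theta> - y')) * ennreal (poisson z \<theta>) + ennreal b * ennreal (cmod (f (of_real (R n) * cis \<theta>) - \<psi> \<theta>)) +
        ennreal (cmod (y' - y n)) * ennreal (poisson z \<theta>) \<partial>circ)"
    proof (rule nn_integral_mono)
      fix \<theta>
      let ?A = "cmod (f (of_real (R n) * cis \<theta>) - \<psi> \<theta>)" and ?P = "poisson z \<theta>"
      have P: "0 \<le> ?P" "?P \<le> b" using poisson_nonneg[OF z] poisson_le[OF z] by (auto simp: b_def)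
      have "cmod (f (of_real (R n) * cis \<theta>) - y n) \<le> cmod (\<psi> \<theta> - y') + ?A + cmod (y' - y n)"
        using norm_triangle_ineq[of "\<psi> \<theta> - y' + (f (of_real (R n) * cis \<theta>) - \<psi> \<theta>)" "y' - y n"]
          norm_triangle_ineq[of "\<psi> \<theta> - y'" "f (of_real (R n) * cis \<theta>) - \<psi> \<theta>"] by simp
      then have "cmod (f (of_real (R n) * cis \<theta>) - y n) * ?P \<le> (cmod (\<psi> \<theta> - y') + ?A + cmod (y' - y n)) * ?P"
        using P by (intro mult_right_mono) auto
      also have "\<dots> \<le> cmod (\<psi> \<theta> - y') * ?P + b * ?A + cmod (y' - y n) * ?P"
        using P mult_right_mono[of ?P b ?A] by (simp add: algebra_simps)
      finally show "ennreal (cmod (f (of_real (R n) * cis \<theta>) - y n)) * ennreal ?P \<le>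
        ennreal (cmod (\<psi> \<theta> - y')) * ennreal ?P + ennreal b * ennreal ?A + ennreal (cmod (y' - y n)) * ennreal ?P"
        using P b by (simp flip: ennreal_mult ennreal_plus add: ennreal_leI)
    qed
    also have "\<dots> = ?J + ennreal b * e n + ennreal (cmod (y' - y n)) * 1"
      unfolding e_def nn_integral_poisson[OF z, symmetric]
      by (simp add: nn_integral_add nn_integral_cmult)
    finally show ?thesis by simp
  qed
  then show "\<exists>N. \<forall>n\<ge>N. ennreal (x n) \<le> ?J + ennreal b * e n + ennreal (cmod (y' - y n))" by blast
qed

lemma isCont_f: "cmod z < 1 \<Longrightarrow> isCont f z"
  using hol by (intro holomorphic_on_imp_continuous_on[THEN continuous_on_interior]) auto

lemma deriv_hol: "deriv f holomorphic_on ball 0 1"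
  by (rule holomorphic_deriv[OF hol]) simp

lemma R_tendsto: "(\<lambda>n. of_real (R n) * z) \<longlonglongrightarrow> (z::complex)"
  using tendsto_mult_right[OF tendsto_of_real[OF R(3)], of z] by simp

lemma norm_diff_le_poisson:
  assumes z: "cmod z < 1"
  shows "ennreal (cmod (c - f z)) \<le> (\<integral>\<^sup>+\<theta>. ennreal (cmod (\<psi> \<theta> - c)) * ennreal (poisson z \<theta>) \<partial>circ)"
proof (rule limit_poisson[OF z tendsto_const])
  show "(\<lambda>n. cmod (c - f (of_real (R n) * z))) \<longlonglongrightarrow> cmod (c - f z)"
    by (intro tendsto_intros isCont_tendsto_compose[OF isCont_f[OF z]] R_tendsto)
  fix n
  note F = holomorphic_dilate[OF hol R(1,2)[of n]]
  have "(\<lambda>w. f (of_real (R n) * w) - c) holomorphic_on ball 0 (1 / R n)" by (intro holomorphic_intros F)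
  from norm_le_poisson[OF this F(2) z]
  show "ennreal (cmod (c - f (of_real (R n) * z))) \<le>
      (\<integral>\<^sup>+\<theta>. ennreal (cmod (f (of_real (R n) * cis \<theta>) - c)) * ennreal (poisson z \<theta>) \<partial>circ)"
    by (simp add: norm_minus_commute)
qed

text \<open>The pointwise form of the first inequality of the theorem. The factor \<open>R n\<close>
  in the proof comes from the chain rule for dilates.\<close>

lemma norm_deriv_le:
  assumes z: "cmod z < 1"
  shows "ennreal ((1 - cmod z) * cmod (deriv f z)) \<le> (\<integral>\<^sup>+\<theta>. ennreal (cmod (\<psi> \<theta> - f z)) * ennreal (poisson z \<theta>) \<partial>circ)"
proof -
  have "ennreal ((1 - (cmod z)\<^sup>2) * cmod (deriv f z)) \<le> (\<integral>\<^sup>+\<theta>. ennreal (cmod (\<psi> \<theta> - f z)) * ennreal (poisson z \<theta>) \<partial>circ)"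
  proof (rule limit_poisson[OF z])
    show "(\<lambda>n. f (of_real (R n) * z)) \<longlonglongrightarrow> f z"
      by (intro isCont_tendsto_compose[OF isCont_f[OF z]] R_tendsto)
    have "isCont (deriv f) z"
      using deriv_hol z by (intro holomorphic_on_imp_continuous_on[THEN continuous_on_interior]) auto
    then have "(\<lambda>n. (1 - (cmod z)\<^sup>2) * (R n * cmod (deriv f (of_real (R n) * z)))) \<longlonglongrightarrow> (1 - (cmod z)\<^sup>2) * (1 * cmod (deriv f z))"
      by (intro tendsto_intros R isCont_tendsto_compose[where g="deriv f"] R_tendsto)
    then show "(\<lambda>n. (1 - (cmod z)\<^sup>2) * (R n * cmod (deriv f (of_real (R n) * z)))) \<longlonglongrightarrow> (1 - (cmod z)\<^sup>2) * cmod (deriv f z)" by simp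
    fix n
    note F = holomorphic_dilate[OF hol R(1,2)[of n]]
    have "cmod (of_real (R n) * z) < 1"
      using R(1,2)[of n] z mult_left_le_one_le[of "cmod z" "R n"] by (simp add: norm_mult)
    then have "(f has_field_derivative deriv f (of_real (R n) * z)) (at (of_real (R n) * z))"
      using hol by (intro holomorphic_derivI) auto
    then have "((\<lambda>w. f (of_real (R n) * w)) has_field_derivative deriv f (of_real (R n) * z) * of_real (R n)) (at z)"
      by (rule DERIV_chain2) (auto intro!: derivative_eq_intros)
    then have "deriv (\<lambda>w. f (of_real (R n) * w)) z = deriv f (of_real (R n) * z) * of_real (R n)" by (rule DERIV_imp_deriv)
    then show "ennreal ((1 - (cmod z)\<^sup>2) * (R n * cmod (deriv f (of_real (R n) * z)))) \<le>
      (\<integral>\<^sup>+\<theta>. ennreal (cmod (f (of_real (R n) * cis \<theta>) - f (of_real (R n) * z))) * ennreal (poisson z \<theta>) \<partial>circ)"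
      using norm_deriv_le_poisson[OF F z] R(1)[of n] by (simp add: norm_mult mult.commute)
  qed
  moreover have "(1 - cmod z) * cmod (deriv f z) \<le> (1 - (cmod z)\<^sup>2) * cmod (deriv f z)"
    using z by (intro mult_right_mono) (auto simp: power2_eq_square mult_left_le)
  ultimately show ?thesis by (meson ennreal_leI order_trans)
qed

text \<open>Fatou's lemma along \<open>R\<close>. The bound makes the moduli of continuity finite,
  see \<open>modulus_finite\<close>.\<close>

lemma Lpn_psi_le: "Lpn circ p (\<lambda>x. ennreal (cmod (\<psi> x))) \<le> ennreal ((2 * pi) powr (1 / p)) * hardy_norm p f"
proof -
  have p0: "p > 0" using p by simp
  have "(\<integral>\<^sup>+x. ennpowr (ennreal (cmod (\<psi> x))) p \<partial>circ) =
      (\<integral>\<^sup>+x. liminf (\<lambda>n. ennpowr (ennreal (cmod (f (of_real (R n) * cis x)))) p) \<partial>circ)"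
  proof (rule nn_integral_cong_AE)
    show "AE x in circ. ennpowr (ennreal (cmod (\<psi> x))) p = liminf (\<lambda>n. ennpowr (ennreal (cmod (f (of_real (R n) * cis x)))) p)"
      using AE_circ[OF nontangential_AE]
    proof eventually_elim
      case (elim x)
      have "(\<lambda>n. f (of_real (R n) * cis x)) \<longlonglongrightarrow> \<psi> x"
        by (rule nontangential_limit_radial[OF elim]) (use R in auto)
      then have "(\<lambda>n. ennreal (cmod (f (of_real (R n) * cis x)) powr p)) \<longlonglongrightarrow> ennreal (cmod (\<psi> x) powr p)"
        using p0 by (intro tendsto_ennrealI tendsto_powr' tendsto_intros) auto
      from lim_imp_Liminf[OF _ this] show ?case by (simp add: ennpowr_ennreal)
    qed
  qed
  also have "\<dots> \<le> liminf (\<lambda>n. \<integral>\<^sup>+x. ennpowr (ennreal (cmod (f (of_real (R n) * cis x)))) p \<partial>circ)"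
    by (rule nn_integral_liminf) measurable
  also have "\<dots> \<le> ennpowr (ennreal ((2 * pi) powr (1 / p)) * hardy_norm p f) p"
  proof (intro Liminf_le always_eventually allI)
    fix n
    have r: "0 \<le> R n" "R n < 1" using R(1,2)[of n] by auto
    have "circ_norm p f (R n) = ennreal ((2 * pi) powr (1 / p)) * Mp p (R n) f"
      using p0 by (simp add: Mp_eq_circ_norm[OF hol r p0] mult.assoc[symmetric] flip: ennreal_mult powr_mult)
    also have "\<dots> \<le> ennreal ((2 * pi) powr (1 / p)) * hardy_norm p f"
      unfolding hardy_norm_def using r by (intro mult_left_mono SUP_upper) auto
    finally have "ennpowr (circ_norm p f (R n)) p \<le> ennpowr (ennreal ((2 * pi) powr (1 / p)) * hardy_norm p f) p"
      using p0 by (intro ennpowr_mono) auto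
    then show "(\<integral>\<^sup>+x. ennpowr (ennreal (cmod (f (of_real (R n) * cis x)))) p \<partial>circ) \<le> ennpowr (ennreal ((2 * pi) powr (1 / p)) * hardy_norm p f) p"
      using p0 by (simp add: circ_norm_def ennpowr_Lpn)
  qed simp
  finally have "ennpowr (Lpn circ p (\<lambda>x. ennreal (cmod (\<psi> x)))) p \<le> ennpowr (ennreal ((2 * pi) powr (1 / p)) * hardy_norm p f) p"
    using p0 by (simp add: ennpowr_Lpn)
  then show ?thesis using p0 by (simp add: ennpowr_le_iff)
qed

end

section \<open>Moduli of continuity\<close>

context hardy_boundary
begin

lemma p_pos: "0 < p" "p \<noteq> 0"
  using p by auto

definition osc :: "real \<Rightarrow> ennreal" where
  "osc h = Lpn circ p (\<lambda>x. ennreal (cmod (\<psi> (x + h) - \<psi> x)))"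

definition modulus :: "real \<Rightarrow> ennreal" where
  "modulus t = (SUP h\<in>{0<..<t}. osc h)"

lemma borel_osc [measurable]: "osc \<in> borel_measurable borel"
proof -
  interpret sigma_finite_measure circ by (rule sigma_finite_circ)
  show ?thesis unfolding osc_def Lpn_def by measurable
qed

lemma osc_periodic: "osc (h + 2 * pi) = osc h"
  using psi_periodic[of "x + h" for x] by (simp add: osc_def add.assoc[symmetric])

lemma psi_shift: "\<psi> (x + 2 * pi + h) = \<psi> (x + h)" "\<psi> (x + 2 * pi - h) = \<psi> (x - h)"
  using psi_periodic[of "x + h"] psi_periodic[of "x - h"] by (simp_all add: algebra_simps)

lemma osc_0: "osc 0 = 0"
  using p_pos by (simp add: osc_def Lpn_const)

lemma osc_minus: "osc (- h) = osc h"
proof -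
  have "osc (- h) = Lpn circ p (\<lambda>x. ennreal (cmod (\<psi> ((x + h) + - h) - \<psi> (x + h))))"
    unfolding osc_def
    by (rule Lpn_circ_shift[symmetric]) (measurable, simp only: psi_shift psi_periodic)
  then show ?thesis by (simp add: osc_def norm_minus_commute)
qed

lemma osc_double: "osc (2 * h) \<le> 2 * osc h"
proof -
  have "osc (2 * h) \<le> Lpn circ p (\<lambda>x. ennreal (cmod (\<psi> ((x + h) + h) - \<psi> (x + h))) + ennreal (cmod (\<psi> (x + h) - \<psi> x)))"
    unfolding osc_def
  proof (rule Lpn_mono[OF p_pos(1)])
    fix x
    show "ennreal (cmod (\<psi> (x + 2 * h) - \<psi> x)) \<le> ennreal (cmod (\<psi> ((x + h) + h) - \<psi> (x + h))) + ennreal (cmod (\<psi> (x + h) - \<psi> x))"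
      using norm_triangle_ineq[of "\<psi> (x + h + h) - \<psi> (x + h)" "\<psi> (x + h) - \<psi> x"]
      by (simp flip: ennreal_plus add: ennreal_leI add.assoc)
  qed
  also have "\<dots> \<le> Lpn circ p (\<lambda>x. ennreal (cmod (\<psi> ((x + h) + h) - \<psi> (x + h)))) + osc h"
    unfolding osc_def by (rule Lpn_add_le[OF sigma_finite_circ p]) measurable
  also have "Lpn circ p (\<lambda>x. ennreal (cmod (\<psi> ((x + h) + h) - \<psi> (x + h)))) = osc h"
    unfolding osc_def
    by (rule Lpn_circ_shift[where F="\<lambda>x. ennreal (cmod (\<psi> (x + h) - \<psi> x))"])
       (measurable, simp only: psi_shift psi_periodic)
  finally show ?thesis by (simp only: mult_2[of "osc h"])
qed

lemma osc_le: "osc h \<le> 2 * Lpn circ p (\<lambda>x. ennreal (cmod (\<psi> x)))"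
proof -
  have "osc h \<le> Lpn circ p (\<lambda>x. ennreal (cmod (\<psi> (x + h))) + ennreal (cmod (\<psi> x)))"
    unfolding osc_def using norm_triangle_ineq4
    by (intro Lpn_mono p_pos) (simp flip: ennreal_plus add: ennreal_leI)
  also have "\<dots> \<le> Lpn circ p (\<lambda>x. ennreal (cmod (\<psi> (x + h)))) + Lpn circ p (\<lambda>x. ennreal (cmod (\<psi> x)))"
    by (rule Lpn_add_le[OF sigma_finite_circ p]) measurable
  also have "Lpn circ p (\<lambda>x. ennreal (cmod (\<psi> (x + h)))) = Lpn circ p (\<lambda>x. ennreal (cmod (\<psi> x)))"
    by (rule Lpn_circ_shift[where F="\<lambda>x. ennreal (cmod (\<psi> x))"]) (auto simp: psi_periodic)
  finally show ?thesis by (simp add: mult_2)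
qed

lemma modulus_mono: "s \<le> t \<Longrightarrow> modulus s \<le> modulus t"
  unfolding modulus_def by (intro SUP_subset_mono) auto

lemma osc_le_modulus: "\<bar>h\<bar> < t \<Longrightarrow> osc h \<le> modulus t"
proof (cases "h = 0")
  case False
  assume "\<bar>h\<bar> < t"
  then have "osc \<bar>h\<bar> \<le> modulus t" unfolding modulus_def using False by (intro SUP_upper) auto
  then show ?thesis using osc_minus[of h] by (cases "0 \<le> h") auto
qed (simp add: osc_0)

lemma modulus_double: "modulus (2 * t) \<le> 2 * modulus t"
proof -
  have "osc h \<le> 2 * modulus t" if "h \<in> {0<..<2 * t}" for h
  proof -
    have "osc h \<le> 2 * osc (h / 2)" using osc_double[of "h / 2"] by simp
    also have "\<dots> \<le> 2 * modulus t" using that by (intro mult_left_mono osc_le_modulus) auto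
    finally show ?thesis .
  qed
  then show ?thesis unfolding modulus_def[of "2 * t"] by (intro SUP_least)
qed

text \<open>Two doublings suffice since \<open>pi < 4\<close>. This covers the dyadic windows that
  are longer than the unit scale.\<close>

lemma osc_le_modulus_1: "\<bar>h\<bar> \<le> pi \<Longrightarrow> osc h \<le> 4 * modulus 1"
proof -
  assume h: "\<bar>h\<bar> \<le> pi"
  have "osc h \<le> modulus (2 * (2 * 1))" using h pi_less_4 by (intro osc_le_modulus) auto
  also have "\<dots> \<le> 2 * modulus (2 * 1)" by (rule modulus_double)
  also have "\<dots> \<le> 2 * (2 * modulus 1)" by (intro mult_left_mono modulus_double) simp
  also have "\<dots> = 4 * modulus 1" by (simp flip: mult.assoc)
  finally show ?thesis .
qed

section \<open>The Poisson deviation and its bound by moduli of continuity\<close>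

definition deviation :: "real \<Rightarrow> ennreal" where
  "deviation r = Lpn circ p (\<lambda>t. \<integral>\<^sup>+\<theta>. ennreal (cmod (\<psi> \<theta> - f (of_real r * cis t))) *
     ennreal (poisson (of_real r * cis t) \<theta>) \<partial>circ)"

lemma circ_norm_deriv_le_deviation:
  assumes r: "0 \<le> r" "r < 1"
  shows "ennreal (1 - r) * circ_norm p (deriv f) r \<le> deviation r"
proof -
  note [measurable] = holomorphic_radius_measurable[OF deriv_hol r]
  have "ennreal (1 - r) * circ_norm p (deriv f) r =
      Lpn circ p (\<lambda>t. ennreal (1 - r) * ennreal (cmod (deriv f (of_real r * cis t))))"
    unfolding circ_norm_def by (rule Lpn_cmult[symmetric]) (use p in auto)
  also have "\<dots> \<le> deviation r" unfolding deviation_def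
  proof (rule Lpn_mono[OF p_pos(1)])
    fix t
    have "cmod (of_real r * cis t) = r" using r by (simp add: norm_mult)
    then show "ennreal (1 - r) * ennreal (cmod (deriv f (of_real r * cis t))) \<le>
      (\<integral>\<^sup>+\<theta>. ennreal (cmod (\<psi> \<theta> - f (of_real r * cis t))) * ennreal (poisson (of_real r * cis t) \<theta>) \<partial>circ)"
      using norm_deriv_le[of "of_real r * cis t"] r by (simp flip: ennreal_mult)
  qed
  finally show ?thesis .
qed

text \<open>The difference from \<open>f z\<close> is split at \<open>\<psi> t\<close>. The part
  \<open>\<psi> t - f z\<close> is again bounded by the Poisson mean of
  \<open>\<psi> \<theta> - \<psi> t\<close>, whence the factor 2; a rotation and Minkowski's
  inequality then produce \<open>osc\<close>.\<close>

lemma deviation_le_osc: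
  assumes r: "0 \<le> r" "r < 1"
  shows "deviation r \<le> 2 * (\<integral>\<^sup>+x. osc x * ennreal (poisson (of_real r) x) \<partial>circ)"
proof -
  have z: "cmod (of_real r * cis t) < 1" for t using r by (simp add: norm_mult)
  have "deviation r \<le> Lpn circ p (\<lambda>t. 2 * (\<integral>\<^sup>+x. ennreal (cmod (\<psi> (t + x) - \<psi> t)) * ennreal (poisson (of_real r) x) \<partial>circ))"
    unfolding deviation_def
  proof (rule Lpn_mono[OF p_pos(1)])
    fix t
    let ?z = "of_real r * cis t"
    let ?J = "\<integral>\<^sup>+\<theta>. ennreal (cmod (\<psi> \<theta> - \<psi> t)) * ennreal (poisson ?z \<theta>) \<partial>circ"
    have "(\<integral>\<^sup>+\<theta>. ennreal (cmod (\<psi> \<theta> - f ?z)) * ennreal (poisson ?z \<theta>) \<partial>circ) \<le>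
      (\<integral>\<^sup>+\<theta>. ennreal (cmod (\<psi> \<theta> - \<psi> t)) * ennreal (poisson ?z \<theta>) + ennreal (cmod (\<psi> t - f ?z)) * ennreal (poisson ?z \<theta>) \<partial>circ)"
    proof (rule nn_integral_mono)
      fix \<theta>
      have "cmod (\<psi> \<theta> - f ?z) \<le> cmod (\<psi> \<theta> - \<psi> t) + cmod (\<psi> t - f ?z)"
        using norm_triangle_ineq[of "\<psi> \<theta> - \<psi> t" "\<psi> t - f ?z"] by simp
      then have "ennreal (cmod (\<psi> \<theta> - f ?z)) \<le> ennreal (cmod (\<psi> \<theta> - \<psi> t)) + ennreal (cmod (\<psi> t - f ?z))"
        by (simp flip: ennreal_plus add: ennreal_leI)
      then show "ennreal (cmod (\<psi> \<theta> - f ?z)) * ennreal (poisson ?z \<theta>) \<le>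
        ennreal (cmod (\<psi> \<theta> - \<psi> t)) * ennreal (poisson ?z \<theta>) + ennreal (cmod (\<psi> t - f ?z)) * ennreal (poisson ?z \<theta>)"
        unfolding distrib_right[symmetric] by (rule mult_right_mono) simp
    qed
    also have "\<dots> = ?J + ennreal (cmod (\<psi> t - f ?z)) * (\<integral>\<^sup>+\<theta>. ennreal (poisson ?z \<theta>) \<partial>circ)"
      by (simp add: nn_integral_add nn_integral_cmult)
    also have "\<dots> \<le> ?J + ?J"
      using norm_diff_le_poisson[OF z[of t], of "\<psi> t"] by (intro add_left_mono) (simp add: nn_integral_poisson z)
    also have "\<dots> = 2 * ?J" by (simp add: mult_2)
    also have "?J = (\<integral>\<^sup>+x. ennreal (cmod (\<psi> (x + t) - \<psi> t)) * ennreal (poisson ?z (x + t)) \<partial>circ)"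
      by (rule nn_integral_circ_shift[symmetric]) (auto simp: psi_periodic poisson_periodic)
    finally show "(\<integral>\<^sup>+\<theta>. ennreal (cmod (\<psi> \<theta> - f ?z)) * ennreal (poisson ?z \<theta>) \<partial>circ) \<le>
        2 * (\<integral>\<^sup>+x. ennreal (cmod (\<psi> (t + x) - \<psi> t)) * ennreal (poisson (of_real r) x) \<partial>circ)"
      unfolding poisson_rotate by (simp add: add.commute)
  qed
  also have "\<dots> = 2 * Lpn circ p (\<lambda>t. \<integral>\<^sup>+x. ennreal (cmod (\<psi> (t + x) - \<psi> t)) * ennreal (poisson (of_real r) x) \<partial>circ)"
  proof -
    interpret sigma_finite_measure circ by (rule sigma_finite_circ)
    show ?thesis by (rule Lpn_cmult) (measurable, rule p_pos)
  qed
  also have "\<dots> \<le> 2 * (\<integral>\<^sup>+x. Lpn circ p (\<lambda>t. ennreal (cmod (\<psi> (t + x) - \<psi> t)) * ennreal (poisson (of_real r) x)) \<partial>circ)"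
    by (intro mult_left_mono Lpn_nn_integral_le sigma_finite_circ p) measurable
  also have "(\<integral>\<^sup>+x. Lpn circ p (\<lambda>t. ennreal (cmod (\<psi> (t + x) - \<psi> t)) * ennreal (poisson (of_real r) x)) \<partial>circ) =
      (\<integral>\<^sup>+x. osc x * ennreal (poisson (of_real r) x) \<partial>circ)"
    unfolding osc_def mult.commute[of _ "ennreal (poisson _ _)"]
    by (subst Lpn_cmult) (auto simp: p_pos)
  finally show ?thesis .
qed

text \<open>The dyadic windows of width \<open>2^k (1 - r)\<close> are contained in those of width
  \<open>2^(k - n)\<close>, so the kernel sum becomes \<open>\<Sum>k. 2^-k w (n - k)\<close>;
  reversing the index gives \<open>2^-n\<close> times the sum on the right.\<close>

lemma deviation_le_dyadic:
  assumes r: "1 - (1/2) ^ n \<le> r" "r < 1"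
  shows "deviation r \<le> ennreal (2048 * (1/2) ^ n) * (\<Sum>k. of_bool (k \<le> n) * (ennreal (2 ^ k) * modulus ((1/2) ^ k)))"
proof -
  define \<delta> where "\<delta> = 1 - r"
  have \<delta>: "0 < \<delta>" "\<delta> \<le> (1/2) ^ n" using r by (auto simp: \<delta>_def)
  have r0: "0 \<le> r" using r(1) power_le_one[of "1/2::real" n] by linarith
  define w where "w k = modulus ((1/2) ^ k)" for k :: nat
  define X where "X = (\<Sum>k\<le>n. ennreal (2 ^ k) * w k)"
  have "(\<integral>\<^sup>+x. osc x * ennreal (poisson (of_real r) x) \<partial>circ) \<le> ennreal (16 * (1 + 1)\<^sup>2) * (\<Sum>k. ennreal ((1/4) ^ k / \<delta>) *
      (\<integral>\<^sup>+x. osc (0 + x) * indicator {-pi..pi} x * indicator {-(2 ^ k * \<delta>)<..<2 ^ k * \<delta>} x \<partial>lborel))"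
  proof -
    have "cmod (of_real r - cis 0) = 1 - r"
      using r norm_of_real[of "r - 1", where 'a=complex] by simp
    then show ?thesis
      using nn_integral_poisson_le_dyadic[OF borel_osc osc_periodic, of "of_real r" 0 1] r r0 by (simp add: \<delta>_def)
  qed
  also have "\<dots> \<le> ennreal (16 * (1 + 1)\<^sup>2) * (\<Sum>k. 8 * (ennreal ((1/2) ^ k) * w (n - k)))"
  proof (intro mult_left_mono suminf_le)
    fix k
    have "(\<integral>\<^sup>+x. osc (0 + x) * indicator {-pi..pi} x * indicator {-(2 ^ k * \<delta>)<..<2 ^ k * \<delta>} x \<partial>lborel) \<le>
      (\<integral>\<^sup>+x. (4 * w (n - k)) * indicator {-(2 ^ k * \<delta>)<..<2 ^ k * \<delta>} x \<partial>lborel)"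
    proof (rule nn_integral_mono)
      fix x
      \<comment> \<open>For \<open>k > n\<close> the truncated difference is 0 and the bound by
        \<open>4 * w 0\<close> comes from \<open>osc_le_modulus_1\<close>; for
        \<open>k \<le> n\<close> the factor 4 is slack.\<close>
      have "osc x \<le> 4 * w (n - k)" if x: "\<bar>x\<bar> \<le> pi" "\<bar>x\<bar> < 2 ^ k * \<delta>"
      proof (cases "k \<le> n")
        case True
        have "2 ^ k * \<delta> \<le> 2 ^ k * (1/2) ^ n" using \<delta> by (intro mult_left_mono) auto
        also have "\<dots> = (1/2) ^ (n - k)"
        proof -
          have "(1/2::real) ^ n = (1/2) ^ k * (1/2) ^ (n - k)" using True by (simp flip: power_add)
          then show ?thesis by (simp add: power_one_over)
        qed
        finally have "osc x \<le> w (n - k)" using x unfolding w_def by (intro osc_le_modulus) auto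
        also have "\<dots> = 1 * w (n - k)" by simp
        also have "\<dots> \<le> 4 * w (n - k)" by (intro mult_right_mono) auto
        finally show ?thesis .
      next
        case False
        then show ?thesis using osc_le_modulus_1[OF x(1)] by (simp add: w_def)
      qed
      then show "osc (0 + x) * indicator {-pi..pi} x * indicator {-(2 ^ k * \<delta>)<..<2 ^ k * \<delta>} x \<le>
        (4 * w (n - k)) * indicator {-(2 ^ k * \<delta>)<..<2 ^ k * \<delta>} x"
        by (auto split: split_indicator)
    qed
    also have "\<dots> = (4 * w (n - k)) * ennreal (2 * (2 ^ k * \<delta>))"
      using \<delta> by (simp add: nn_integral_cmult_indicator mult.commute[of \<delta>])
    finally have "ennreal ((1/4) ^ k / \<delta>) * (\<integral>\<^sup>+x. osc (0 + x) * indicator {-pi..pi} x * indicator {-(2 ^ k * \<delta>)<..<2 ^ k * \<delta>} x \<partial>lborel) \<le>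
       ennreal ((1/4) ^ k / \<delta>) * ((4 * w (n - k)) * ennreal (2 * (2 ^ k * \<delta>)))" by (rule mult_left_mono) simp
    also have "\<dots> = (ennreal ((1/4) ^ k / \<delta>) * ennreal (2 * (2 ^ k * \<delta>))) * (4 * w (n - k))" by (simp only: ac_simps)
    also have "ennreal ((1/4) ^ k / \<delta>) * ennreal (2 * (2 ^ k * \<delta>)) = ennreal (2 * (1/2) ^ k)"
    proof -
      have "(1/4::real) ^ k * 2 ^ k = (1/2) ^ k" by (simp flip: power_mult_distrib)
      then have "(1/4) ^ k / \<delta> * (2 * (2 ^ k * \<delta>)) = 2 * (1/2) ^ k" using \<delta> by (simp add: field_simps)
      then show ?thesis using \<delta> by (simp flip: ennreal_mult)
    qed
    also have "ennreal (2 * (1/2) ^ k) * (4 * w (n - k)) = 8 * (ennreal ((1/2) ^ k) * w (n - k))"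
      by (simp add: ennreal_mult mult.assoc mult.left_commute)
    finally show "ennreal ((1/4) ^ k / \<delta>) * (\<integral>\<^sup>+x. osc (0 + x) * indicator {-pi..pi} x * indicator {-(2 ^ k * \<delta>)<..<2 ^ k * \<delta>} x \<partial>lborel) \<le>
       8 * (ennreal ((1/2) ^ k) * w (n - k))" .
  qed auto
  also have "(\<Sum>k. 8 * (ennreal ((1/2) ^ k) * w (n - k))) \<le> 8 * (ennreal ((1/2) ^ n) * (2 * X))"
  proof -
    \<comment> \<open>The terms up to \<open>n\<close>, read backwards, give \<open>2^-n X\<close>.
      The terms beyond \<open>n\<close> all contain \<open>w 0\<close> and sum to
      \<open>2^-n w 0\<close>, which is at most \<open>2^-n X\<close>.\<close>
    have "(\<Sum>k. ennreal ((1/2) ^ k) * w (n - k)) =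
        (\<Sum>k<Suc n. ennreal ((1/2) ^ k) * w (n - k)) + (\<Sum>k. ennreal ((1/2) ^ (k + Suc n)) * w (n - (k + Suc n)))"
      by (subst suminf_offset[of _ "Suc n"]) auto
    also have "(\<Sum>k<Suc n. ennreal ((1/2) ^ k) * w (n - k)) = (\<Sum>k<Suc n. ennreal ((1/2) ^ (n - k)) * w k)"
      by (subst sum.nat_diff_reindex[symmetric]) (auto intro!: sum.cong)
    also have "\<dots> = ennreal ((1/2) ^ n) * X"
      unfolding X_def sum_distrib_left lessThan_Suc_atMost
    proof (rule sum.cong)
      fix k assume "k \<in> {..n}"
      then have "(1/2::real) ^ (n - k) = (1/2) ^ n * 2 ^ k"
        by (simp add: power_diff power_one_over field_simps)
      then show "ennreal ((1/2) ^ (n - k)) * w k = ennreal ((1/2) ^ n) * (ennreal (2 ^ k) * w k)"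
        by (simp add: ennreal_mult mult.assoc)
    qed simp
    also have "(\<Sum>k. ennreal ((1/2) ^ (k + Suc n)) * w (n - (k + Suc n))) = (\<Sum>k. ennreal ((1/2) ^ Suc n) * (ennreal ((1/2) ^ k) * w 0))"
    proof (intro suminf_cong)
      fix k
      have "ennreal ((1/2) ^ (k + Suc n)) = ennreal ((1/2) ^ Suc n) * ennreal ((1/2) ^ k)"
        by (subst ennreal_mult[symmetric]) (auto simp: power_add mult.commute)
      then show "ennreal ((1/2) ^ (k + Suc n)) * w (n - (k + Suc n)) = ennreal ((1/2) ^ Suc n) * (ennreal ((1/2) ^ k) * w 0)"
        by (simp only: mult.assoc) simp
    qed
    also have "\<dots> = ennreal ((1/2) ^ Suc n) * (2 * w 0)"
      by (simp only: ennreal_suminf_cmult ennreal_suminf_multc suminf_half_ennreal)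
    also have "\<dots> = ennreal ((1/2) ^ n) * w 0"
    proof -
      have "ennreal ((1/2) ^ Suc n) * 2 = ennreal ((1/2) ^ n)"
        using ennreal_mult[of "(1/2) ^ Suc n" 2] by simp
      then show ?thesis by (simp only: mult.assoc[symmetric])
    qed
    also have "w 0 \<le> X"
    proof -
      have "ennreal (2 ^ 0) * w 0 \<le> X" unfolding X_def by (rule member_le_sum) auto
      then show ?thesis by simp
    qed
    finally have "(\<Sum>k. ennreal ((1/2) ^ k) * w (n - k)) \<le> ennreal ((1/2) ^ n) * (2 * X)"
      by (simp add: mult_2 distrib_left mult_left_mono)
    then show ?thesis unfolding ennreal_suminf_cmult by (intro mult_left_mono) auto
  qed
  finally have "(\<integral>\<^sup>+x. osc x * ennreal (poisson (of_real r) x) \<partial>circ) \<le>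
      ennreal (16 * (1 + 1)\<^sup>2) * (8 * (ennreal ((1/2) ^ n) * (2 * X)))"
    by (simp add: mult_left_mono)
  with deviation_le_osc[OF r0 r(2)]
  have "deviation r \<le> 2 * (ennreal (16 * (1 + 1)\<^sup>2) * (8 * (ennreal ((1/2) ^ n) * (2 * X))))"
    by (meson mult_left_mono order_trans zero_le)
  also have "\<dots> = (2 * ennreal (16 * (1 + 1)\<^sup>2) * 8 * 2) * ennreal ((1/2) ^ n) * X" by (simp only: ac_simps)
  also have "2 * ennreal (16 * (1 + 1)\<^sup>2) * 8 * 2 = ennreal 2048" by simp
  also have "ennreal 2048 * ennreal ((1/2) ^ n) = ennreal (2048 * (1/2) ^ n)"
    by (rule ennreal_mult[symmetric]) auto
  also have "X = (\<Sum>k. of_bool (k \<le> n) * (ennreal (2 ^ k) * w k))"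
    unfolding X_def by (subst suminf_finite[of "{..n}"]) auto
  finally show ?thesis by (simp add: w_def)
qed

end

section \<open>Moduli of continuity bounded by means of the derivative\<close>

lemma norm_diff_le_nn_integral:
  fixes G G' :: "real \<Rightarrow> complex"
  assumes ab: "a \<le> b" and G: "\<And>u. u \<in> {a..b} \<Longrightarrow> (G has_vector_derivative G' u) (at u within {a..b})"
    and cont: "continuous_on {a..b} G'"
  shows "ennreal (cmod (G b - G a)) \<le> (\<integral>\<^sup>+u\<in>{a..b}. ennreal (cmod (G' u)) \<partial>lborel)"
proof -
  have int: "(G' has_integral (G b - G a)) {a..b}"
    by (rule fundamental_theorem_of_calculus[OF ab G])
  have n: "((\<lambda>u. cmod (G' u)) has_integral integral {a..b} (\<lambda>u. cmod (G' u))) {a..b}"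
    by (intro integrable_integral integrable_continuous_interval continuous_intros cont)
  have "cmod (G b - G a) \<le> integral {a..b} (\<lambda>u. cmod (G' u))"
    using integral_norm_bound_integral[OF has_integral_integrable[OF int] has_integral_integrable[OF n]] int
    by (simp add: integral_unique)
  also have "ennreal \<dots> = (\<integral>\<^sup>+u. indicator {a..b} u * cmod (G' u) \<partial>lborel)"
    by (rule nn_integral_has_integral_lebesgue[OF _ n, symmetric]) simp
  also have "\<dots> = (\<integral>\<^sup>+u\<in>{a..b}. ennreal (cmod (G' u)) \<partial>lborel)"
    by (intro nn_integral_cong) (auto split: split_indicator)
  finally show ?thesis by (simp add: ennreal_leI)
qed

context hardy_boundary
begin

lemma f_has_derivative: "cmod z < 1 \<Longrightarrow> (f has_field_derivative deriv f z) (at z)"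
  using hol by (intro holomorphic_derivI) auto

lemma continuous_on_deriv:
  "continuous_on S g \<Longrightarrow> (\<And>x. x \<in> S \<Longrightarrow> cmod (g x) < 1) \<Longrightarrow> continuous_on S (\<lambda>x. deriv f (g x))"
  by (rule continuous_on_compose2[OF holomorphic_on_imp_continuous_on[OF deriv_hol]]) auto

text \<open>The derivative is integrated along the radius up to \<open>R n\<close>, and then
  \<open>n\<close> tends to infinity at the points where the nontangential limit exists.\<close>

lemma radial_deviation_le:
  assumes r: "0 \<le> r" "r < 1"
  shows "Lpn circ p (\<lambda>x. ennreal (cmod (\<psi> x - f (of_real r * cis x)))) \<le>
    (\<integral>\<^sup>+u\<in>{r..<1}. circ_norm p (deriv f) u \<partial>lborel)"
proof -
  define D where "D u x = ennreal (cmod (deriv f (of_real u * cis x))) * indicator {r..<1} u" for u x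
  \<comment> \<open>Joint measurability in \<open>(u, x)\<close> follows from continuity on the
    strip \<open>r \<le> u < 1\<close>, outside which the integrand is cut to 0.\<close>
  have "(\<lambda>z. indicator ({r..<1} \<times> UNIV) z *\<^sub>R deriv f (of_real (fst z) * cis (snd z))) \<in> borel_measurable (borel :: (real \<times> real) measure)"
    using r by (intro borel_measurable_continuous_on_indicator continuous_on_deriv continuous_intros borel_Times)
      (auto simp: norm_mult)
  then have m: "(\<lambda>z. ennreal (cmod (indicator ({r..<1} \<times> UNIV) z *\<^sub>R deriv f (of_real (fst z) * cis (snd z))))) \<in> borel_measurable (borel \<Otimes>\<^sub>M borel)"
    unfolding borel_prod by measurable
  have e: "(\<lambda>z. ennreal (cmod (indicator ({r..<1} \<times> UNIV) z *\<^sub>R deriv f (of_real (fst z) * cis (snd z))))) = (\<lambda>(u, x). D u x)"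
    by (auto simp: fun_eq_iff D_def split: split_indicator)
  have s: "sets (lborel \<Otimes>\<^sub>M circ) = sets (borel \<Otimes>\<^sub>M (borel :: real measure))"
    by (intro sets_pair_measure_cong) auto
  have [measurable]: "(\<lambda>(u, x). D u x) \<in> borel_measurable (lborel \<Otimes>\<^sub>M circ)"
    using m unfolding e measurable_cong_sets[OF s refl] .
  have "Lpn circ p (\<lambda>x. ennreal (cmod (\<psi> x - f (of_real r * cis x)))) \<le> Lpn circ p (\<lambda>x. \<integral>\<^sup>+u. D u x \<partial>lborel)"
  proof (rule Lpn_mono_AE[OF p_pos(1)])
    show "AE x in circ. ennreal (cmod (\<psi> x - f (of_real r * cis x))) \<le> (\<integral>\<^sup>+u. D u x \<partial>lborel)"
      using AE_circ[OF nontangential_AE]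
    proof eventually_elim
      case (elim x)
      have "(\<lambda>n. f (of_real (R n) * cis x)) \<longlonglongrightarrow> \<psi> x"
        by (rule nontangential_limit_radial[OF elim]) (use R in auto)
      then have lim: "(\<lambda>n. ennreal (cmod (f (of_real (R n) * cis x) - f (of_real r * cis x)))) \<longlonglongrightarrow> ennreal (cmod (\<psi> x - f (of_real r * cis x)))"
        by (intro tendsto_ennrealI tendsto_intros)
      have "\<forall>\<^sub>F n in sequentially. r < R n" using order_tendstoD(1)[OF R(3)] r by auto
      then obtain N where N: "\<And>n. N \<le> n \<Longrightarrow> r < R n" by (auto simp: eventually_sequentially)
      have "ennreal (cmod (f (of_real (R n) * cis x) - f (of_real r * cis x))) \<le> (\<integral>\<^sup>+u. D u x \<partial>lborel)" if n: "N \<le> n" for n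
      proof -
        have "ennreal (cmod (f (of_real (R n) * cis x) - f (of_real r * cis x))) \<le>
          (\<integral>\<^sup>+u\<in>{r..R n}. ennreal (cmod (deriv f (of_real u * cis x) * cis x)) \<partial>lborel)"
        proof (rule norm_diff_le_nn_integral)
          show "r \<le> R n" using N[OF n] by simp
          have u1: "cmod (of_real u * cis x) < 1" if "u \<in> {r..R n}" for u
            using that r R(2)[of n] by (simp add: norm_mult)
          show "continuous_on {r..R n} (\<lambda>u. deriv f (of_real u * cis x) * cis x)"
            by (intro continuous_intros continuous_on_deriv u1)
          fix u assume u: "u \<in> {r..R n}"
          have "((\<lambda>u. of_real u * cis x) has_vector_derivative cis x) (at u within {r..R n})"
            by (auto intro!: derivative_eq_intros simp: has_vector_derivative_def scaleR_conv_of_real)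
          from field_vector_diff_chain_within[OF this has_field_derivative_at_within[OF f_has_derivative[OF u1[OF u]]]]
          show "((\<lambda>u. f (of_real u * cis x)) has_vector_derivative deriv f (of_real u * cis x) * cis x) (at u within {r..R n})"
            by (simp only: o_def mult.commute[of "deriv f (of_real u * cis x)" "cis x"])
        qed
        also have "\<dots> \<le> (\<integral>\<^sup>+u. D u x \<partial>lborel)"
          unfolding D_def using R(2)[of n] by (intro nn_integral_mono) (auto split: split_indicator simp: norm_mult)
        finally show ?thesis .
      qed
      then show ?case by (intro LIMSEQ_le_const2[OF lim]) blast
    qed
  qed
  also have "\<dots> \<le> (\<integral>\<^sup>+u. Lpn circ p (D u) \<partial>lborel)"
    by (rule Lpn_nn_integral_le[OF sigma_finite_circ _ p]) (measurable, auto intro: sigma_finite_lborel)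
  also have "\<dots> = (\<integral>\<^sup>+u\<in>{r..<1}. circ_norm p (deriv f) u \<partial>lborel)"
    by (intro nn_integral_cong) (auto simp: D_def[abs_def] circ_norm_def Lpn_const p_pos split: split_indicator)
  finally show ?thesis .
qed

lemma angular_deviation_le:
  assumes r: "0 \<le> r" "r < 1" and h: "0 \<le> h"
  shows "Lpn circ p (\<lambda>x. ennreal (cmod (f (of_real r * cis (x + h)) - f (of_real r * cis x)))) \<le> ennreal h * circ_norm p (deriv f) r"
proof -
  note [measurable] = holomorphic_radius_measurable[OF deriv_hol r]
  have r1: "cmod (of_real r * cis x) < 1" for x using r by (simp add: norm_mult)
  have "Lpn circ p (\<lambda>x. ennreal (cmod (f (of_real r * cis (x + h)) - f (of_real r * cis x)))) \<le>
      Lpn circ p (\<lambda>x. \<integral>\<^sup>+y. ennreal (cmod (deriv f (of_real r * cis (x + y)))) * indicator {0..h} y \<partial>lborel)"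
  proof (rule Lpn_mono[OF p_pos(1)])
    fix x
    have "ennreal (cmod (f (of_real r * cis (x + h)) - f (of_real r * cis (x + 0)))) \<le>
      (\<integral>\<^sup>+y\<in>{0..h}. ennreal (cmod (deriv f (of_real r * cis (x + y)) * (of_real r * (\<i> * cis (x + y))))) \<partial>lborel)"
    proof (rule norm_diff_le_nn_integral[OF h])
      show "continuous_on {0..h} (\<lambda>y. deriv f (of_real r * cis (x + y)) * (of_real r * (\<i> * cis (x + y))))"
        by (intro continuous_intros continuous_on_deriv r1)
      fix y
      have "((\<lambda>y. of_real r * cis (x + y)) has_vector_derivative of_real r * (\<i> * cis (x + y))) (at y within {0..h})"
      proof -
        have "((\<lambda>w. of_real r * exp (\<i> * (of_real x + w))) has_field_derivative
            of_real r * (\<i> * exp (\<i> * (of_real x + of_real y)))) (at (of_real y))"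
          by (auto intro!: derivative_eq_intros)
        from has_vector_derivative_real_field[OF this] show ?thesis by (simp add: cis_conv_exp)
      qed
      from field_vector_diff_chain_within[OF this has_field_derivative_at_within[OF f_has_derivative[OF r1[of "x + y"]]]]
      show "((\<lambda>y. f (of_real r * cis (x + y))) has_vector_derivative deriv f (of_real r * cis (x + y)) * (of_real r * (\<i> * cis (x + y)))) (at y within {0..h})"
        by (simp only: o_def mult.commute[of "deriv f (of_real r * cis (x + y))"])
    qed
    also have "\<dots> \<le> (\<integral>\<^sup>+y. ennreal (cmod (deriv f (of_real r * cis (x + y)))) * indicator {0..h} y \<partial>lborel)"
      using r by (intro nn_integral_mono mult_right_mono ennreal_leI) (auto simp: norm_mult mult_left_le)
    finally show "ennreal (cmod (f (of_real r * cis (x + h)) - f (of_real r * cis x))) \<le>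
      (\<integral>\<^sup>+y. ennreal (cmod (deriv f (of_real r * cis (x + y)))) * indicator {0..h} y \<partial>lborel)" by simp
  qed
  also have "\<dots> \<le> (\<integral>\<^sup>+y. Lpn circ p (\<lambda>x. ennreal (cmod (deriv f (of_real r * cis (x + y)))) * indicator {0..h} y) \<partial>lborel)"
    by (rule Lpn_nn_integral_le[OF sigma_finite_circ sigma_finite_lborel p]) measurable
  also have "\<dots> = (\<integral>\<^sup>+y. circ_norm p (deriv f) r * indicator {0..h} y \<partial>lborel)"
  proof (intro nn_integral_cong)
    fix y
    have "Lpn circ p (\<lambda>x. ennreal (cmod (deriv f (of_real r * cis (x + y))))) = circ_norm p (deriv f) r"
      unfolding circ_norm_def
      by (rule Lpn_circ_shift[where F="\<lambda>x. ennreal (cmod (deriv f (of_real r * cis x)))"]) (auto simp: cis_periodic)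
    then show "Lpn circ p (\<lambda>x. ennreal (cmod (deriv f (of_real r * cis (x + y)))) * indicator {0..h} y) = circ_norm p (deriv f) r * indicator {0..h} y"
      by (auto simp: Lpn_const p_pos split: split_indicator)
  qed
  also have "\<dots> = ennreal h * circ_norm p (deriv f) r"
    using h by (subst nn_integral_cmult_indicator) (auto simp: mult.commute)
  finally show ?thesis .
qed

text \<open>The two boundary points are joined by a path: radially inwards to radius
  \<open>r\<close>, along the arc of angle \<open>h\<close>, and radially outwards. The two radial
  parts have the same norm by rotation.\<close>

lemma osc_le_deriv:
  assumes r: "0 \<le> r" "r < 1" and h: "0 \<le> h"
  shows "osc h \<le> 2 * (\<integral>\<^sup>+u\<in>{r..<1}. circ_norm p (deriv f) u \<partial>lborel) + ennreal h * circ_norm p (deriv f) r"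
proof -
  note [measurable] = borel_f[OF r]
  let ?u = "\<lambda>x. f (of_real r * cis x)"
  let ?A = "\<lambda>x. ennreal (cmod (\<psi> x - ?u x))" and ?B = "\<lambda>x. ennreal (cmod (?u (x + h) - ?u x))"
  have "osc h \<le> Lpn circ p (\<lambda>x. ?A (x + h) + (?B x + ?A x))"
    unfolding osc_def
  proof (rule Lpn_mono[OF p_pos(1)])
    fix x
    have "cmod (\<psi> (x + h) - \<psi> x) \<le> cmod (\<psi> (x + h) - ?u (x + h)) + (cmod (?u (x + h) - ?u x) + cmod (\<psi> x - ?u x))"
      using norm_triangle_ineq4[of "\<psi> (x + h) - ?u (x + h) + (?u (x + h) - ?u x)" "\<psi> x - ?u x"]
        norm_triangle_ineq[of "\<psi> (x + h) - ?u (x + h)" "?u (x + h) - ?u x"] by simp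
    then show "ennreal (cmod (\<psi> (x + h) - \<psi> x)) \<le> ?A (x + h) + (?B x + ?A x)"
      by (simp flip: ennreal_plus add: ennreal_leI)
  qed
  also have "\<dots> \<le> Lpn circ p (\<lambda>x. ?A (x + h)) + Lpn circ p (\<lambda>x. ?B x + ?A x)"
    by (rule Lpn_add_le[OF sigma_finite_circ p]) measurable
  also have "\<dots> \<le> Lpn circ p (\<lambda>x. ?A (x + h)) + (Lpn circ p ?B + Lpn circ p ?A)"
    by (intro add_left_mono Lpn_add_le[OF sigma_finite_circ p]) measurable
  also have "Lpn circ p (\<lambda>x. ?A (x + h)) = Lpn circ p ?A"
    by (rule Lpn_circ_shift) (auto simp: psi_periodic cis_periodic)
  also have "Lpn circ p ?A + (Lpn circ p ?B + Lpn circ p ?A) = 2 * Lpn circ p ?A + Lpn circ p ?B"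
    by (simp add: mult_2 ac_simps)
  also have "\<dots> \<le> 2 * (\<integral>\<^sup>+u\<in>{r..<1}. circ_norm p (deriv f) u \<partial>lborel) + ennreal h * circ_norm p (deriv f) r"
    by (intro add_mono mult_left_mono radial_deviation_le angular_deviation_le r h) auto
  finally show ?thesis .
qed

end

section \<open>Dyadic intervals in [0, 1)\<close>

definition dyadic :: "nat \<Rightarrow> real set" where
  "dyadic n = {1 - (1/2) ^ n..<1 - (1/2) ^ Suc n}"

lemma dyadic_sets [measurable, simp]: "dyadic n \<in> sets borel"
  by (simp add: dyadic_def)

lemma UN_dyadic: "(\<Union>k. dyadic (n + k)) = {1 - (1/2) ^ n..<1}"
proof safe
  fix x k assume "x \<in> dyadic (n + k)"
  moreover have "(1/2::real) ^ (n + k) \<le> (1/2) ^ n" by (rule power_decreasing) auto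
  moreover have "0 < (1/2::real) ^ Suc (n + k)" by simp
  ultimately show "x \<in> {1 - (1/2) ^ n..<1}" unfolding dyadic_def atLeastLessThan_iff by linarith
next
  fix x :: real assume x: "x \<in> {1 - (1/2) ^ n..<1}"
  obtain j where j: "(1/2) ^ j < 1 - x" using real_arch_pow_inv[of "1 - x" "1/2"] x by auto
  define k where "k = (LEAST j. (1/2) ^ j < 1 - x)"
  have k: "(1/2) ^ k < 1 - x" unfolding k_def by (rule LeastI) (rule j)
  have nk: "n < k"
  proof (rule ccontr)
    assume "\<not> n < k"
    then have "(1/2::real) ^ n \<le> (1/2) ^ k" by (intro power_decreasing) auto
    moreover have "1 - (1/2) ^ n \<le> x" using x by simp
    ultimately show False using k by linarith
  qed
  then have "\<not> (1/2) ^ (k - 1) < 1 - x" unfolding k_def by (intro not_less_Least) simp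
  then have "x \<in> dyadic (k - 1)" using k nk by (auto simp: dyadic_def)
  moreover have "k - 1 = n + (k - 1 - n)" using nk by simp
  ultimately show "x \<in> (\<Union>k. dyadic (n + k))" by (metis UN_I UNIV_I)
qed

lemma disjoint_dyadic: "disjoint_family (\<lambda>k. dyadic (n + k))"
proof -
  have "dyadic i \<inter> dyadic j = {}" if "i < j" for i j
  proof -
    have "(1/2::real) ^ j \<le> (1/2) ^ Suc i" using that by (intro power_decreasing) auto
    then show ?thesis by (auto simp: dyadic_def)
  qed
  then show ?thesis
    unfolding disjoint_family_on_def by (metis Int_commute add_left_cancel linorder_neqE_nat)
qed

lemma lower_integral_dyadic:
  assumes "\<And>k. dyadic k \<in> sets M"
  shows "(\<integral>\<^sup>+x\<in>{1 - (1/2) ^ n..<1}. f x \<partial>M) = (\<Sum>k. \<integral>\<^sup>+x\<in>dyadic (n + k). f x \<partial>M)"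
  unfolding UN_dyadic[symmetric] by (rule lower_integral_UN[OF disjoint_dyadic assms])

text \<open>The path estimate is used with \<open>r = 1 - 2^-n\<close>. On each dyadic interval the
  increasing mean is replaced by its value at the right end, whence \<open>Suc k\<close>; the length
  \<open>2^-k / 2\<close> absorbs the factor 2 of the radial parts. The arc costs no more than the
  first term of the series.\<close>

lemma (in hardy_boundary) modulus_le_deriv:
  "modulus ((1/2) ^ n) \<le>
    2 * (\<Sum>k. of_bool (n \<le> k) * (ennreal ((1/2) ^ k) * circ_norm p (deriv f) (1 - (1/2) ^ Suc k)))"
proof -
  define N where "N = circ_norm p (deriv f)"
  define r where "r = 1 - (1/2::real) ^ n"
  have r: "0 \<le> r" "r < 1" by (auto simp: r_def power_le_one)
  define X where "X = (\<Sum>k. of_bool (n \<le> k) * (ennreal ((1/2) ^ k) * N (1 - (1/2) ^ Suc k)))"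
  have N_mono: "N u \<le> N v" if "0 \<le> u" "u \<le> v" "v < 1" for u v
    unfolding N_def by (rule circ_norm_mono[OF deriv_hol p that])
  have X_eq: "X = (\<Sum>k. ennreal ((1/2) ^ (n + k)) * N (1 - (1/2) ^ Suc (n + k)))"
    unfolding X_def by (subst suminf_offset[of _ n]) (auto simp: add.commute)
  have 1: "2 * (\<integral>\<^sup>+u\<in>{r..<1}. N u \<partial>lborel) \<le> X"
  proof -
    have "(\<integral>\<^sup>+u\<in>{r..<1}. N u \<partial>lborel) = (\<Sum>k. \<integral>\<^sup>+u\<in>dyadic (n + k). N u \<partial>lborel)"
      unfolding r_def by (rule lower_integral_dyadic) simp
    also have "\<dots> \<le> (\<Sum>k. ennreal (1/2) * (ennreal ((1/2) ^ (n + k)) * N (1 - (1/2) ^ Suc (n + k))))"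
    proof (intro suminf_le)
      fix k
      have "(\<integral>\<^sup>+u\<in>dyadic (n + k). N u \<partial>lborel) \<le> (\<integral>\<^sup>+u. N (1 - (1/2) ^ Suc (n + k)) * indicator (dyadic (n + k)) u \<partial>lborel)"
      proof (rule nn_integral_mono)
        fix u
        have "N u \<le> N (1 - (1/2) ^ Suc (n + k))" if u: "u \<in> dyadic (n + k)"
        proof (rule N_mono)
          have "(1/2::real) ^ (n + k) \<le> 1" by (rule power_le_one) auto
          then show "0 \<le> u" using u by (auto simp: dyadic_def)
        qed (use u in \<open>auto simp: dyadic_def\<close>)
        then show "N u * indicator (dyadic (n + k)) u \<le> N (1 - (1/2) ^ Suc (n + k)) * indicator (dyadic (n + k)) u"
          by (auto split: split_indicator)
      qed
      also have "\<dots> = N (1 - (1/2) ^ Suc (n + k)) * ennreal ((1/2) ^ (n + k) / 2)"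
        by (simp add: nn_integral_cmult_indicator) (simp add: dyadic_def)
      also have "ennreal ((1/2) ^ (n + k) / 2) = ennreal (1/2) * ennreal ((1/2) ^ (n + k))"
        by (subst ennreal_mult[symmetric]) auto
      finally show "(\<integral>\<^sup>+u\<in>dyadic (n + k). N u \<partial>lborel) \<le> ennreal (1/2) * (ennreal ((1/2) ^ (n + k)) * N (1 - (1/2) ^ Suc (n + k)))"
        by (simp only: ac_simps)
    qed auto
    also have "\<dots> = ennreal (1/2) * X" unfolding X_eq by (rule ennreal_suminf_cmult)
    finally have "2 * (\<integral>\<^sup>+u\<in>{r..<1}. N u \<partial>lborel) \<le> 2 * (ennreal (1/2) * X)" by (rule mult_left_mono) simp
    also have "\<dots> = X" using ennreal_mult[of 2 "1/2"] by (simp add: mult.assoc[symmetric])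
    finally show ?thesis .
  qed
  have 2: "ennreal h * N r \<le> X" if "h < (1/2) ^ n" for h
  proof -
    have "ennreal h * N r \<le> ennreal ((1/2) ^ n) * N (1 - (1/2) ^ Suc n)"
      using that r by (intro mult_mono ennreal_leI N_mono) (auto simp: r_def)
    also have "\<dots> \<le> X"
      unfolding X_eq using ennreal_le_suminf[of "\<lambda>k. ennreal ((1/2) ^ (n + k)) * N (1 - (1/2) ^ Suc (n + k))" 0] by simp
    finally show ?thesis .
  qed
  have "osc h \<le> X + X" if "0 < h" "h < (1/2) ^ n" for h
  proof -
    have "osc h \<le> 2 * (\<integral>\<^sup>+u\<in>{r..<1}. N u \<partial>lborel) + ennreal h * N r"
      unfolding N_def using that by (intro osc_le_deriv r) simp
    also have "\<dots> \<le> X + X" using 1 2[OF that(2)] by (rule add_mono)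
    finally show ?thesis .
  qed
  then show ?thesis
    unfolding modulus_def X_def[unfolded N_def, symmetric] mult_2 by (intro SUP_least) (simp add: greaterThanLessThan_iff)
qed

section \<open>Dyadic decomposition of the weight\<close>

lemma dyadic_bounds:
  assumes "s \<in> dyadic n"
  shows "0 \<le> s" "s < 1" "1 - (1/2) ^ n \<le> s" "1 - s \<le> (1/2) ^ n" "(1/2) ^ Suc n < 1 - s"
proof -
  have "(1/2::real) ^ n \<le> 1" by (rule power_le_one) auto
  moreover have "0 < (1/2::real) ^ Suc n" by simp
  moreover have s: "1 - (1/2) ^ n \<le> s" "s < 1 - (1/2) ^ Suc n" using assms by (auto simp only: dyadic_def atLeastLessThan_iff)
  ultimately show "0 \<le> s" "s < 1" "1 - (1/2) ^ n \<le> s" "1 - s \<le> (1/2) ^ n" "(1/2) ^ Suc n < 1 - s" by linarith+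
qed

lemma dyadic_inverse_powr:
  assumes s: "s \<in> dyadic n" and q: "0 < q"
  shows "(2 ^ n) powr q \<le> 1 / (1 - s) powr q" "1 / (1 - s) powr q \<le> 2 powr q * (2 ^ n) powr q"
proof -
  note b = dyadic_bounds[OF s]
  have pos: "0 < (1 - s) powr q" using b by simp
  have "(1 - s) powr q \<le> ((1/2) ^ n) powr q" using b q by (intro powr_mono2) auto
  moreover have "((1/2) ^ n) powr q = 1 / (2 ^ n) powr q" by (simp add: power_one_over powr_divide)
  ultimately have "1 / (1 / (2 ^ n) powr q) \<le> 1 / (1 - s) powr q" using pos by (intro frac_le) auto
  then show "(2 ^ n) powr q \<le> 1 / (1 - s) powr q" by simp
  have "((1/2) ^ Suc n) powr q \<le> (1 - s) powr q" using b q by (intro powr_mono2) auto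
  moreover have "((1/2) ^ Suc n) powr q = 1 / (2 powr q * (2 ^ n) powr q)"
    by (simp add: power_one_over powr_divide powr_mult)
  ultimately have "1 / (1 - s) powr q \<le> 1 / (1 / (2 powr q * (2 ^ n) powr q))" by (intro frac_le) auto
  then show "1 / (1 - s) powr q \<le> 2 powr q * (2 ^ n) powr q" by simp
qed

text \<open>A factor leaves a lower integral with the inequality in this direction only when it is
  finite. This is where finiteness of the moduli, and so \<open>f\<close> being in the Hardy space,
  is used.\<close>

lemma lower_integral_dyadic_le:
  assumes G: "\<And>n s. s \<in> dyadic n \<Longrightarrow> G s \<le> c n * v s" and c: "\<And>n. c n < top"
  shows "(\<integral>\<^sup>+s\<in>{0..<1}. G s \<partial>lebesgue) \<le> (\<Sum>n. c n * (\<integral>\<^sup>+s\<in>dyadic n. v s \<partial>lebesgue))"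
proof -
  have "(\<integral>\<^sup>+s\<in>{0..<1}. G s \<partial>lebesgue) = (\<Sum>n. \<integral>\<^sup>+s\<in>dyadic n. G s \<partial>lebesgue)"
    using lower_integral_dyadic[where M=lebesgue and n=0 and f=G] by simp
  also have "\<dots> \<le> (\<Sum>n. \<integral>\<^sup>+s. c n * (v s * indicator (dyadic n) s) \<partial>lebesgue)"
    using G by (intro suminf_le nn_integral_mono) (auto split: split_indicator)
  also have "\<dots> = (\<Sum>n. c n * (\<integral>\<^sup>+s\<in>dyadic n. v s \<partial>lebesgue))"
    by (simp add: lower_integral_cmult[OF c])
  finally show ?thesis .
qed

lemma lower_integral_dyadic_ge:
  assumes G: "\<And>n s. s \<in> dyadic n \<Longrightarrow> c n * v s \<le> G s"
  shows "(\<Sum>n. c n * (\<integral>\<^sup>+s\<in>dyadic n. v s \<partial>lebesgue)) \<le> (\<integral>\<^sup>+s\<in>{0..<1}. G s \<partial>lebesgue)"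
proof -
  have "(\<Sum>n. c n * (\<integral>\<^sup>+s\<in>dyadic n. v s \<partial>lebesgue)) \<le> (\<Sum>n. \<integral>\<^sup>+s. c n * (v s * indicator (dyadic n) s) \<partial>lebesgue)"
    by (intro suminf_le lower_integral_cmult_ge) auto
  also have "\<dots> \<le> (\<Sum>n. \<integral>\<^sup>+s\<in>dyadic n. G s \<partial>lebesgue)"
    using G by (intro suminf_le nn_integral_mono) (auto split: split_indicator)
  also have "\<dots> = (\<integral>\<^sup>+s\<in>{0..<1}. G s \<partial>lebesgue)"
    using lower_integral_dyadic[where M=lebesgue and n=0 and f=G] by simp
  finally show ?thesis .
qed

definition block :: "(complex \<Rightarrow> real) \<Rightarrow> nat \<Rightarrow> ennreal" where
  "block \<nu> n = (\<integral>\<^sup>+s\<in>dyadic n. ennreal (\<nu> (of_real s)) \<partial>lebesgue)"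

lemma tail_eq_sum_block: "tail \<nu> (1 - (1/2) ^ n) = (\<Sum>k. block \<nu> (n + k))"
  unfolding tail_def block_def by (rule lower_integral_dyadic) simp

lemma tail_antimono: "r \<le> s \<Longrightarrow> tail \<nu> s \<le> tail \<nu> r"
  unfolding tail_def by (intro nn_integral_mono) (auto split: split_indicator)

text \<open>The doubling condition at \<open>1 - 2^-n\<close> is one dyadic step, and the
  \<open>K\<close> of the reverse condition is rounded up to \<open>2 ^ M\<close>. Doubling carries
  an infinite tail at 0 to every later index, which gives the dichotomy required by
  \<open>dyadic_weight\<close>.\<close>

lemma dyadic_weight_exists:
  assumes "\<nu> \<in> D_class"
  obtains c0 M D where "dyadic_weight (block \<nu>) (\<lambda>n. tail \<nu> (1 - (1/2) ^ n)) c0 M" "0 \<le> D"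
    "\<And>n. tail \<nu> (1 - (1/2) ^ n) \<le> ennreal D * tail \<nu> (1 - (1/2) ^ Suc n)"
proof -
  let ?T = "\<lambda>n. tail \<nu> (1 - (1/2) ^ n)"
  obtain D where D: "D > 0" "\<And>r. r \<in> {0..<1} \<Longrightarrow> tail \<nu> r \<le> ennreal D * tail \<nu> ((1 + r) / 2)"
    using assms by (auto simp: D_class_def D_hat_def)
  obtain K C where K: "K > 1" "C > 1" "\<And>r. r \<in> {0..<1} \<Longrightarrow> ennreal C * tail \<nu> (1 - (1 - r) / K) \<le> tail \<nu> r"
    using assms by (auto simp: D_class_def D_check_def)
  have r: "1 - (1/2::real) ^ n \<in> {0..<1}" for n by (simp add: power_le_one)
  have doubling: "?T n \<le> ennreal D * ?T (Suc n)" for n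
    using D(2)[OF r[of n]] by (simp add: field_simps)
  obtain M where M: "K < 2 ^ M" using real_arch_pow[of 2 K] by auto
  have "dyadic_weight (block \<nu>) ?T C M"
  proof
    show "?T n = (\<Sum>k. block \<nu> (n + k))" for n by (rule tail_eq_sum_block)
    show "ennreal C * ?T (n + M) \<le> ?T n" for n
    proof -
      have "(1/2::real) ^ (n + M) \<le> (1/2) ^ n / K"
        using M K by (simp add: power_add power_one_over field_simps)
      then have "?T (n + M) \<le> tail \<nu> (1 - (1 - (1 - (1/2) ^ n)) / K)" by (intro tail_antimono) simp
      then have "ennreal C * ?T (n + M) \<le> ennreal C * tail \<nu> (1 - (1 - (1 - (1/2) ^ n)) / K)" by (rule mult_left_mono) simp
      also have "\<dots> \<le> ?T n" by (rule K(3)[OF r])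
      finally show ?thesis .
    qed
    show "(\<forall>n. ?T n < top) \<or> (\<forall>n. ?T n = top)"
    proof (cases "?T 0 = top")
      case True
      have "?T n = top" for n
      proof (induction n)
        case (Suc n)
        then show ?case using doubling[of n] by (auto simp: top_unique ennreal_mult_eq_top_iff)
      qed (use True in simp)
      then show ?thesis by blast
    next
      case False
      have "?T n \<le> ?T 0" for n by (rule tail_antimono) (simp add: power_le_one)
      then have "?T n < top" for n using False by (metis less_top le_less_trans)
      then show ?thesis by blast
    qed
  qed (rule K)
  then show ?thesis using that[of C M D] D(1) doubling by simp
qed

lemma weight_nonneg:
  assumes \<nu>: "\<nu> \<in> D_hat_sub q" and s: "0 \<le> s" "s < 1"
  shows "0 \<le> \<nu> (of_real s)"
proof -
  have "\<forall>z\<in>ball 0 1. 0 \<le> \<nu> z \<and> \<nu> z = \<nu> (of_real (cmod z))"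
    using \<nu> unfolding D_hat_sub_def D_hat_def weights_def radial_weight_def by blast
  moreover have "complex_of_real s \<in> ball 0 1" using s by simp
  ultimately show ?thesis by blast
qed

text \<open>The defining supremum is evaluated at \<open>r = 1 - 2^-k\<close>, where
  \<open>[0, r]\<close> contains the blocks \<open>n < k\<close>, on which
  \<open>2^n \<le> 1 / (1 - s)\<close>. Finite positive tails allow the division to be
  cleared.\<close>

lemma D_hat_sub_dyadic:
  assumes \<nu>: "\<nu> \<in> D_hat_sub q" and q: "0 < q" and fin: "\<And>n. tail \<nu> (1 - (1/2) ^ n) < top"
  obtains E where "0 \<le> E"
    "\<And>k. (\<Sum>n<k. ennreal ((2 ^ n) powr q) * block \<nu> n) \<le> ennreal E * (ennreal ((2 ^ k) powr q) * tail \<nu> (1 - (1/2) ^ k))"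
proof -
  let ?T = "\<lambda>n. tail \<nu> (1 - (1/2) ^ n)"
  define S where "S = (SUP r\<in>{0..<1}. ennreal ((1 - r) powr q) / tail \<nu> r *
        (\<integral>\<^sup>+s\<in>{0..r}. ennreal (\<nu> (of_real s) / (1 - s) powr q) \<partial>lebesgue))"
  have "S < top" using \<nu> by (simp add: D_hat_sub_def S_def)
  then obtain E where E: "S = ennreal E" "0 \<le> E" by (cases S) auto
  note \<nu>_nn = weight_nonneg[OF \<nu>]
  have pos: "0 < ?T n" for n
    using \<nu> by (auto simp: D_hat_sub_def D_hat_def weights_def power_le_one)
  show ?thesis
  proof (rule that[OF E(2)])
    fix k
    define r where "r = 1 - (1/2::real) ^ k"
    have r: "r \<in> {0..<1}" by (simp add: r_def power_le_one)
    have "(\<Sum>n<k. ennreal ((2 ^ n) powr q) * block \<nu> n) = (\<Sum>n. (of_bool (n < k) * ennreal ((2 ^ n) powr q)) * block \<nu> n)"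
      by (subst suminf_finite[of "{..<k}"]) auto
    also have "\<dots> \<le> (\<integral>\<^sup>+s\<in>{0..<1}. ennreal (\<nu> (of_real s) / (1 - s) powr q) * indicator {0..r} s \<partial>lebesgue)"
      unfolding block_def
    proof (rule lower_integral_dyadic_ge)
      fix n s assume s: "s \<in> dyadic n"
      note b = dyadic_bounds[OF s]
      show "of_bool (n < k) * ennreal ((2 ^ n) powr q) * ennreal (\<nu> (of_real s)) \<le>
        ennreal (\<nu> (of_real s) / (1 - s) powr q) * indicator {0..r} s"
      proof (cases "n < k")
        case True
        then have "(1/2::real) ^ k \<le> (1/2) ^ Suc n" by (intro power_decreasing) auto
        then have "s \<le> 1 - (1/2) ^ k" using b by linarith
        then have "s \<in> {0..r}" using b by (simp add: r_def)
        moreover have "(2 ^ n) powr q * \<nu> (of_real s) \<le> 1 / (1 - s) powr q * \<nu> (of_real s)"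
          using dyadic_inverse_powr(1)[OF s q] \<nu>_nn[OF b(1,2)] by (intro mult_right_mono)
        ultimately show ?thesis using True \<nu>_nn[OF b(1,2)] by (simp flip: ennreal_mult add: ennreal_leI)
      qed simp
    qed
    also have "\<dots> \<le> (\<integral>\<^sup>+s\<in>{0..r}. ennreal (\<nu> (of_real s) / (1 - s) powr q) \<partial>lebesgue)" (is "_ \<le> ?I")
      by (intro nn_integral_mono) (auto split: split_indicator)
    also have "?I \<le> ennreal E * (ennreal ((2 ^ k) powr q) * ?T k)"
    proof -
      have "ennreal ((1 - r) powr q) / tail \<nu> r * ?I \<le> ennreal E"
        unfolding E(1)[symmetric] S_def by (rule SUP_upper[OF r])
      moreover have "tail \<nu> r = ?T k" by (simp add: r_def)
      moreover obtain t where t: "?T k = ennreal t" "t > 0" using fin[of k] pos[of k] by (cases "?T k") auto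
      ultimately have le: "ennreal ((1 - r) powr q / t) * ?I \<le> ennreal E" by (simp add: divide_ennreal)
      have "((1/2) ^ k) powr q = 1 / (2 ^ k) powr q" by (simp add: power_one_over powr_divide)
      then have eq: "((2 ^ k) powr q * t) * ((1 - r) powr q / t) = 1" using t by (simp add: r_def)
      have "?I = ennreal (((2 ^ k) powr q * t) * ((1 - r) powr q / t)) * ?I" unfolding eq by simp
      also have "\<dots> = ennreal ((2 ^ k) powr q * t) * (ennreal ((1 - r) powr q / t) * ?I)"
        using t by (subst ennreal_mult) (auto simp: mult.assoc)
      also have "\<dots> \<le> ennreal ((2 ^ k) powr q * t) * ennreal E" by (rule mult_left_mono[OF le]) simp
      also have "\<dots> = ennreal E * (ennreal ((2 ^ k) powr q) * ?T k)" using t by (simp add: ennreal_mult ac_simps)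
      finally show ?thesis .
    qed
    finally show "(\<Sum>n<k. ennreal ((2 ^ n) powr q) * block \<nu> n) \<le> ennreal E * (ennreal ((2 ^ k) powr q) * ?T k)" .
  qed
qed

section \<open>Comparison of the integrals with dyadic sums\<close>

context hardy_boundary
begin

text \<open>For each shift \<open>h\<close> the two functions agree off a null set and its translate
  by \<open>h\<close>; no uniformity in \<open>h\<close> is needed, since the supremum is taken
  after integration.\<close>

lemma Lp_modulus_eq: "Lp_modulus p t f = modulus t"
proof -
  have "(\<integral>\<^sup>+\<theta>\<in>{0..2*pi}. ennreal (cmod (boundary_value f (cis (\<theta> + h)) - boundary_value f (cis \<theta>)) powr p) \<partial>lebesgue) =
      (\<integral>\<^sup>+x. ennpowr (ennreal (cmod (\<psi> (x + h) - \<psi> x))) p \<partial>circ)" for h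
  proof -
    obtain N where N: "{x. boundary_value f (cis x) \<noteq> \<psi> x} \<subseteq> N" "N \<in> null_sets lborel"
      using boundary_value_AE by (auto simp: eventually_ae_filter)
    have "AE x in lborel. x \<notin> N" using N(2) by (rule AE_not_in)
    moreover have "AE x in lborel. h + 1 * x \<notin> N"
      using N(2) calculation by (intro AE_borel_affine[where P="\<lambda>x. x \<notin> N"]) (auto simp: null_sets_def)
    ultimately have ae: "AE x in lborel. boundary_value f (cis (x + h)) = \<psi> (x + h) \<and> boundary_value f (cis x) = \<psi> x"
      by eventually_elim (use N(1) in \<open>auto simp: add.commute\<close>)
    have "(\<integral>\<^sup>+\<theta>\<in>{0..2*pi}. ennreal (cmod (boundary_value f (cis (\<theta> + h)) - boundary_value f (cis \<theta>)) powr p) \<partial>lborel) =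
      (\<integral>\<^sup>+x\<in>{0..2*pi}. ennpowr (ennreal (cmod (\<psi> (x + h) - \<psi> x))) p \<partial>lborel)"
    proof (intro nn_integral_cong_AE)
      show "AE x in lborel. ennreal (cmod (boundary_value f (cis (x + h)) - boundary_value f (cis x)) powr p) * indicator {0..2*pi} x =
        ennpowr (ennreal (cmod (\<psi> (x + h) - \<psi> x))) p * indicator {0..2*pi} x"
        using ae by eventually_elim (simp add: ennpowr_ennreal)
    qed
    then show ?thesis by (simp add: nn_integral_completion nn_integral_circ)
  qed
  then show ?thesis by (simp add: Lp_modulus_def modulus_def osc_def Lpn_def)
qed

text \<open>The boundary function is measurable for the completed measure because it agrees almost
  everywhere with the Borel function \<open>\<psi>\<close>; inside the integral it can then be
  replaced by \<open>\<psi>\<close>.\<close>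

lemma poisson_deviation_eq:
  assumes r: "0 \<le> r" "r < 1"
  shows "ennpowr (\<integral>\<^sup>+t\<in>{0..2*pi}. ennpowr (\<integral>\<^sup>+\<theta>. ennreal (cmod (boundary_value f (cis \<theta>) - f (of_real r * cis t)))
     \<partial>poisson_measure (of_real r * cis t)) p \<partial>lebesgue) (q / p) = ennpowr (deviation r) q"
proof -
  interpret sigma_finite_measure circ by (rule sigma_finite_circ)
  have z: "cmod (of_real r * cis t) < 1" for t using r by (simp add: norm_mult)
  note [measurable] = borel_f[OF r]
  have "(\<integral>\<^sup>+\<theta>. ennreal (cmod (boundary_value f (cis \<theta>) - f (of_real r * cis t))) \<partial>poisson_measure (of_real r * cis t)) =
    (\<integral>\<^sup>+\<theta>. ennreal (cmod (\<psi> \<theta> - f (of_real r * cis t))) * ennreal (poisson (of_real r * cis t) \<theta>) \<partial>circ)" for t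
  proof -
    let ?z = "of_real r * cis t"
    define B where "B \<theta> = ennreal (cmod (boundary_value f (cis \<theta>) - f ?z))" for \<theta>
    have pm: "poisson_measure ?z = density (lebesgue_on {0..<2*pi}) (\<lambda>\<theta>. ennreal (poisson ?z \<theta>))"
      by (simp add: poisson_measure_def poisson_def)
    have B_AE: "AE \<theta> in lborel. ennreal (cmod (\<psi> \<theta> - f ?z)) = B \<theta>"
      using boundary_value_AE by eventually_elim (simp add: B_def)
    have B_meas: "B \<in> borel_measurable lebesgue"
    proof -
      have "(\<lambda>\<theta>. boundary_value f (cis \<theta>)) \<in> borel_measurable lebesgue"
        by (rule borel_measurable_AE[of \<psi>]) (auto intro!: measurable_completion AE_completion eventually_mono[OF boundary_value_AE])
      then show ?thesis unfolding B_def by measurable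
    qed
    have [measurable]: "B \<in> borel_measurable (lebesgue_on {0..<2*pi})"
      using B_meas by (rule measurable_restrict_space1)
    have P [measurable]: "(\<lambda>\<theta>. ennreal (poisson ?z \<theta>)) \<in> borel_measurable (lebesgue_on {0..<2*pi})"
      by (intro measurable_restrict_space1 measurable_completion) measurable
    have "(\<integral>\<^sup>+\<theta>. B \<theta> \<partial>poisson_measure ?z) = (\<integral>\<^sup>+\<theta>. ennreal (poisson ?z \<theta>) * B \<theta> \<partial>lebesgue_on {0..<2*pi})"
      unfolding pm by (rule nn_integral_density) measurable
    also have "\<dots> = (\<integral>\<^sup>+\<theta>. ennreal (poisson ?z \<theta>) * B \<theta> * indicator {0..<2*pi} \<theta> \<partial>lborel)"
      by (subst nn_integral_restrict_space) (auto simp: nn_integral_completion)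
    also have "\<dots> = (\<integral>\<^sup>+\<theta>. ennreal (cmod (\<psi> \<theta> - f ?z)) * ennreal (poisson ?z \<theta>) * indicator {0..<2*pi} \<theta> \<partial>lborel)"
      by (intro nn_integral_cong_AE) (use B_AE in \<open>auto elim!: eventually_mono simp: mult.commute\<close>)
    also have "\<dots> = (\<integral>\<^sup>+\<theta>. ennreal (cmod (\<psi> \<theta> - f ?z)) * ennreal (poisson ?z \<theta>) \<partial>circ)"
      by (rule nn_integral_circ_half_open[symmetric]) measurable
    finally show ?thesis by (simp add: B_def)
  qed
  then show ?thesis unfolding deviation_def
    by (subst nn_integral_lebesgue_circ) (auto simp: ennpowr_Lpn p_pos)
qed

lemma modulus_finite:
  assumes "hardy_norm p f < top" shows "modulus t < top"
proof -
  have "modulus t \<le> 2 * (ennreal ((2 * pi) powr (1 / p)) * hardy_norm p f)"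
    unfolding modulus_def using osc_le Lpn_psi_le
    by (intro SUP_least) (meson mult_left_mono order_trans zero_le)
  also have "\<dots> < top" using assms by (simp add: ennreal_mult_less_top)
  finally show ?thesis .
qed

text \<open>The constant is 1 because the normalizing factor
  \<open>(1 / (2 * pi)) powr (1 / p)\<close> in \<open>Mp\<close> is at most 1.\<close>

lemma mixed_norm_le_deviation:
  assumes q: "0 < q"
  shows "mixed_norm_pow p q \<nu> (deriv f) \<le> (\<integral>\<^sup>+r\<in>{0..<1}. ennpowr (deviation r) q * ennreal (\<nu> (of_real r) / (1 - r) powr q) \<partial>lebesgue)"
  unfolding mixed_norm_pow_def
proof (rule nn_integral_mono)
  fix r
  show "ennpowr (Mp p r (deriv f)) q * ennreal (\<nu> (of_real r)) * indicator {0..<1} r \<le>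
    ennpowr (deviation r) q * ennreal (\<nu> (of_real r) / (1 - r) powr q) * indicator {0..<1} r"
  proof (cases "r \<in> {0..<1}")
    case True
    then have r: "0 \<le> r" "r < 1" by auto
    have "(1 / (2 * pi)) powr (1 / p) \<le> 1 powr (1 / p)" using p_pos pi_gt3 by (intro powr_mono2) auto
    then have "Mp p r (deriv f) \<le> ennreal 1 * circ_norm p (deriv f) r"
      unfolding Mp_eq_circ_norm[OF deriv_hol r p_pos(1)] by (intro mult_right_mono ennreal_leI) auto
    then have "ennreal (1 - r) * Mp p r (deriv f) \<le> ennreal (1 - r) * circ_norm p (deriv f) r"
      by (intro mult_left_mono) auto
    also have "\<dots> \<le> deviation r" by (rule circ_norm_deriv_le_deviation[OF r])
    finally have "ennreal (1 - r) * Mp p r (deriv f) \<le> deviation r" .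
    then have "ennpowr (ennreal (1 - r) * Mp p r (deriv f)) q \<le> ennpowr (deviation r) q"
      using q by (intro ennpowr_mono) auto
    then have le: "ennreal ((1 - r) powr q) * ennpowr (Mp p r (deriv f)) q \<le> ennpowr (deviation r) q"
      using r by (simp add: ennpowr_mult ennpowr_ennreal)
    have "ennreal (\<nu> (of_real r)) = ennreal ((1 - r) powr q) * ennreal (\<nu> (of_real r) / (1 - r) powr q)"
      using r by (subst ennreal_mult'[symmetric]) auto
    then have "ennpowr (Mp p r (deriv f)) q * ennreal (\<nu> (of_real r)) =
        (ennreal ((1 - r) powr q) * ennpowr (Mp p r (deriv f)) q) * ennreal (\<nu> (of_real r) / (1 - r) powr q)"
      by (simp only: ac_simps)
    also have "\<dots> \<le> ennpowr (deviation r) q * ennreal (\<nu> (of_real r) / (1 - r) powr q)"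
      by (rule mult_right_mono[OF le]) simp
    finally show ?thesis using True by simp
  qed simp
qed

text \<open>On the \<open>n\<close>-th block \<open>1 / (1 - r)\<close> is at most
  \<open>2 * 2^n\<close>, which cancels the \<open>2^-n\<close> of
  \<open>deviation_le_dyadic\<close>; there remains \<open>2 * 2048 = 4096\<close>.\<close>

lemma deviation_integral_le_sum:
  assumes q: "0 < q" and fin: "hardy_norm p f < top" and \<nu>: "\<And>s. 0 \<le> s \<Longrightarrow> s < 1 \<Longrightarrow> 0 \<le> \<nu> (of_real s)"
  shows "(\<integral>\<^sup>+r\<in>{0..<1}. ennpowr (deviation r) q * ennreal (\<nu> (of_real r) / (1 - r) powr q) \<partial>lebesgue) \<le>
    ennreal (4096 powr q) * (\<Sum>n. ennpowr (\<Sum>k. of_bool (k \<le> n) * (ennreal (2 ^ k) * modulus ((1/2) ^ k))) q * block \<nu> n)"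
proof -
  define X where "X n = (\<Sum>k. of_bool (k \<le> n) * (ennreal (2 ^ k) * modulus ((1/2) ^ k)))" for n :: nat
  have "X n = (\<Sum>k\<le>n. ennreal (2 ^ k) * modulus ((1/2) ^ k))" for n
    unfolding X_def by (subst suminf_finite[of "{..n}"]) auto
  then have X_fin: "X n < top" for n
    using modulus_finite[OF fin] by (simp add: ennreal_mult_less_top)
  have "(\<integral>\<^sup>+r\<in>{0..<1}. ennpowr (deviation r) q * ennreal (\<nu> (of_real r) / (1 - r) powr q) \<partial>lebesgue) \<le>
      (\<Sum>n. (ennreal (4096 powr q) * ennpowr (X n) q) * (\<integral>\<^sup>+s\<in>dyadic n. ennreal (\<nu> (of_real s)) \<partial>lebesgue))"
  proof (rule lower_integral_dyadic_le)
    show "ennreal (4096 powr q) * ennpowr (X n) q < top" for n using X_fin by (simp add: ennreal_mult_less_top)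
    fix n r assume r: "r \<in> dyadic n"
    note b = dyadic_bounds[OF r]
    have "ennpowr (deviation r) q \<le> ennpowr (ennreal (2048 * (1/2) ^ n) * X n) q"
      unfolding X_def using q b by (intro ennpowr_mono deviation_le_dyadic) auto
    also have "\<dots> = ennreal ((2048 * (1/2) ^ n) powr q) * ennpowr (X n) q"
      by (simp add: ennpowr_mult ennpowr_ennreal)
    finally have 1: "ennpowr (deviation r) q \<le> ennreal ((2048 * (1/2) ^ n) powr q) * ennpowr (X n) q" .
    have "\<nu> (of_real r) / (1 - r) powr q \<le> 2 powr q * (2 ^ n) powr q * \<nu> (of_real r)"
      using mult_right_mono[OF dyadic_inverse_powr(2)[OF r q] \<nu>[OF b(1,2)]] by simp
    then have 2: "ennreal (\<nu> (of_real r) / (1 - r) powr q) \<le> ennreal (2 powr q * (2 ^ n) powr q * \<nu> (of_real r))" by (rule ennreal_leI)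
    have "ennpowr (deviation r) q * ennreal (\<nu> (of_real r) / (1 - r) powr q) \<le>
       (ennreal ((2048 * (1/2) ^ n) powr q) * ennpowr (X n) q) * ennreal (2 powr q * (2 ^ n) powr q * \<nu> (of_real r))"
      by (intro mult_mono 1 2) auto
    also have "\<dots> = (ennreal ((2048 * (1/2) ^ n) powr q) * ennreal (2 powr q * (2 ^ n) powr q)) * ennpowr (X n) q * ennreal (\<nu> (of_real r))"
      using \<nu>[OF b(1,2)] by (simp add: ennreal_mult ac_simps)
    also have "ennreal ((2048 * (1/2) ^ n) powr q) * ennreal (2 powr q * (2 ^ n) powr q) = ennreal (4096 powr q)"
    proof -
      have "2048 * (1/2) ^ n * (2 * 2 ^ n) = (4096::real)" by (simp add: power_one_over)
      then have "(2048 * (1/2) ^ n) powr q * (2 powr q * (2 ^ n) powr q) = 4096 powr q"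
        by (metis (no_types) powr_mult)
      then show ?thesis by (simp flip: ennreal_mult)
    qed
    finally show "ennpowr (deviation r) q * ennreal (\<nu> (of_real r) / (1 - r) powr q) \<le>
      ennreal (4096 powr q) * ennpowr (X n) q * ennreal (\<nu> (of_real r))" .
  qed
  then show ?thesis unfolding block_def X_def by (simp only: mult.assoc ennreal_suminf_cmult)
qed

text \<open>On the \<open>n\<close>-th block only \<open>1 - s > 2^-(n+1)\<close> is known, so the
  modulus at \<open>2^-n\<close> is first halved in its argument; this doubling is the factor
  \<open>2 powr q\<close>.\<close>

lemma sum_le_modulus_integral:
  assumes q: "0 < q" and \<nu>: "\<And>s. 0 \<le> s \<Longrightarrow> s < 1 \<Longrightarrow> 0 \<le> \<nu> (of_real s)"
  shows "(\<Sum>n. ennpowr (ennreal (2 ^ n) * modulus ((1/2) ^ n)) q * block \<nu> n) \<le>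
    ennreal (2 powr q) * (\<integral>\<^sup>+s\<in>{0..<1}. ennpowr (modulus (1 - s)) q * ennreal (\<nu> (of_real s) / (1 - s) powr q) \<partial>lebesgue)"
proof -
  define c where "c n = ennpowr (modulus ((1/2) ^ Suc n)) q * ennreal ((2 ^ n) powr q)" for n
  have "ennpowr (ennreal (2 ^ n) * modulus ((1/2) ^ n)) q \<le> ennreal (2 powr q) * c n" for n
  proof -
    have "modulus ((1/2) ^ n) \<le> ennreal 2 * modulus ((1/2) ^ Suc n)"
      using modulus_double[of "(1/2) ^ Suc n"] by simp
    then have "ennpowr (ennreal (2 ^ n) * modulus ((1/2) ^ n)) q \<le> ennpowr (ennreal (2 ^ n) * (ennreal 2 * modulus ((1/2) ^ Suc n))) q"
      using q by (intro ennpowr_mono mult_left_mono) auto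
    also have "\<dots> = ennreal (2 powr q) * c n"
      unfolding c_def ennpowr_mult by (simp add: ennpowr_ennreal ac_simps del: ennreal_numeral)
    finally show ?thesis .
  qed
  then have "(\<Sum>n. ennpowr (ennreal (2 ^ n) * modulus ((1/2) ^ n)) q * block \<nu> n) \<le> (\<Sum>n. ennreal (2 powr q) * c n * block \<nu> n)"
    by (intro suminf_le mult_right_mono) auto
  also have "\<dots> = ennreal (2 powr q) * (\<Sum>n. c n * block \<nu> n)" by (simp add: mult.assoc)
  also have "(\<Sum>n. c n * block \<nu> n) \<le> (\<integral>\<^sup>+s\<in>{0..<1}. ennpowr (modulus (1 - s)) q * ennreal (\<nu> (of_real s) / (1 - s) powr q) \<partial>lebesgue)"
    unfolding block_def
  proof (rule lower_integral_dyadic_ge)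
    fix n s assume s: "s \<in> dyadic n"
    note b = dyadic_bounds[OF s]
    have 1: "ennpowr (modulus ((1/2) ^ Suc n)) q \<le> ennpowr (modulus (1 - s)) q"
      using b q by (intro ennpowr_mono modulus_mono) auto
    have "(2 ^ n) powr q * \<nu> (of_real s) \<le> \<nu> (of_real s) / (1 - s) powr q"
      using mult_right_mono[OF dyadic_inverse_powr(1)[OF s q] \<nu>[OF b(1,2)]] by simp
    then have 2: "ennreal ((2 ^ n) powr q) * ennreal (\<nu> (of_real s)) \<le> ennreal (\<nu> (of_real s) / (1 - s) powr q)"
      using \<nu>[OF b(1,2)] by (simp flip: ennreal_mult add: ennreal_leI)
    show "c n * ennreal (\<nu> (of_real s)) \<le> ennpowr (modulus (1 - s)) q * ennreal (\<nu> (of_real s) / (1 - s) powr q)"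
      unfolding c_def mult.assoc by (intro mult_mono 1 2) auto
  qed
  finally show ?thesis by (simp add: mult_left_mono)
qed

text \<open>One factor \<open>2 powr q\<close> comes from \<open>modulus_le_deriv\<close>, the other
  from \<open>1 / (1 - s) \<le> 2 * 2^n\<close> on the block.\<close>

lemma modulus_integral_le_sum:
  assumes q: "0 < q" and fin: "hardy_norm p f < top" and \<nu>: "\<And>s. 0 \<le> s \<Longrightarrow> s < 1 \<Longrightarrow> 0 \<le> \<nu> (of_real s)"
  shows "(\<integral>\<^sup>+s\<in>{0..<1}. ennpowr (modulus (1 - s)) q * ennreal (\<nu> (of_real s) / (1 - s) powr q) \<partial>lebesgue) \<le>
    ennreal (4 powr q) * (\<Sum>n. ennpowr (\<Sum>k. of_bool (n \<le> k) * (ennreal ((1/2) ^ k) * circ_norm p (deriv f) (1 - (1/2) ^ Suc k))) q *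
      (ennreal ((2 ^ n) powr q) * block \<nu> n))"
proof -
  define X where "X n = (\<Sum>k. of_bool (n \<le> k) * (ennreal ((1/2) ^ k) * circ_norm p (deriv f) (1 - (1/2) ^ Suc k)))" for n
  define c where "c n = ennpowr (modulus ((1/2) ^ n)) q * ennreal (2 powr q * (2 ^ n) powr q)" for n
  have "(\<integral>\<^sup>+s\<in>{0..<1}. ennpowr (modulus (1 - s)) q * ennreal (\<nu> (of_real s) / (1 - s) powr q) \<partial>lebesgue) \<le> (\<Sum>n. c n * block \<nu> n)"
    unfolding block_def
  proof (rule lower_integral_dyadic_le)
    show "c n < top" for n using modulus_finite[OF fin] by (simp add: c_def ennreal_mult_less_top)
    fix n s assume s: "s \<in> dyadic n"
    note b = dyadic_bounds[OF s]
    have 1: "ennpowr (modulus (1 - s)) q \<le> ennpowr (modulus ((1/2) ^ n)) q"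
      using b q by (intro ennpowr_mono modulus_mono) auto
    have "\<nu> (of_real s) / (1 - s) powr q \<le> 2 powr q * (2 ^ n) powr q * \<nu> (of_real s)"
      using mult_right_mono[OF dyadic_inverse_powr(2)[OF s q] \<nu>[OF b(1,2)]] by simp
    then have 2: "ennreal (\<nu> (of_real s) / (1 - s) powr q) \<le> ennreal (2 powr q * (2 ^ n) powr q) * ennreal (\<nu> (of_real s))"
      using \<nu>[OF b(1,2)] by (subst ennreal_mult[symmetric]) (auto intro: ennreal_leI)
    show "ennpowr (modulus (1 - s)) q * ennreal (\<nu> (of_real s) / (1 - s) powr q) \<le> c n * ennreal (\<nu> (of_real s))"
      unfolding c_def mult.assoc by (intro mult_mono 1 2) auto
  qed
  also have "\<dots> \<le> (\<Sum>n. ennreal (4 powr q) * (ennpowr (X n) q * (ennreal ((2 ^ n) powr q) * block \<nu> n)))"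
  proof (intro suminf_le)
    fix n
    have "ennpowr (modulus ((1/2) ^ n)) q \<le> ennpowr (ennreal 2 * X n) q"
      using modulus_le_deriv[of n] q by (intro ennpowr_mono) (auto simp: X_def)
    also have "\<dots> = ennreal (2 powr q) * ennpowr (X n) q" by (simp add: ennpowr_mult ennpowr_ennreal del: ennreal_numeral)
    finally have "c n * block \<nu> n \<le> ennreal (2 powr q) * ennpowr (X n) q * ennreal (2 powr q * (2 ^ n) powr q) * block \<nu> n"
      unfolding c_def by (intro mult_right_mono) auto
    also have "\<dots> = ennreal (2 powr q) * ennreal (2 powr q) * (ennpowr (X n) q * (ennreal ((2 ^ n) powr q) * block \<nu> n))"
      by (simp add: ennreal_mult ac_simps)
    also have "ennreal (2 powr q) * ennreal (2 powr q) = ennreal (4 powr q)"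
      by (simp flip: ennreal_mult powr_mult)
    finally show "c n * block \<nu> n \<le> ennreal (4 powr q) * (ennpowr (X n) q * (ennreal ((2 ^ n) powr q) * block \<nu> n))" .
  qed auto
  finally show ?thesis by (simp add: X_def)
qed

text \<open>Here the mean is taken at the left end of each block, where monotonicity bounds it by
  the means inside; \<open>2 * pi\<close> undoes the normalization in \<open>Mp\<close>.\<close>

lemma sum_le_mixed_norm:
  assumes q: "0 < q"
  shows "(\<Sum>n. ennpowr (circ_norm p (deriv f) (1 - (1/2) ^ n)) q * block \<nu> n) \<le>
    ennreal ((2 * pi) powr (q / p)) * mixed_norm_pow p q \<nu> (deriv f)"
proof -
  have c: "ennpowr (circ_norm p (deriv f) r) q = ennreal ((2 * pi) powr (q / p)) * ennpowr (Mp p r (deriv f)) q" if r: "0 \<le> r" "r < 1" for r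
  proof -
    have "circ_norm p (deriv f) r = ennreal ((2 * pi) powr (1 / p)) * Mp p r (deriv f)"
      using p_pos by (simp add: Mp_eq_circ_norm[OF deriv_hol r] mult.assoc[symmetric] flip: ennreal_mult powr_mult)
    then show ?thesis by (simp add: ennpowr_mult ennpowr_ennreal powr_powr)
  qed
  have r: "0 \<le> 1 - (1/2::real) ^ n" "1 - (1/2::real) ^ n < 1" for n by (auto simp: power_le_one)
  have "(\<Sum>n. ennpowr (circ_norm p (deriv f) (1 - (1/2) ^ n)) q * block \<nu> n) =
      ennreal ((2 * pi) powr (q / p)) * (\<Sum>n. ennpowr (Mp p (1 - (1/2) ^ n) (deriv f)) q * block \<nu> n)"
    by (simp add: c[OF r] mult.assoc)
  also have "(\<Sum>n. ennpowr (Mp p (1 - (1/2) ^ n) (deriv f)) q * block \<nu> n) \<le> mixed_norm_pow p q \<nu> (deriv f)"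
    unfolding block_def mixed_norm_pow_def
  proof (rule lower_integral_dyadic_ge)
    fix n s assume s: "s \<in> dyadic n"
    note b = dyadic_bounds[OF s]
    have "Mp p (1 - (1/2) ^ n) (deriv f) \<le> Mp p s (deriv f)"
      unfolding Mp_eq_circ_norm[OF deriv_hol r p_pos(1)] Mp_eq_circ_norm[OF deriv_hol b(1,2) p_pos(1)]
      by (intro mult_left_mono circ_norm_mono deriv_hol p r b) auto
    then show "ennpowr (Mp p (1 - (1/2) ^ n) (deriv f)) q * ennreal (\<nu> (of_real s)) \<le> ennpowr (Mp p s (deriv f)) q * ennreal (\<nu> (of_real s))"
      using q by (intro mult_right_mono ennpowr_mono) auto
  qed
  finally show ?thesis by (simp add: mult_left_mono)
qed

end

section \<open>Assembly of the chain of inequalities\<close>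

theorem theorem2:
  fixes p q :: real and \<nu> :: "complex \<Rightarrow> real"
  assumes "1 \<le> p" and "0 < q" and "\<nu> \<in> D_class \<inter> D_hat_sub q"
  shows "\<exists>C1 C2 :: real. C1 > 0 \<and> C2 > 0 \<and> (\<forall>f\<in>hardy_space p.
    (let W = (\<integral>\<^sup>+r\<in>{0..<1}.
           ennpowr (\<integral>\<^sup>+t\<in>{0..2*pi}.
              ennpowr (\<integral>\<^sup>+\<theta>. ennreal (cmod (boundary_value f (cis \<theta>) - f (of_real r * cis t)))
                          \<partial>poisson_measure (of_real r * cis t)) p \<partial>lebesgue) (q / p)
           * ennreal (\<nu> (of_real r) / (1 - r) powr q) \<partial>lebesgue);
         S = (\<integral>\<^sup>+s\<in>{0..<1}. ennpowr (Lp_modulus p (1 - s) f) q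
                * ennreal (\<nu> (of_real s) / (1 - s) powr q) \<partial>lebesgue)
             + ennpowr (hardy_norm p f) q;
         A = mixed_norm_pow p q \<nu> (deriv f)
     in A \<le> W
      \<and> W \<le> ennreal C1 * S
      \<and> ennreal C1 * S \<le> ennreal C2 * (A + ennpowr (hardy_norm p f) q)))"
proof -
  note p = assms(1) and q = assms(2)
  have \<nu>D: "\<nu> \<in> D_class" and \<nu>q: "\<nu> \<in> D_hat_sub q" using assms(3) by auto
  note \<nu>_nn = weight_nonneg[OF \<nu>q]
  let ?T = "\<lambda>n. tail \<nu> (1 - (1/2) ^ n)"
  obtain c0 M D where dw: "dyadic_weight (block \<nu>) ?T c0 M" and D: "0 \<le> D" "\<And>n. ?T n \<le> ennreal D * ?T (Suc n)"
    by (rule dyadic_weight_exists[OF \<nu>D]) (rule that)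
  interpret dyadic_weight "block \<nu>" ?T c0 M by (rule dw)
  \<comment> \<open>When all tails are infinite the right side is infinite already for
    \<open>E = 1\<close>.\<close>
  have "\<exists>E\<ge>0. \<forall>k. (\<Sum>n<k. ennreal ((2 ^ n) powr q) * block \<nu> n) \<le> ennreal E * (ennreal ((2 ^ k) powr q) * ?T k)"
    using finite_or_top
  proof
    assume "\<forall>n. ?T n < top"
    then have fin: "\<And>n. ?T n < top" by blast
    show ?thesis by (rule D_hat_sub_dyadic[OF \<nu>q q fin]) blast
  next
    assume "\<forall>n. ?T n = top"
    then show ?thesis by (intro exI[of _ 1]) (simp add: ennreal_mult_top)
  qed
  then obtain E where E: "0 \<le> E" "\<And>k. (\<Sum>n<k. ennreal ((2 ^ n) powr q) * block \<nu> n) \<le> ennreal E * (ennreal ((2 ^ k) powr q) * ?T k)"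
    by blast
  obtain CL where CL: "CL > 0" "\<And>a. incseq a \<Longrightarrow>
    (\<Sum>n. ennpowr (\<Sum>k. of_bool (k \<le> n) * a k) q * block \<nu> n) \<le> ennreal CL * (\<Sum>n. ennpowr (a n) q * block \<nu> n)"
    by (rule hardy_lower[OF q]) (rule that)
  obtain CU where CU: "CU > 0" "\<And>a. incseq a \<Longrightarrow>
    (\<Sum>n. ennpowr (\<Sum>k. of_bool (n \<le> k) * (ennreal ((1/2) ^ k) * a (Suc k))) q * (ennreal ((2 ^ n) powr q) * block \<nu> n)) \<le>
    ennreal CU * (\<Sum>n. ennpowr (a n) q * block \<nu> n)"
    by (rule hardy_upper[OF q D(1) E(1) D(2) E(2)]) (rule that)
  \<comment> \<open>The factors of \<open>C1\<close> come, in order, from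
    \<open>deviation_integral_le_sum\<close>, \<open>hardy_lower\<close> and
    \<open>sum_le_modulus_integral\<close>; those of \<open>K\<close> from
    \<open>modulus_integral_le_sum\<close>, \<open>hardy_upper\<close> and
    \<open>sum_le_mixed_norm\<close>.\<close>
  define C1 where "C1 = 4096 powr q * (CL * 2 powr q)"
  define K where "K = 4 powr q * (CU * (2 * pi) powr (q / p))"
  have C1: "C1 > 0" using CL by (simp add: C1_def)
  have K: "K > 0" using CU by (simp add: K_def)
  show ?thesis
  proof (rule exI[of _ C1], rule exI[of _ "C1 * (K + 1)"], intro conjI ballI)
    show "C1 > 0" by (rule C1)
    show "C1 * (K + 1) > 0" using C1 K by simp
    fix f assume f: "f \<in> hardy_space p"
    then have fin: "hardy_norm p f < top" by (simp add: hardy_space_def)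
    obtain R \<psi> where "hardy_boundary p f R \<psi>" by (rule hardy_boundary_exists[OF p f]) (rule that)
    then interpret hardy_boundary p f R \<psi> .
    define W where "W = (\<integral>\<^sup>+r\<in>{0..<1}. ennpowr (deviation r) q * ennreal (\<nu> (of_real r) / (1 - r) powr q) \<partial>lebesgue)"
    define S where "S = (\<integral>\<^sup>+s\<in>{0..<1}. ennpowr (modulus (1 - s)) q * ennreal (\<nu> (of_real s) / (1 - s) powr q) \<partial>lebesgue)"
    define A where "A = mixed_norm_pow p q \<nu> (deriv f)"
    define H where "H = ennpowr (hardy_norm p f) q"
    have W_eq: "(\<integral>\<^sup>+r\<in>{0..<1}. ennpowr (\<integral>\<^sup>+t\<in>{0..2*pi}.
          ennpowr (\<integral>\<^sup>+\<theta>. ennreal (cmod (boundary_value f (cis \<theta>) - f (of_real r * cis t)))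
            \<partial>poisson_measure (of_real r * cis t)) p \<partial>lebesgue) (q / p)
           * ennreal (\<nu> (of_real r) / (1 - r) powr q) \<partial>lebesgue) = W"
      unfolding W_def using poisson_deviation_eq
      by (intro nn_integral_cong) (auto split: split_indicator)
    have AW: "A \<le> W" unfolding A_def W_def by (rule mixed_norm_le_deviation[OF q])
    have WS: "W \<le> ennreal C1 * S"
    proof -
      let ?a = "\<lambda>k. ennreal (2 ^ k) * modulus ((1/2) ^ k)"
      \<comment> \<open>This is the doubling inequality for the modulus, multiplied by
        \<open>2 ^ k\<close>.\<close>
      have a: "incseq ?a"
      proof (rule incseq_SucI)
        fix k
        have "modulus ((1/2) ^ k) \<le> ennreal 2 * modulus ((1/2) ^ Suc k)"
          using modulus_double[of "(1/2) ^ Suc k"] by simp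
        then have "?a k \<le> ennreal (2 ^ k) * (ennreal 2 * modulus ((1/2) ^ Suc k))" by (rule mult_left_mono) simp
        also have "\<dots> = ?a (Suc k)"
          by (simp only: mult.assoc[symmetric] ennreal_mult[symmetric] power_Suc2 zero_le_power zero_le_numeral)
        finally show "?a k \<le> ?a (Suc k)" .
      qed
      have "W \<le> ennreal (4096 powr q) * (\<Sum>n. ennpowr (\<Sum>k. of_bool (k \<le> n) * ?a k) q * block \<nu> n)"
        unfolding W_def by (rule deviation_integral_le_sum[where \<nu>=\<nu>, OF q fin \<nu>_nn])
      also have "\<dots> \<le> ennreal (4096 powr q) * (ennreal CL * (\<Sum>n. ennpowr (?a n) q * block \<nu> n))"
        by (intro mult_left_mono CL a) simp
      also have "\<dots> \<le> ennreal (4096 powr q) * (ennreal CL * (ennreal (2 powr q) * S))"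
        unfolding S_def by (intro mult_left_mono sum_le_modulus_integral q \<nu>_nn) auto
      also have "\<dots> = ennreal C1 * S" using CL by (simp add: C1_def ennreal_mult mult.assoc)
      finally show ?thesis .
    qed
    have SA: "S \<le> ennreal K * A"
    proof -
      let ?a = "\<lambda>k. circ_norm p (deriv f) (1 - (1/2) ^ k)"
      have a: "incseq ?a"
        by (intro incseq_SucI circ_norm_mono deriv_hol p) (auto simp: power_le_one)
      have "S \<le> ennreal (4 powr q) * (\<Sum>n. ennpowr (\<Sum>k. of_bool (n \<le> k) * (ennreal ((1/2) ^ k) * ?a (Suc k))) q *
          (ennreal ((2 ^ n) powr q) * block \<nu> n))"
        unfolding S_def by (rule modulus_integral_le_sum[where \<nu>=\<nu>, OF q fin \<nu>_nn])
      also have "\<dots> \<le> ennreal (4 powr q) * (ennreal CU * (\<Sum>n. ennpowr (?a n) q * block \<nu> n))"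
        by (intro mult_left_mono CU(2)[OF a]) simp
      also have "\<dots> \<le> ennreal (4 powr q) * (ennreal CU * (ennreal ((2 * pi) powr (q / p)) * A))"
        unfolding A_def by (intro mult_left_mono sum_le_mixed_norm q) auto
      also have "\<dots> = ennreal K * A" using CU by (simp add: K_def ennreal_mult mult.assoc)
      finally show ?thesis .
    qed
    \<comment> \<open>The comparisons above are between \<open>W\<close>, \<open>S\<close> and
      \<open>A\<close>; the power \<open>H\<close> of the Hardy norm is now added on both sides, and
      \<open>K + 1\<close> dominates both \<open>K\<close> and 1.\<close>
    have "S + H \<le> ennreal (K + 1) * (A + H)"
    proof -
      have "S + H \<le> ennreal K * A + 1 * H" using SA by (intro add_mono) auto
      also have "\<dots> \<le> ennreal (K + 1) * A + ennreal (K + 1) * H"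
        using K by (intro add_mono mult_right_mono) (auto intro: ennreal_leI simp flip: ennreal_1)
      finally show ?thesis by (simp add: distrib_left)
    qed
    then have "ennreal C1 * (S + H) \<le> ennreal C1 * (ennreal (K + 1) * (A + H))" by (rule mult_left_mono) simp
    also have "\<dots> = ennreal (C1 * (K + 1)) * (A + H)" using C1 K by (subst ennreal_mult) (auto simp: mult.assoc)
    finally have SH: "ennreal C1 * (S + H) \<le> ennreal (C1 * (K + 1)) * (A + H)" .
    have "ennreal C1 * S \<le> ennreal C1 * (S + H)" by (intro mult_left_mono) auto
    then have "W \<le> ennreal C1 * (S + H)" using WS by (rule order_trans[rotated])
    with AW SH show "let W = (\<integral>\<^sup>+r\<in>{0..<1}.
           ennpowr (\<integral>\<^sup>+t\<in>{0..2*pi}.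
              ennpowr (\<integral>\<^sup>+\<theta>. ennreal (cmod (boundary_value f (cis \<theta>) - f (of_real r * cis t)))
                          \<partial>poisson_measure (of_real r * cis t)) p \<partial>lebesgue) (q / p)
           * ennreal (\<nu> (of_real r) / (1 - r) powr q) \<partial>lebesgue);
         S = (\<integral>\<^sup>+s\<in>{0..<1}. ennpowr (Lp_modulus p (1 - s) f) q
                * ennreal (\<nu> (of_real s) / (1 - s) powr q) \<partial>lebesgue)
             + ennpowr (hardy_norm p f) q;
         A = mixed_norm_pow p q \<nu> (deriv f)
     in A \<le> W
      \<and> W \<le> ennreal C1 * S
      \<and> ennreal C1 * S \<le> ennreal (C1 * (K + 1)) * (A + ennpowr (hardy_norm p f) q)"
      unfolding Let_def W_eq Lp_modulus_eq A_def[symmetric] S_def[symmetric] H_def[symmetric] by blast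
  qed
qed

end
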